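(* Let $\mathbb{K}$ be an arbitrary field. For quadratic $\mathbb{K}$-algebras $A$ satisfying $\dim A_1=\dim A_2=3$, the complete list of possible Hilbert series is $\{H_1,\dots,H_{11}\}$; that is, every such $A$ satisfies $H_A\in\{H_1,\dots,H_{11}\}$, and each $H_j$ with $1\leqslant j\leqslant 11$ is the Hilbert series of some such $A$. Here $$H_1(t)=1+3t+3t^2;$$ $$H_2(t)=1+3t+3t^2+t^3=(1+t)^3;$$ $$H_3(t)=1+3t+3t^2+t^3+t^4+t^5+\cdots=\frac{1+2t-2t^3}{1-t};$$ $$H_4(t)=1+3t+3t^2+2t^3;$$ $$H_5(t)=1+3t+3t^2+2t^3+t^4;$$ $$H_6(t)=1+3t+3t^2+2t^3+t^4+t^5+\cdots=\frac{1+2t-t^3-t^4}{1-t};$$ $$H_7(t)=1+3t+3t^2+2t^3+2t^4+2t^5+\cdots=\frac{1+2t-t^3}{1-t};$$ $$H_8(t)=1+3t+3t^2+3t^3+3t^4+3t^5+\cdots=\frac{1+2t}{1-t};$$ $$H_9(t)=1+3t+3t^2+4t^3+4t^4+4t^5+\cdots=\frac{1+2t+t^3}{1-t};$$ $$H_{10}(t)=1+3t+3t^2+4t^3+5t^4+6t^5+\cdots=\frac{1+t-2t^2+t^3}{(1-t)^2};$$ $$H_{11}(t)=1+3t+3t^2+5t^3+8t^4+13t^5+\cdots=\frac{1+2t-t^2-t^3}{1-t-t^2},$$ where the coefficients of $H_{11}$, starting from the third term, are consecutive Fibonacci numbers.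
   Context: For a finite-dimensional vector space $V$ over $\mathbb{K}$, let $F(V)$ be the tensor (free associative) algebra of $V$, with the degree grading. For a subspace $R\subseteq V\otimes V$, the quadratic algebra $A=A(V,R)$ is the quotient of $F(V)$ by the two-sided ideal generated by $R$, with the induced grading $A=\bigoplus_{m\geqslant 0}A_m$. Its Hilbert series is $H_A(t)=\sum_{j=0}^\infty \dim_{\mathbb{K}}(A_j)\,t^j$. *)

theory Defs
  imports
    "HOL-Library.Poly_Mapping"
    "HOL-Algebra.QuotRing"
    "HOL-Algebra.Embedded_Algebras"
    "HOL-Computational_Algebra.Formal_Power_Series"
begin

text \<open>
  Words form the free monoid, written additively because the convolution product of
  \<^theory>\<open>HOL-Library.Poly_Mapping\<close> is indexed by an additive monoid (which need not commute).
  Finitely supported functions from words to \<open>'k\<close> are the noncommutative polynomials.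
\<close>

datatype word = Word (letters: "nat list")

instantiation word :: monoid_add
begin

definition zero_word :: word
  where "0 = Word []"

definition plus_word :: "word \<Rightarrow> word \<Rightarrow> word"
  where "u + v = Word (letters u @ letters v)"

instance
  by standard (simp_all add: zero_word_def plus_word_def)

end

type_synonym 'k ncpoly = "word \<Rightarrow>\<^sub>0 'k"

text \<open>
  Here \<open>V\<close> is the \<open>n\<close>-dimensional space with basis the letters \<open>0, \<dots>, n - 1\<close>, so that \<open>F(V)\<close> is
  the free associative algebra on these letters and \<open>V \<otimes> V\<close> is its component of degree 2.
\<close>

definition free_algebra :: "nat \<Rightarrow> 'k::field ncpoly ring"
  where "free_algebra n =
    \<lparr>carrier = {f. \<forall>w \<in> Poly_Mapping.keys f. set (letters w) \<subseteq> {..<n}},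
     monoid.mult = (*), one = 1, zero = 0, add = (+)\<rparr>"

definition free_component :: "nat \<Rightarrow> nat \<Rightarrow> 'k::field ncpoly set"
  where "free_component n m =
    {f \<in> carrier (free_algebra n). \<forall>w \<in> Poly_Mapping.keys f. length (letters w) = m}"

definition const :: "'k::field \<Rightarrow> 'k ncpoly"
  where "const c = Poly_Mapping.single 0 c"

definition quadratic_relations :: "nat \<Rightarrow> 'k::field ncpoly set \<Rightarrow> bool"
  where "quadratic_relations n R \<longleftrightarrow>
    R \<subseteq> free_component n 2 \<and> module.subspace (\<lambda>c f. const c * f) R"

definition relation_ideal :: "nat \<Rightarrow> 'k::field ncpoly set \<Rightarrow> 'k ncpoly set"
  where "relation_ideal n R = Idl\<^bsub>free_algebra n\<^esub> R"

definition quadratic_algebra :: "nat \<Rightarrow> 'k::field ncpoly set \<Rightarrow> 'k ncpoly set ring"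
  where "quadratic_algebra n R = free_algebra n Quot relation_ideal n R"

definition quotient_map :: "nat \<Rightarrow> 'k::field ncpoly set \<Rightarrow> 'k ncpoly \<Rightarrow> 'k ncpoly set"
  where "quotient_map n R f = relation_ideal n R +>\<^bsub>free_algebra n\<^esub> f"

text \<open>The copy of the ground field inside \<open>A\<close>, over which dimensions in \<open>A\<close> are taken.\<close>

definition ground_field :: "nat \<Rightarrow> 'k::field ncpoly set \<Rightarrow> 'k ncpoly set set"
  where "ground_field n R = quotient_map n R ` range const"

definition component :: "nat \<Rightarrow> 'k::field ncpoly set \<Rightarrow> nat \<Rightarrow> 'k ncpoly set set"
  where "component n R m = quotient_map n R ` free_component n m"

definition component_dim :: "nat \<Rightarrow> 'k::field ncpoly set \<Rightarrow> nat \<Rightarrow> nat"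
  where "component_dim n R m =
    ring.dim (quadratic_algebra n R) (ground_field n R) (component n R m)"

definition hilbert_series :: "nat \<Rightarrow> 'k::field ncpoly set \<Rightarrow> rat fps"
  where "hilbert_series n R = Abs_fps (\<lambda>m. of_nat (component_dim n R m))"

end

theory Submission
  imports Defs "HOL-Algebra.Algebraic_Closure_Type" "HOL-Analysis.Determinants"
begin

text \<open>
  The dual of \<open>A\<^sub>m\<close> is the space of \<open>m\<close>-linear forms on \<open>V\<close> each of whose adjacent pairs of
  arguments enters only through the multiplication \<open>\<mu> : V \<times> V \<rightarrow> A\<^sub>2\<close>. Its dimension does not change
  under field extension, so for the classification \<open>K\<close> may be taken algebraically closed.

  Suppose some left (or, dually, right) multiplication \<open>z : V \<rightarrow> A\<^sub>2\<close> is bijective. Identifying \<open>A\<^sub>2\<close>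
  with \<open>V\<close> by means of \<open>z\<close>, every form is determined by its values on the tuples \<open>(z, \<dots>, z, v)\<close>.
  Hence \<open>dim A\<^sub>m\<close> is nonincreasing for \<open>m \<ge> 2\<close>, and it is constant as soon as two consecutive values
  agree. This gives \<open>H\<^sub>1, \<dots>, H\<^sub>8\<close>.

  Otherwise all left and all right multiplications are singular. By Atkinson's classification of
  three-dimensional spaces of singular \<open>3 \<times> 3\<close> matrices, either \<open>\<mu>\<close> has a common kernel, or it maps
  a plane into a line, or it is a twisted exterior product, on each side. Combining the two sides
  leaves a few normal forms of \<open>\<mu>\<close>, whose dimensions are computed directly.
\<close>

text \<open>The degree \<open>m\<close> part of the ideal is a sum of spaces \<open>p R s\<close>,
  so its annihilator is cut out by one local condition for each adjacent pair of letters; no element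
  of the ideal ever has to be described. Dimension is encoded by forms dual to points, data that can
  be kept unchanged under base change. The closure serves two purposes. The vanishing of a cubic
  determinant at all points must force identities between its coefficients, which fails over small
  fields; and a binary quadratic form must have a zero, so that the relation of an algebra on two
  generators can be freed of one square. In the bijective case the normalized product on
  \<open>V\<close> is not associative. The duals of all \<open>A\<^sub>m\<close> become a decreasing
  chain inside the dual of \<open>V\<close>, and the real point is that one equality in this chain
  propagates; it rests on a weak form of associativity that holds only after applying the
  functionals in question. The converse is proved over \<open>K\<close> itself, by multiplication
  tables with entries 0 and 1.\<close>

no_notation fps_nth (infixl "$" 75)

subsection \<open>Finite-dimensional spaces of functions\<close>

definition fsub :: "('x \<Rightarrow> 'k::field) set \<Rightarrow> bool" where
  "fsub Q \<longleftrightarrow> (\<lambda>_. 0) \<in> Q \<and> (\<forall>f\<in>Q. \<forall>g\<in>Q. (\<lambda>x. f x + g x) \<in> Q) \<and> (\<forall>c. \<forall>f\<in>Q. (\<lambda>x. c * f x) \<in> Q)"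

text \<open>Dimension \<open>k\<close> is witnessed by \<open>k\<close> functions dual to evaluation
  at \<open>k\<close> points, together with the condition that these points detect every element of
  \<open>Q\<close>. Such a pair can be carried along a reindexing of the arguments or an extension
  of the field, and it yields coordinates at once: the coefficients of \<open>f\<close> are its
  values at the points.\<close>

definition dual_system :: "('x \<Rightarrow> 'k::field) set \<Rightarrow> nat \<Rightarrow> (nat \<Rightarrow> 'x \<Rightarrow> 'k) \<Rightarrow> (nat \<Rightarrow> 'x) \<Rightarrow> bool" where
  "dual_system Q k F P \<longleftrightarrow> (\<forall>i<k. F i \<in> Q) \<and> (\<forall>i<k. \<forall>j<k. F i (P j) = (if i = j then 1 else 0))
     \<and> (\<forall>f\<in>Q. (\<forall>i<k. f (P i) = 0) \<longrightarrow> f = (\<lambda>_. 0))"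

definition has_dim :: "('x \<Rightarrow> 'k::field) set \<Rightarrow> nat \<Rightarrow> bool" where
  "has_dim Q k \<longleftrightarrow> (\<exists>F P. dual_system Q k F P)"

lemma dual_systemD:
  assumes "dual_system Q k F P"
  shows "i < k \<Longrightarrow> F i \<in> Q" "i < k \<Longrightarrow> j < k \<Longrightarrow> F i (P j) = (if i = j then 1 else 0)"
    "f \<in> Q \<Longrightarrow> (\<And>i. i < k \<Longrightarrow> f (P i) = 0) \<Longrightarrow> f = (\<lambda>_. 0)"
  using assms unfolding dual_system_def by blast+

lemma has_dimI:
  assumes "\<And>i. i < k \<Longrightarrow> F i \<in> Q"
    and "\<And>i j. i < k \<Longrightarrow> j < k \<Longrightarrow> F i (P j) = (if i = j then 1 else 0)"
    and "\<And>f. f \<in> Q \<Longrightarrow> (\<And>i. i < k \<Longrightarrow> f (P i) = 0) \<Longrightarrow> f = (\<lambda>_. 0)"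
  shows "has_dim Q k"
  unfolding has_dim_def dual_system_def using assms by blast

lemma fsubD:
  assumes "fsub Q"
  shows "(\<lambda>_. 0) \<in> Q" "f \<in> Q \<Longrightarrow> g \<in> Q \<Longrightarrow> (\<lambda>x. f x + g x) \<in> Q" "f \<in> Q \<Longrightarrow> (\<lambda>x. c * f x) \<in> Q"
  using assms by (auto simp: fsub_def)

lemma fsub_sum:
  assumes "fsub Q" "\<And>i. i \<in> A \<Longrightarrow> F i \<in> Q"
  shows "(\<lambda>x. \<Sum>i\<in>A. c i * F i x) \<in> Q"
  using assms(2)
proof (induction A rule: infinite_finite_induct)
  case (insert a A)
  then show ?case using fsubD[OF assms(1)] by simp
qed (use fsubD(1)[OF assms(1)] in auto)

lemma fsub_diff:
  assumes "fsub Q" "f \<in> Q" "g \<in> Q"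
  shows "(\<lambda>x. f x - g x) \<in> Q"
  using fsubD(2)[OF assms(1,2) fsubD(3)[OF assms(1,3), of "-1"]] by simp

lemma dual_system_expand:
  assumes "fsub Q" "dual_system Q k F P" "f \<in> Q"
  shows "f x = (\<Sum>i<k. f (P i) * F i x)"
proof -
  let ?g = "\<lambda>x. f x - (\<Sum>i<k. f (P i) * F i x)"
  have "?g \<in> Q"
    by (intro fsub_diff fsub_sum assms) (auto intro: dual_systemD(1)[OF assms(2)])
  moreover have "?g (P j) = 0" if "j < k" for j
  proof -
    have "(\<Sum>i<k. f (P i) * F i (P j)) = (\<Sum>i<k. if i = j then f (P j) else 0)"
      using dual_systemD(2)[OF assms(2) _ that] by (intro sum.cong) auto
    then show ?thesis using that by simp
  qed
  ultimately have "?g = (\<lambda>_. 0)" by (rule dual_systemD(3)[OF assms(2)])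
  from fun_cong[OF this, of x] show ?thesis by simp
qed

text \<open>Induction on the finite support. If some member of \<open>Q\<close> is nonzero at the
  new point \<open>a\<close>, the members vanishing at \<open>a\<close> have a dual system by
  induction, and a function with value 1 at \<open>a\<close>, corrected to vanish at the old points,
  completes it.\<close>

lemma has_dim_exists:
  assumes "finite A" "fsub Q" "\<And>f x. f \<in> Q \<Longrightarrow> x \<notin> A \<Longrightarrow> f x = 0"
  shows "\<exists>k. has_dim Q k"
  using assms
proof (induction A arbitrary: Q rule: finite_induct)
  case empty
  then have "dual_system Q 0 (\<lambda>_ _. 0) (\<lambda>_. undefined)" by (auto simp: dual_system_def)
  then show ?case by (auto simp: has_dim_def)
next
  case (insert a A)
  show ?case
  proof (cases "\<forall>f\<in>Q. f a = 0")
    case True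
    show ?thesis
      by (rule insert.IH[OF insert.prems(1)]) (metis True insert.prems(2) insertE)
  next
    case False
    then obtain g0 where g0: "g0 \<in> Q" "g0 a \<noteq> 0" by auto
    define g where "g = (\<lambda>x. (1 / g0 a) * g0 x)"
    have g: "g \<in> Q" "g a = 1" using g0 fsubD(3)[OF insert.prems(1) g0(1), of "1 / g0 a"] by (auto simp: g_def)
    let ?Q = "{f \<in> Q. f a = 0}"
    have "fsub ?Q" using insert.prems(1) by (auto simp: fsub_def)
    then have "\<exists>k. has_dim ?Q k"
      by (rule insert.IH) (metis (mono_tags, lifting) insert.prems(2) insertE mem_Collect_eq)
    then obtain k F P where *: "dual_system ?Q k F P" by (auto simp: has_dim_def)
    let ?h = "\<lambda>x. g x - (\<Sum>i<k. g (P i) * F i x)"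
    have h: "?h \<in> Q"
      using dual_systemD(1)[OF *] by (intro fsub_diff fsub_sum insert.prems(1) g) auto
    have Fa: "F i a = 0" if "i < k" for i using dual_systemD(1)[OF * that] by simp
    then have ha: "?h a = 1" using g by simp
    have hP: "?h (P j) = 0" if "j < k" for j
    proof -
      have "(\<Sum>i<k. g (P i) * F i (P j)) = (\<Sum>i<k. if i = j then g (P j) else 0)"
        using dual_systemD(2)[OF * _ that] by (intro sum.cong) auto
      then show ?thesis using that by simp
    qed
    have "has_dim Q (Suc k)"
    proof (rule has_dimI[of _ "\<lambda>i. if i = k then ?h else F i" _ "\<lambda>i. if i = k then a else P i"])
      show "(if i = k then ?h else F i) \<in> Q" if "i < Suc k" for i
        using h dual_systemD(1)[OF *, of i] that by (cases "i = k") auto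
      show "(if i = k then ?h else F i) (if j = k then a else P j) = (if i = j then 1 else 0)"
        if "i < Suc k" "j < Suc k" for i j
        using ha hP[of j] Fa[of i] dual_systemD(2)[OF *, of i j] that by (cases "i = k"; cases "j = k") auto
      fix f assume f: "f \<in> Q" and z: "\<And>i. i < Suc k \<Longrightarrow> f (if i = k then a else P i) = 0"
      have "f (P i) = 0" if "i < k" for i using z[of i] that by simp
      moreover have "f \<in> ?Q" using z[of k] f by simp
      ultimately show "f = (\<lambda>_. 0)" using dual_systemD(3)[OF *] by blast
    qed
    then show ?thesis by blast
  qed
qed

text \<open>The functional is an interpolation error: interpolate by \<open>Q\<close> in the points
  \<open>P\<close> of a dual system and evaluate the difference at a point \<open>y\<close> where it
  is nonzero for \<open>g\<close>. On \<open>Q\<close> interpolation is exact.\<close>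

lemma separation:
  assumes "finite A" "fsub Q" "\<And>f x. f \<in> Q \<Longrightarrow> x \<notin> A \<Longrightarrow> f x = 0"
    and "\<And>x. x \<notin> A \<Longrightarrow> g x = 0" "g \<notin> Q"
  obtains \<phi> where "\<And>x. x \<notin> A \<Longrightarrow> \<phi> x = 0" "\<And>f. f \<in> Q \<Longrightarrow> (\<Sum>x\<in>A. f x * \<phi> x) = 0"
    "(\<Sum>x\<in>A. g x * \<phi> x) \<noteq> 0"
proof -
  have "\<exists>k. has_dim Q k"
    by (rule has_dim_exists[OF assms(1,2)]) (rule assms(3))
  then obtain k F P where *: "dual_system Q k F P" unfolding has_dim_def by blast
  have FQ: "F i \<in> Q" if "i < k" for i using dual_systemD(1)[OF * that] .
  have XA: "P i \<in> A" if "i < k" for i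
  proof (rule ccontr)
    assume "P i \<notin> A"
    then have "F i (P i) = 0" using assms(3)[OF FQ[OF that]] by simp
    then show False using dual_systemD(2)[OF * that that] by simp
  qed
  let ?g = "\<lambda>x. g x - (\<Sum>i<k. g (P i) * F i x)"
  have "?g \<noteq> (\<lambda>_. 0)"
  proof
    assume "?g = (\<lambda>_. 0)"
    then have "g x = (\<Sum>i<k. g (P i) * F i x)" for x using fun_cong[of ?g _ x] by simp
    then have "g = (\<lambda>x. \<Sum>i<k. g (P i) * F i x)" by (rule ext)
    moreover have "(\<lambda>x. \<Sum>i<k. g (P i) * F i x) \<in> Q"
      by (intro fsub_sum assms(2)) (auto intro: FQ)
    ultimately show False using assms(5) by simp
  qed
  then obtain y where y: "?g y \<noteq> 0" unfolding fun_eq_iff by blast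
  have yA: "y \<in> A"
  proof (rule ccontr)
    assume n: "y \<notin> A"
    have "F i y = 0" if "i < k" for i
      using FQ[OF that] n by (rule assms(3))
    then show False using y assms(4)[OF n] by simp
  qed
  \<comment> \<open>Chosen so that summation against \<open>\<phi>\<close> sends \<open>f\<close> to
    \<open>f y\<close> minus the value at \<open>y\<close> of its interpolant.\<close>
  define \<phi> where "\<phi> = (\<lambda>x. (if x = y then 1 else 0) - (\<Sum>i<k. if x = P i then F i y else 0))"
  have ev: "(\<Sum>x\<in>A. f x * \<phi> x) = f y - (\<Sum>i<k. f (P i) * F i y)" for f
  proof -
    have "(\<Sum>x\<in>A. f x * (\<Sum>i<k. if x = P i then F i y else 0)) = (\<Sum>i<k. \<Sum>x\<in>A. f x * (if x = P i then F i y else 0))"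
      unfolding sum_distrib_left by (rule sum.swap)
    also have "\<dots> = (\<Sum>i<k. f (P i) * F i y)"
    proof (rule sum.cong, rule refl)
      fix i assume "i \<in> {..<k}"
      then have "P i \<in> A" using XA by simp
      moreover have "(\<Sum>x\<in>A. f x * (if x = P i then F i y else 0)) = (\<Sum>x\<in>A. if x = P i then f (P i) * F i y else 0)"
        by (rule sum.cong) auto
      ultimately show "(\<Sum>x\<in>A. f x * (if x = P i then F i y else 0)) = f (P i) * F i y"
        using assms(1) by simp
    qed
    moreover have "(\<Sum>x\<in>A. f x * (if x = y then 1 else 0)) = f y"
    proof -
      have "(\<Sum>x\<in>A. f x * (if x = y then 1 else 0)) = (\<Sum>x\<in>A. if x = y then f y else 0)"
        by (rule sum.cong) auto
      then show ?thesis using yA assms(1) by simp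
    qed
    ultimately show ?thesis
      by (simp add: \<phi>_def right_diff_distrib sum_subtractf)
  qed
  show ?thesis
  proof (rule that[of \<phi>])
    show "\<phi> x = 0" if x: "x \<notin> A" for x
    proof -
      have "x \<noteq> y" "\<And>i. i < k \<Longrightarrow> x \<noteq> P i" using x yA XA by blast+
      then show ?thesis by (simp add: \<phi>_def)
    qed
    show "(\<Sum>x\<in>A. f x * \<phi> x) = 0" if "f \<in> Q" for f
      unfolding ev using dual_system_expand[OF assms(2) * that, of y] by simp
    show "(\<Sum>x\<in>A. g x * \<phi> x) \<noteq> 0" using y unfolding ev .
  qed
qed

subsection \<open>Graded dimensions by duality\<close>

definition ev :: "(nat list \<Rightarrow> 'k::field) \<Rightarrow> 'k ncpoly \<Rightarrow> 'k" where
  "ev \<phi> f = (\<Sum>w\<in>Poly_Mapping.keys f. Poly_Mapping.lookup f w * \<phi> (letters w))"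

lemma ev_superset:
  assumes "finite A" "Poly_Mapping.keys f \<subseteq> A"
  shows "ev \<phi> f = (\<Sum>w\<in>A. Poly_Mapping.lookup f w * \<phi> (letters w))"
  unfolding ev_def using assms by (intro sum.mono_neutral_left) (auto simp: in_keys_iff)

lemma ev_add: "ev \<phi> (f + g) = ev \<phi> f + ev \<phi> g"
proof -
  let ?A = "Poly_Mapping.keys f \<union> Poly_Mapping.keys g"
  have "ev \<phi> (f + g) = (\<Sum>w\<in>?A. Poly_Mapping.lookup (f + g) w * \<phi> (letters w))"
    by (rule ev_superset) (use Poly_Mapping.keys_add[of f g] in auto)
  also have "\<dots> = ev \<phi> f + ev \<phi> g"
    by (subst (1 2) ev_superset[of ?A]) (auto simp: lookup_add distrib_right sum.distrib)
  finally show ?thesis .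
qed

lemma ev_zero [simp]: "ev \<phi> 0 = 0"
  by (simp add: ev_def)

lemma ev_sum: "ev \<phi> (sum f A) = (\<Sum>a\<in>A. ev \<phi> (f a))"
  by (induction A rule: infinite_finite_induct) (auto simp: ev_add)

lemma ev_single [simp]: "ev \<phi> (Poly_Mapping.single w c) = c * \<phi> (letters w)"
  by (cases "c = 0") (auto simp: ev_def)

lemma ncpoly_expand: "f = (\<Sum>w\<in>Poly_Mapping.keys f. Poly_Mapping.single w (Poly_Mapping.lookup f w))"
proof (rule poly_mapping_eqI)
  fix w
  have "(\<Sum>v\<in>Poly_Mapping.keys f. Poly_Mapping.lookup (Poly_Mapping.single v (Poly_Mapping.lookup f v)) w)
     = (\<Sum>v\<in>Poly_Mapping.keys f. if v = w then Poly_Mapping.lookup f w else 0)"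
    by (rule sum.cong) (auto simp: lookup_single)
  then show "Poly_Mapping.lookup f w = Poly_Mapping.lookup (\<Sum>w\<in>Poly_Mapping.keys f. Poly_Mapping.single w (Poly_Mapping.lookup f w)) w"
    by (simp add: lookup_sum in_keys_iff)
qed

lemma ev_mult_left:
  "ev \<phi> (g * f) = (\<Sum>u\<in>Poly_Mapping.keys g. Poly_Mapping.lookup g u * ev (\<lambda>v. \<phi> (letters u @ v)) f)"
proof -
  have "g * f = (\<Sum>u\<in>Poly_Mapping.keys g. \<Sum>v\<in>Poly_Mapping.keys f.
      Poly_Mapping.single (u + v) (Poly_Mapping.lookup g u * Poly_Mapping.lookup f v))"
  proof -
    have "g * f = (\<Sum>u\<in>Poly_Mapping.keys g. Poly_Mapping.single u (Poly_Mapping.lookup g u)) *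
        (\<Sum>v\<in>Poly_Mapping.keys f. Poly_Mapping.single v (Poly_Mapping.lookup f v))"
      by (rule arg_cong2[where f = "(*)"]) (rule ncpoly_expand)+
    also have "\<dots> = (\<Sum>u\<in>Poly_Mapping.keys g. \<Sum>v\<in>Poly_Mapping.keys f.
        Poly_Mapping.single (u + v) (Poly_Mapping.lookup g u * Poly_Mapping.lookup f v))"
      unfolding sum_product by (simp only: mult_single)
    finally show ?thesis .
  qed
  then have "ev \<phi> (g * f) = (\<Sum>u\<in>Poly_Mapping.keys g. \<Sum>v\<in>Poly_Mapping.keys f.
      Poly_Mapping.lookup g u * Poly_Mapping.lookup f v * \<phi> (letters u @ letters v))"
    by (simp add: ev_sum plus_word_def)
  also have "\<dots> = (\<Sum>u\<in>Poly_Mapping.keys g. Poly_Mapping.lookup g u * ev (\<lambda>v. \<phi> (letters u @ v)) f)"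
    by (simp add: ev_def sum_distrib_left mult.assoc)
  finally show ?thesis .
qed

lemma ev_mult_right:
  "ev \<phi> (f * g) = (\<Sum>u\<in>Poly_Mapping.keys g. Poly_Mapping.lookup g u * ev (\<lambda>v. \<phi> (v @ letters u)) f)"
proof -
  have "ev \<phi> (f * g) = (\<Sum>v\<in>Poly_Mapping.keys f. \<Sum>u\<in>Poly_Mapping.keys g.
      Poly_Mapping.lookup f v * (Poly_Mapping.lookup g u * \<phi> (letters v @ letters u)))"
    unfolding ev_mult_left by (simp add: ev_def sum_distrib_left)
  also have "\<dots> = (\<Sum>u\<in>Poly_Mapping.keys g. \<Sum>v\<in>Poly_Mapping.keys f.
      Poly_Mapping.lookup f v * (Poly_Mapping.lookup g u * \<phi> (letters v @ letters u)))"
    by (rule sum.swap)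
  also have "\<dots> = (\<Sum>u\<in>Poly_Mapping.keys g. Poly_Mapping.lookup g u * ev (\<lambda>v. \<phi> (v @ letters u)) f)"
    by (simp add: ev_def sum_distrib_left mult_ac)
  finally show ?thesis .
qed

lemma ev_uminus: "ev \<phi> (- f) = - ev \<phi> f"
  using ev_add[of \<phi> f "- f"] by (simp add: eq_neg_iff_add_eq_0 add.commute)

lemma ev_const_mult: "ev \<phi> (const c * f) = c * ev \<phi> f"
  by (cases "c = 0") (auto simp: ev_mult_left const_def zero_word_def)

text \<open>The dual of \<open>A\<^sub>m\<close>, as functionals on words of length \<open>m\<close>.\<close>

definition ann :: "nat \<Rightarrow> 'k::field ncpoly set \<Rightarrow> nat \<Rightarrow> (nat list \<Rightarrow> 'k) set" where
  "ann n R m = {\<phi>. (\<forall>w. \<phi> w \<noteq> 0 \<longrightarrow> length w = m \<and> set w \<subseteq> {..<n}) \<and>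
     (\<forall>p s. \<forall>r\<in>R. length p + length s + 2 = m \<longrightarrow> set p \<subseteq> {..<n} \<longrightarrow> set s \<subseteq> {..<n} \<longrightarrow> ev (\<lambda>w. \<phi> (p @ w @ s)) r = 0)}"

lemma annD:
  assumes "\<phi> \<in> ann n R m"
  shows "\<phi> w \<noteq> 0 \<Longrightarrow> length w = m \<and> set w \<subseteq> {..<n}"
    "r \<in> R \<Longrightarrow> length p + length s + 2 = m \<Longrightarrow> set p \<subseteq> {..<n} \<Longrightarrow> set s \<subseteq> {..<n} \<Longrightarrow> ev (\<lambda>w. \<phi> (p @ w @ s)) r = 0"
  using assms unfolding ann_def by blast+

lemma ev_add_left: "ev (\<lambda>w. \<phi> w + \<psi> w) f = ev \<phi> f + ev \<psi> f"
  by (simp add: ev_def distrib_left sum.distrib)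

lemma ev_scale_left: "ev (\<lambda>w. c * \<phi> w) f = c * ev \<phi> f"
  by (simp add: ev_def sum_distrib_left mult_ac)

lemma ev_zero_left: "ev (\<lambda>w. 0) f = 0"
  by (simp add: ev_def)

lemma fsub_ann: "fsub (ann n R m)"
  unfolding fsub_def
proof (intro conjI ballI allI)
  show "(\<lambda>_. 0) \<in> ann n R m" by (simp add: ann_def ev_zero_left)
  fix f g assume *: "f \<in> ann n R m" "g \<in> ann n R m"
  then have "f w + g w \<noteq> 0 \<Longrightarrow> f w \<noteq> 0 \<or> g w \<noteq> 0" for w by auto
  then show "(\<lambda>x. f x + g x) \<in> ann n R m"
    using * unfolding ann_def by (fastforce simp: ev_add_left)
next
  fix c f assume "f \<in> ann n R m"
  then show "(\<lambda>x. c * f x) \<in> ann n R m" by (auto simp: ann_def ev_scale_left)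
qed

lemma finite_words: "finite {w :: nat list. length w = m \<and> set w \<subseteq> {..<n}}"
  using finite_lists_length_eq[of "{..<n}" m] by (simp add: conj_commute)

lemma ex_has_dim_ann: "\<exists>k. has_dim (ann n R m) k"
  by (rule has_dim_exists[OF finite_words[of m n] fsub_ann]) (auto simp: ann_def)

lemma free_component_ops:
  fixes f :: "'k::field ncpoly"
  shows "f \<in> free_component n m \<Longrightarrow> g \<in> free_component n m \<Longrightarrow> f + g \<in> free_component n m"
    "f \<in> free_component n m \<Longrightarrow> const c * f \<in> free_component n m"
    "(0 :: 'k ncpoly) \<in> free_component n m"
proof -
  show "f + g \<in> free_component n m" if "f \<in> free_component n m" "g \<in> free_component n m"
    using that Poly_Mapping.keys_add[of f g] by (simp add: free_component_def free_algebra_def) blast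
  show "const c * f \<in> free_component n m" if "f \<in> free_component n m"
    using that Poly_Mapping.keys_mult[of "const c" f]
    by (cases "c = 0") (fastforce simp: free_component_def free_algebra_def const_def)+
  show "(0 :: 'k ncpoly) \<in> free_component n m"
    by (auto simp: free_component_def free_algebra_def)
qed

section \<open>The ideal of relations and the functionals annihilating it\<close>

context
  fixes n :: nat and R :: "'k::field ncpoly set"
  assumes qr: "quadratic_relations n R"
begin

interpretation FA: ring "free_algebra n :: 'k ncpoly ring"
proof (rule ringI)
  let ?F = "free_algebra n :: 'k ncpoly ring"
  show "abelian_group ?F"
  proof (rule abelian_groupI)
    fix x assume "x \<in> carrier ?F"
    then show "\<exists>y\<in>carrier ?F. y \<oplus>\<^bsub>?F\<^esub> x = \<zero>\<^bsub>?F\<^esub>"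
      by (intro bexI[of _ "- x"]) (auto simp: free_algebra_def)
  next
    fix x y assume "x \<in> carrier ?F" "y \<in> carrier ?F"
    then show "x \<oplus>\<^bsub>?F\<^esub> y \<in> carrier ?F"
      using Poly_Mapping.keys_add[of x y] by (auto simp: free_algebra_def)
  qed (auto simp: free_algebra_def add_ac)
  show "monoid ?F"
  proof (rule monoidI)
    fix x y assume "x \<in> carrier ?F" "y \<in> carrier ?F"
    then show "x \<otimes>\<^bsub>?F\<^esub> y \<in> carrier ?F"
      using Poly_Mapping.keys_mult[of x y] by (fastforce simp: free_algebra_def plus_word_def)
  next
    show "\<one>\<^bsub>?F\<^esub> \<in> carrier ?F"
      by (auto simp: free_algebra_def zero_word_def)
  qed (auto simp: free_algebra_def mult.assoc)
qed (auto simp: free_algebra_def algebra_simps)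

lemma carrier_FA: "f \<in> carrier (free_algebra n) \<longleftrightarrow> (\<forall>w\<in>Poly_Mapping.keys f. set (letters w) \<subseteq> {..<n})"
  by (simp add: free_algebra_def)

lemma FA_ops: "x \<otimes>\<^bsub>free_algebra n\<^esub> y = x * y" "x \<oplus>\<^bsub>free_algebra n\<^esub> y = x + y" "\<one>\<^bsub>free_algebra n\<^esub> = 1" "\<zero>\<^bsub>free_algebra n\<^esub> = 0"
  by (simp_all add: free_algebra_def)

lemma R_in: "r \<in> R \<Longrightarrow> r \<in> carrier (free_algebra n)" "r \<in> R \<Longrightarrow> w \<in> Poly_Mapping.keys r \<Longrightarrow> length (letters w) = 2"
  using qr by (auto simp: quadratic_relations_def free_component_def)

lemma ideal_I: "ideal (relation_ideal n R) (free_algebra n)"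
  unfolding relation_ideal_def by (rule FA.genideal_ideal) (use R_in in auto)

text \<open>Cutting off a prefix keeps the conditions of \<open>ann\<close>, since these already
  range over all prefixes. A prefix longer than \<open>m\<close> is treated separately because
  \<open>m - length u\<close> truncates.\<close>

lemma ann_shift_left:
  assumes "\<phi> \<in> ann n R m" "set u \<subseteq> {..<n}"
  shows "length u \<le> m \<Longrightarrow> (\<lambda>v. \<phi> (u @ v)) \<in> ann n R (m - length u)" "length u > m \<Longrightarrow> (\<lambda>v. \<phi> (u @ v)) = (\<lambda>_. 0)"
proof -
  assume l: "length u \<le> m"
  have 1: "length w = m - length u \<and> set w \<subseteq> {..<n}" if "\<phi> (u @ w) \<noteq> 0" for w
    using assms that by (fastforce simp: ann_def)
  have 2: "ev (\<lambda>w. \<phi> (u @ p @ w @ s)) r = 0"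
    if "r \<in> R" "length p + length s + 2 = m - length u" "set p \<subseteq> {..<n}" "set s \<subseteq> {..<n}" for p s r
  proof -
    have "length (u @ p) + length s + 2 = m" "set (u @ p) \<subseteq> {..<n}" using that assms l by auto
    then have "ev (\<lambda>w. \<phi> ((u @ p) @ w @ s)) r = 0" by (intro annD(2)[OF assms(1)] that)
    then show ?thesis by simp
  qed
  show "(\<lambda>v. \<phi> (u @ v)) \<in> ann n R (m - length u)"
    using 1 2 by (auto simp: ann_def)
next
  assume l: "length u > m"
  have "\<phi> (u @ v) = 0" for v
  proof (rule ccontr)
    assume "\<phi> (u @ v) \<noteq> 0"
    then have "length (u @ v) = m" using assms(1) by (auto simp: ann_def)
    then show False using l by simp
  qed
  then show "(\<lambda>v. \<phi> (u @ v)) = (\<lambda>_. 0)" by auto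
qed

lemma ann_shift_right:
  assumes "\<phi> \<in> ann n R m" "set u \<subseteq> {..<n}"
  shows "length u \<le> m \<Longrightarrow> (\<lambda>v. \<phi> (v @ u)) \<in> ann n R (m - length u)" "length u > m \<Longrightarrow> (\<lambda>v. \<phi> (v @ u)) = (\<lambda>_. 0)"
proof -
  assume l: "length u \<le> m"
  have 1: "length w = m - length u \<and> set w \<subseteq> {..<n}" if "\<phi> (w @ u) \<noteq> 0" for w
    using assms that by (fastforce simp: ann_def)
  have 2: "ev (\<lambda>w. \<phi> (p @ w @ s @ u)) r = 0"
    if "r \<in> R" "length p + length s + 2 = m - length u" "set p \<subseteq> {..<n}" "set s \<subseteq> {..<n}" for p s r
  proof -
    have "length p + length (s @ u) + 2 = m" "set (s @ u) \<subseteq> {..<n}" using that assms l by auto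
    then have "ev (\<lambda>w. \<phi> (p @ w @ (s @ u))) r = 0" by (intro annD(2)[OF assms(1)] that)
    then show ?thesis by simp
  qed
  show "(\<lambda>v. \<phi> (v @ u)) \<in> ann n R (m - length u)"
    using 1 2 by (auto simp: ann_def)
next
  assume l: "length u > m"
  have "\<phi> (v @ u) = 0" for v
  proof (rule ccontr)
    assume "\<phi> (v @ u) \<noteq> 0"
    then have "length (v @ u) = m" using assms(1) by (auto simp: ann_def)
    then show False using l by simp
  qed
  then show "(\<lambda>v. \<phi> (v @ u)) = (\<lambda>_. 0)" by auto
qed

text \<open>The common kernel of the annihilating functionals of all degrees. It is an ideal
  containing \<open>R\<close>, which bounds the relation ideal from above.\<close>

definition killed :: "'k ncpoly set" where
  "killed = {f \<in> carrier (free_algebra n). \<forall>m. \<forall>\<phi>\<in>ann n R m. ev \<phi> f = 0}"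

lemma ideal_killed: "ideal killed (free_algebra n)"
proof (rule idealI)
  show "ring (free_algebra n :: 'k ncpoly ring)" by (rule FA.ring_axioms)
  show "subgroup killed (add_monoid (free_algebra n))"
  proof (rule FA.add.subgroupI)
    show "killed \<subseteq> carrier (free_algebra n)" by (auto simp: killed_def)
    show "killed \<noteq> {}" using FA.zero_closed by (auto simp: killed_def FA_ops intro!: exI[of _ 0])
    show "\<ominus>\<^bsub>free_algebra n\<^esub> a \<in> killed" if "a \<in> killed" for a
    proof -
      have a: "a \<in> carrier (free_algebra n)" using that by (simp add: killed_def)
      have "- a \<in> carrier (free_algebra n)" using a by (simp add: carrier_FA)
      then have "\<ominus>\<^bsub>free_algebra n\<^esub> a = - a"
        using a by (intro FA.minus_equality) (auto simp: FA_ops)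
      then show ?thesis using that \<open>- a \<in> _\<close> by (auto simp: killed_def ev_uminus)
    qed
    show "a \<oplus>\<^bsub>free_algebra n\<^esub> b \<in> killed" if "a \<in> killed" "b \<in> killed" for a b
      using that FA.add.m_closed[of a b] by (auto simp: killed_def FA_ops ev_add)
  qed
  fix a x :: "'k ncpoly" assume ax: "a \<in> killed" "x \<in> carrier (free_algebra n)"
  have a: "a \<in> carrier (free_algebra n)" "\<And>m \<phi>. \<phi> \<in> ann n R m \<Longrightarrow> ev \<phi> a = 0"
    using ax by (auto simp: killed_def)
  have "ev (\<lambda>v. \<phi> (letters u @ v)) a = 0" if "\<phi> \<in> ann n R m" "u \<in> Poly_Mapping.keys x" for \<phi> m u
    using ann_shift_left[OF that(1), of "letters u"] a(2) that(2) ax(2)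
    by (cases "length (letters u) \<le> m") (auto simp: carrier_FA ev_zero_left)
  then have "\<forall>m. \<forall>\<phi>\<in>ann n R m. ev \<phi> (x * a) = 0"
    by (simp add: ev_mult_left)
  then show "x \<otimes>\<^bsub>free_algebra n\<^esub> a \<in> killed"
    using FA.m_closed[OF ax(2) a(1)] by (auto simp: killed_def FA_ops)
  have "ev (\<lambda>v. \<phi> (v @ letters u)) a = 0" if "\<phi> \<in> ann n R m" "u \<in> Poly_Mapping.keys x" for \<phi> m u
    using ann_shift_right[OF that(1), of "letters u"] a(2) that(2) ax(2)
    by (cases "length (letters u) \<le> m") (auto simp: carrier_FA ev_zero_left)
  then have "\<forall>m. \<forall>\<phi>\<in>ann n R m. ev \<phi> (a * x) = 0"
    by (simp add: ev_mult_right)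
  then show "a \<otimes>\<^bsub>free_algebra n\<^esub> x \<in> killed"
    using FA.m_closed[OF a(1) ax(2)] by (auto simp: killed_def FA_ops)
qed

lemma R_killed: "R \<subseteq> killed"
proof
  fix r assume r: "r \<in> R"
  have "ev \<phi> r = 0" if \<phi>: "\<phi> \<in> ann n R m" for m \<phi>
  proof (cases "m = 2")
    case True
    then have "ev (\<lambda>w. \<phi> ([] @ w @ [])) r = 0"
      by (intro annD(2)[OF \<phi> r]) auto
    then show ?thesis by simp
  next
    case False
    have "\<phi> (letters w) = 0" if "w \<in> Poly_Mapping.keys r" for w
    proof (rule ccontr)
      assume "\<phi> (letters w) \<noteq> 0"
      then have "length (letters w) = m" using \<phi> by (auto simp: ann_def)
      then show False using R_in(2)[OF r that] False by simp
    qed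
    then show ?thesis by (simp add: ev_def)
  qed
  then show "r \<in> killed" using R_in(1)[OF r] by (auto simp: killed_def)
qed

lemma I_killed: "relation_ideal n R \<subseteq> killed"
  unfolding relation_ideal_def by (rule FA.genideal_minimal[OF ideal_killed R_killed])

lemma single_in_carrier: "set (letters w) \<subseteq> {..<n} \<Longrightarrow> Poly_Mapping.single w c \<in> carrier (free_algebra n)"
  by (cases "c = 0") (auto simp: carrier_FA)

lemma const_in_carrier: "const c \<in> carrier (free_algebra n)"
  by (simp add: const_def single_in_carrier zero_word_def)

text \<open>The reverse inclusion, one degree at a time. A functional separating \<open>f\<close>
  from the degree \<open>m\<close> part of the ideal lies in \<open>ann\<close>, because the ideal
  contains \<open>p r s\<close> for all words \<open>p\<close> and \<open>s\<close>; but then it has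
  to vanish on \<open>f\<close>.\<close>

lemma killed_component:
  assumes f: "f \<in> free_component n m" and k: "\<And>\<phi>. \<phi> \<in> ann n R m \<Longrightarrow> ev \<phi> f = 0"
  shows "f \<in> relation_ideal n R"
proof (rule ccontr)
  assume nf: "f \<notin> relation_ideal n R"
  interpret I: ideal "relation_ideal n R" "free_algebra n" by (rule ideal_I)
  let ?A = "{w :: nat list. length w = m \<and> set w \<subseteq> {..<n}}"
  \<comment> \<open>Reads a polynomial as a function on lists of letters, so that
    \<open>separation\<close> applies with the finite set of words of length
    \<open>m\<close>.\<close>
  define T where "T = (\<lambda>f :: 'k ncpoly. \<lambda>w. Poly_Mapping.lookup f (Word w))"
  let ?Q = "T ` (relation_ideal n R \<inter> free_component n m)"
  have Tinj: "T f = T g \<Longrightarrow> f = g" for f g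
    by (rule poly_mapping_eqI) (metis T_def word.exhaust)
  have supp: "T f x = 0" if "f \<in> free_component n m" "x \<notin> ?A" for f x
  proof (rule ccontr)
    assume "T f x \<noteq> 0"
    then have "Word x \<in> Poly_Mapping.keys f" by (simp add: T_def in_keys_iff)
    then have "set (letters (Word x)) \<subseteq> {..<n}" "length (letters (Word x)) = m"
      using that(1) unfolding free_component_def carrier_FA by blast+
    then show False using that(2) by simp
  qed
  have evT: "ev \<phi> f = (\<Sum>x\<in>?A. T f x * \<phi> x)" if "f \<in> free_component n m" for f \<phi>
  proof -
    have "ev \<phi> f = (\<Sum>w\<in>Word ` ?A. Poly_Mapping.lookup f w * \<phi> (letters w))"
    proof (rule ev_superset)
      show "finite (Word ` ?A)" using finite_words by simp
      show "Poly_Mapping.keys f \<subseteq> Word ` ?A"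
      proof
        fix w assume w: "w \<in> Poly_Mapping.keys f"
        have "w = Word (letters w)" by simp
        moreover have "letters w \<in> ?A" using w that unfolding free_component_def carrier_FA by blast
        ultimately show "w \<in> Word ` ?A" by (rule image_eqI)
      qed
    qed
    also have "\<dots> = (\<Sum>x\<in>?A. T f x * \<phi> x)"
      by (subst sum.reindex) (auto simp: inj_on_def T_def)
    finally show ?thesis .
  qed
  have fs: "fsub ?Q"
    unfolding fsub_def
  proof (intro conjI ballI allI)
    show "(\<lambda>_. 0) \<in> ?Q"
    proof (rule image_eqI[of _ _ 0])
      show "(\<lambda>_. 0) = T 0" by (simp add: T_def)
      show "0 \<in> relation_ideal n R \<inter> free_component n m"
        using I.zero_closed free_component_ops(3) by (simp add: FA_ops)
    qed
    fix f g assume "f \<in> ?Q" "g \<in> ?Q"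
    then obtain f' g' where *: "f = T f'" "g = T g'" "f' \<in> relation_ideal n R" "g' \<in> relation_ideal n R"
      "f' \<in> free_component n m" "g' \<in> free_component n m" by auto
    show "(\<lambda>x. f x + g x) \<in> ?Q"
    proof (rule image_eqI[of _ _ "f' + g'"])
      show "(\<lambda>x. f x + g x) = T (f' + g')" by (simp add: * T_def lookup_add)
      show "f' + g' \<in> relation_ideal n R \<inter> free_component n m"
        using I.a_closed[OF *(3,4)] free_component_ops(1)[OF *(5,6)] by (simp add: FA_ops)
    qed
  next
    fix c f assume "f \<in> ?Q"
    then obtain f' where *: "f = T f'" "f' \<in> relation_ideal n R" "f' \<in> free_component n m" by auto
    have lk: "Poly_Mapping.lookup (const c * f') w = c * Poly_Mapping.lookup f' w" for w
      unfolding const_def mult_map_scale_conv_mult[symmetric] by (simp add: map.rep_eq when_def)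
    show "(\<lambda>x. c * f x) \<in> ?Q"
    proof (rule image_eqI[of _ _ "const c * f'"])
      show "(\<lambda>x. c * f x) = T (const c * f')" by (simp add: * T_def lk)
      show "const c * f' \<in> relation_ideal n R \<inter> free_component n m"
        using I.I_l_closed[OF *(2) const_in_carrier[of c]] free_component_ops(2)[OF *(3)] by (simp add: FA_ops)
    qed
  qed
  obtain \<phi> where \<phi>: "\<And>x. x \<notin> ?A \<Longrightarrow> \<phi> x = 0" "\<And>g. g \<in> ?Q \<Longrightarrow> (\<Sum>x\<in>?A. g x * \<phi> x) = 0"
    "(\<Sum>x\<in>?A. T f x * \<phi> x) \<noteq> 0"
  proof (rule separation[OF finite_words fs, where g = "T f"])
    show "\<And>g x. g \<in> ?Q \<Longrightarrow> x \<notin> ?A \<Longrightarrow> g x = 0" using supp by blast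
    show "\<And>x. x \<notin> ?A \<Longrightarrow> T f x = 0" using supp f by blast
    show "T f \<notin> ?Q" using nf Tinj by blast
  qed (rule that)
  have "\<phi> \<in> ann n R m"
    unfolding ann_def
  proof (intro CollectI conjI allI ballI impI)
    show "length w = m" "set w \<subseteq> {..<n}" if "\<phi> w \<noteq> 0" for w using \<phi>(1) that by blast+
    fix p s r assume r: "r \<in> R" and l: "length p + length s + 2 = m" and ps: "set p \<subseteq> {..<n}" "set s \<subseteq> {..<n}"
    \<comment> \<open>Pairing \<open>\<phi>\<close> with the ideal element \<open>p r s\<close> is
      the condition of \<open>ann\<close> for the context \<open>p\<close>,
      \<open>s\<close>.\<close>
    let ?g = "Poly_Mapping.single (Word p) 1 * r * Poly_Mapping.single (Word s) 1"
    have "r \<in> relation_ideal n R"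
      unfolding relation_ideal_def using FA.genideal_self[of R] R_in r by auto
    then have gI: "?g \<in> relation_ideal n R"
      using I.I_r_closed[OF I.I_l_closed, OF _ single_in_carrier single_in_carrier, of r "Word p" "Word s" 1 1] ps
      by (simp add: FA_ops)
    have "Poly_Mapping.keys ?g \<subseteq> {Word p + v + Word s | v. v \<in> Poly_Mapping.keys r}"
    proof -
      have "Poly_Mapping.keys (Poly_Mapping.single (Word p) 1 * r) \<subseteq> {Word p + v | v. v \<in> Poly_Mapping.keys r}"
        using Poly_Mapping.keys_mult[of "Poly_Mapping.single (Word p) (1::'k)" r] by auto
      then show ?thesis
        using Poly_Mapping.keys_mult[of "Poly_Mapping.single (Word p) (1::'k) * r" "Poly_Mapping.single (Word s) 1"] by fastforce
    qed
    then have gm: "?g \<in> free_component n m"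
    proof -
      assume sub: "Poly_Mapping.keys ?g \<subseteq> {Word p + v + Word s | v. v \<in> Poly_Mapping.keys r}"
      have "set (letters w) \<subseteq> {..<n} \<and> length (letters w) = m" if w: "w \<in> Poly_Mapping.keys ?g" for w
      proof -
        obtain v where v: "w = Word p + v + Word s" "v \<in> Poly_Mapping.keys r" using sub w by blast
        have "set (letters v) \<subseteq> {..<n}" "length (letters v) = 2"
          using R_in[OF r] v(2) unfolding carrier_FA by blast+
        then show ?thesis using ps l by (simp add: v plus_word_def)
      qed
      then show ?thesis unfolding free_component_def carrier_FA by blast
    qed
    have "T ?g \<in> ?Q" using gI gm by blast
    then have "ev \<phi> ?g = 0" unfolding evT[OF gm] by (rule \<phi>(2))
    then show "ev (\<lambda>w. \<phi> (p @ w @ s)) r = 0"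
      by (simp add: ev_mult_right ev_mult_left) (simp add: ev_def)
  qed
  then show False using k \<phi>(3) unfolding evT[OF f] by blast
qed

lemma subfield_const: "subfield (range const) (free_algebra n :: 'k ncpoly ring)"
proof (rule FA.subfieldI)
  have "subring (range const) (free_algebra n :: 'k ncpoly ring)"
  proof (rule FA.subringI)
    show "\<ominus>\<^bsub>free_algebra n\<^esub> h \<in> range const" if h: "h \<in> range const" for h :: "'k ncpoly"
    proof -
      obtain c where c: "h = const c" using h by blast
      have "\<ominus>\<^bsub>free_algebra n\<^esub> h = const (- c)"
        using const_in_carrier by (intro FA.minus_equality) (auto simp: c FA_ops const_def single_add[symmetric])
      then show ?thesis by simp
    qed
    show "h1 \<oplus>\<^bsub>free_algebra n\<^esub> h2 \<in> range const" if "h1 \<in> range const" "h2 \<in> range const" for h1 h2 :: "'k ncpoly"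
      using that by (auto simp: FA_ops const_def single_add[symmetric])
    show "h1 \<otimes>\<^bsub>free_algebra n\<^esub> h2 \<in> range const" if "h1 \<in> range const" "h2 \<in> range const" for h1 h2 :: "'k ncpoly"
      using that by (auto simp: FA_ops const_def mult_single)
  qed (use const_in_carrier in \<open>auto simp: FA_ops const_def intro: image_eqI[of _ _ 1]\<close>)
  then show "subcring (range const) (free_algebra n :: 'k ncpoly ring)"
    by (rule FA.subcringI) (auto simp: FA_ops const_def mult_single mult.commute)
  show "Units (free_algebra n \<lparr>carrier := range const\<rparr>) = range const - {\<zero>\<^bsub>free_algebra n\<^esub> :: 'k ncpoly}"
  proof (intro equalityI subsetI)
    fix k :: "'k ncpoly" assume "k \<in> Units (free_algebra n \<lparr>carrier := range const\<rparr>)"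
    then show "k \<in> range const - {\<zero>\<^bsub>free_algebra n\<^esub>}"
      by (auto simp: Units_def FA_ops)
  next
    fix k :: "'k ncpoly" assume "k \<in> range const - {\<zero>\<^bsub>free_algebra n\<^esub>}"
    then obtain c where c: "k = const c" "const c \<noteq> 0" unfolding FA_ops by blast
    then have "c \<noteq> 0" by (auto simp: const_def)
    with c have "const (inverse c) * k = 1" "k * const (inverse c) = 1"
      by (auto simp: const_def mult_single)
    then show "k \<in> Units (free_algebra n \<lparr>carrier := range const\<rparr>)"
      unfolding Units_def using c by (auto simp: FA_ops)
  qed
qed

text \<open>Follows the recursion of \<open>combine\<close> in the quotient ring, including the
  value 0 when one of the lists runs out, so that the quotient map carries one into the
  other.\<close>

primrec lin_comb :: "'k list \<Rightarrow> nat list list \<Rightarrow> 'k ncpoly" where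
  "lin_comb [] xs = 0"
| "lin_comb (c # cs) xs = (case xs of [] \<Rightarrow> 0 | x # xs' \<Rightarrow> const c * Poly_Mapping.single (Word x) 1 + lin_comb cs xs')"

lemma ev_lin_comb:
  "length cs = length xs \<Longrightarrow> ev \<phi> (lin_comb cs xs) = (\<Sum>i<length xs. cs ! i * \<phi> (xs ! i))"
proof (induction cs xs rule: list_induct2)
  case (Cons c cs x xs)
  then show ?case by (simp add: ev_add ev_const_mult sum.lessThan_Suc_shift del: sum.lessThan_Suc)
qed simp

lemma lin_comb_component:
  "(\<forall>x\<in>set xs. length x = m \<and> set x \<subseteq> {..<n}) \<Longrightarrow> lin_comb cs xs \<in> free_component n m"
proof (induction cs arbitrary: xs)
  case (Cons c cs)
  then show ?case
  proof (cases xs)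
    case (Cons x xs')
    then have "Poly_Mapping.single (Word x) (1 :: 'k) \<in> free_component n m"
      using Cons.prems by (auto simp: free_component_def carrier_FA)
    then show ?thesis using Cons Cons.IH[of xs'] Cons.prems by (auto intro!: free_component_ops)
  qed (simp add: free_component_ops)
qed (simp add: free_component_ops)

text \<open>The words at the points \<open>P\<close> of a dual system give a basis of the component.
  They are independent modulo the ideal because the \<open>F i\<close> separate them, and they span
  because \<open>f\<close> minus the combination with coefficients \<open>ev (F i) f\<close> is
  annihilated by all of \<open>ann\<close>.\<close>

theorem component_dim_eq:
  assumes "has_dim (ann n R m) k"
  shows "component_dim n R m = k"
proof -
  let ?F = "free_algebra n :: 'k ncpoly ring" and ?I = "relation_ideal n R" and ?q = "quotient_map n R"
  let ?Q = "quadratic_algebra n R"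
  interpret I: ideal ?I ?F by (rule ideal_I)
  interpret Q: ring ?Q unfolding quadratic_algebra_def by (rule I.quotient_is_ring)
  interpret h: ring_hom_ring ?F ?Q ?q
  proof (rule ring_hom_ringI2[OF FA.ring_axioms Q.ring_axioms])
    show "?q \<in> ring_hom ?F ?Q"
      unfolding quadratic_algebra_def
      using I.rcos_ring_hom by (simp add: quotient_map_def[abs_def])
  qed
  have q0: "?q f = \<zero>\<^bsub>?Q\<^esub> \<longleftrightarrow> f \<in> ?I" if "f \<in> carrier ?F" for f
  proof -
    have z: "\<zero>\<^bsub>?Q\<^esub> = ?I" by (simp add: quadratic_algebra_def FactRing_def)
    show ?thesis
      unfolding z quotient_map_def using that I.a_rcos_self[of f] I.a_rcos_const[of f] by auto
  qed
  have comp_carrier: "free_component n l \<subseteq> carrier ?F" for l by (auto simp: free_component_def)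
  \<comment> \<open>The functional reading off the constant term shows that 1 is not in the ideal.
    The quotient is then nontrivial, so that its copy of the ground field is a subfield.\<close>
  have "(\<lambda>w. if w = [] then 1 else 0) \<in> ann n R 0" by (auto simp: ann_def)
  then have "1 \<notin> ?I" using I_killed unfolding killed_def
    by (force simp: ev_def zero_word_def)
  then have nontriv: "\<one>\<^bsub>?Q\<^esub> \<noteq> \<zero>\<^bsub>?Q\<^esub>"
    using q0[OF FA.one_closed] h.hom_one by (simp add: FA_ops)
  have sf: "subfield (ground_field n R) ?Q"
    unfolding ground_field_def by (rule h.img_is_subfield(2)[OF subfield_const nontriv])
  obtain F P where FP: "dual_system (ann n R m) k F P" using assms by (auto simp: has_dim_def)
  define xs where "xs = map P [0..<k]"
  have xs: "length xs = k" "\<And>i. i < k \<Longrightarrow> xs ! i = P i" by (auto simp: xs_def)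
  have Xw: "length (P i) = m \<and> set (P i) \<subseteq> {..<n}" if "i < k" for i
    using annD(1)[OF dual_systemD(1)[OF FP that], of "P i"] dual_systemD(2)[OF FP that that] by simp
  then have xsw: "\<forall>x\<in>set xs. length x = m \<and> set x \<subseteq> {..<n}" by (auto simp: xs_def)
  define Us where "Us = map (\<lambda>x. ?q (Poly_Mapping.single (Word x) 1)) xs"
  have Uc: "set Us \<subseteq> carrier ?Q"
    using xsw by (auto simp: Us_def intro!: h.hom_closed single_in_carrier)
  have comb: "(\<forall>x\<in>set ys. set x \<subseteq> {..<n}) \<Longrightarrow>
      Q.combine (map (\<lambda>c. ?q (const c)) cs) (map (\<lambda>x. ?q (Poly_Mapping.single (Word x) 1)) ys) = ?q (lin_comb cs ys)
      \<and> lin_comb cs ys \<in> carrier ?F" for cs ys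
  proof (induction cs arbitrary: ys)
    case Nil
    then show ?case using h.hom_zero FA.zero_closed by (simp add: FA_ops)
  next
    case (Cons c cs)
    show ?case
    proof (cases ys)
      case Nil
      then show ?thesis using h.hom_zero FA.zero_closed by (simp add: FA_ops)
    next
      case ys: (Cons y ys')
      have 1: "Poly_Mapping.single (Word y) 1 \<in> carrier ?F"
        using Cons.prems ys by (intro single_in_carrier) auto
      have 2: "lin_comb cs ys' \<in> carrier ?F" using Cons.IH[of ys'] Cons.prems ys by auto
      have 3: "const c * Poly_Mapping.single (Word y) 1 \<in> carrier ?F"
        using FA.m_closed[OF const_in_carrier 1] by (simp add: FA_ops)
      show ?thesis
        using Cons.IH[of ys'] Cons.prems ys h.hom_mult[OF const_in_carrier 1, of c] h.hom_add[OF 3 2] FA.a_closed[OF 3 2]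
        by (simp add: FA_ops)
    qed
  qed
  have Ks: "\<exists>cs. Ks = map (\<lambda>c. ?q (const c)) cs" if "set Ks \<subseteq> ground_field n R" for Ks
    using that unfolding ground_field_def ex_map_conv by blast
  have indep: "Q.independent (ground_field n R) Us"
  proof (rule Q.trivial_combine_imp_independent[OF sf Uc])
    fix Ks assume 1: "set Ks \<subseteq> ground_field n R" and 2: "Q.combine Ks Us = \<zero>\<^bsub>?Q\<^esub>"
    have "set (take (length Us) Ks) \<subseteq> ground_field n R" using 1 set_take_subset[of "length Us" Ks] by (rule order_trans[rotated])
    then obtain cs where cs: "take (length Us) Ks = map (\<lambda>c. ?q (const c)) cs" using Ks by blast
    have lcs: "length cs \<le> length xs"
      using arg_cong[OF cs, of length] by (simp add: Us_def)
    \<comment> \<open>The independence criterion admits coefficient lists of any length; the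
      truncated list is padded with zeros to the length of \<open>xs\<close>.\<close>
    define ds where "ds = cs @ replicate (length xs - length cs) 0"
    have lds: "length ds = length xs" using lcs by (simp add: ds_def)
    have "Q.combine (take (length Us) Ks) Us = \<zero>\<^bsub>?Q\<^esub>" using 2 Q.combine_take by simp
    moreover have "Q.combine (map (\<lambda>c. ?q (const c)) ds) Us = Q.combine (map (\<lambda>c. ?q (const c)) cs) Us"
    proof -
      have "?q (const 0) = \<zero>\<^bsub>?Q\<^esub>" using h.hom_zero by (simp add: FA_ops const_def)
      then have "map (\<lambda>c. ?q (const c)) ds = map (\<lambda>c. ?q (const c)) cs @ replicate (length xs - length cs) \<zero>\<^bsub>?Q\<^esub>"
        by (simp add: ds_def)
      then show ?thesis using Q.combine_append_replicate[OF Uc] by simp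
    qed
    ultimately have z: "?q (lin_comb ds xs) = \<zero>\<^bsub>?Q\<^esub>" and c: "lin_comb ds xs \<in> carrier ?F"
      using comb[of xs ds] xsw cs by (auto simp: Us_def)
    then have "lin_comb ds xs \<in> ?I" using q0 by blast
    then have k: "ev (F i) (lin_comb ds xs) = 0" if "i < k" for i
      using I_killed dual_systemD(1)[OF FP that] unfolding killed_def by blast
    have "ds ! i = 0" if "i < k" for i
    proof -
      have "(\<Sum>j<k. ds ! j * F i (P j)) = (\<Sum>j<k. if j = i then ds ! i else 0)"
        using dual_systemD(2)[OF FP _ that] dual_systemD(2)[OF FP that] that by (intro sum.cong) auto
      then show ?thesis using k[OF that] that by (simp add: ev_lin_comb lds xs)
    qed
    then have "\<forall>c\<in>set ds. c = 0" by (metis in_set_conv_nth lds xs(1))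
    then have "\<forall>c\<in>set cs. c = 0" by (simp add: ds_def)
    moreover have "?q (const 0) = \<zero>\<^bsub>?Q\<^esub>" using h.hom_zero by (simp add: FA_ops const_def)
    ultimately show "set (take (length Us) Ks) \<subseteq> {\<zero>\<^bsub>?Q\<^esub>}" unfolding cs by auto
  qed
  have span: "Q.Span (ground_field n R) Us = component n R m"
  proof
    show "Q.Span (ground_field n R) Us \<subseteq> component n R m"
    proof
      fix a assume "a \<in> Q.Span (ground_field n R) Us"
      then obtain Cs where "a = Q.combine Cs Us" "set Cs \<subseteq> ground_field n R"
        unfolding Q.Span_eq_combine_set_length_version[OF sf Uc] by blast
      then obtain cs where "a = ?q (lin_comb cs xs)"
        using Ks[of Cs] comb[of xs] xsw unfolding Us_def by auto
      then show "a \<in> component n R m"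
        unfolding component_def using lin_comb_component[OF xsw] by blast
    qed
    show "component n R m \<subseteq> Q.Span (ground_field n R) Us"
    proof
      fix a assume "a \<in> component n R m"
      then obtain f where f: "a = ?q f" "f \<in> free_component n m" by (auto simp: component_def)
      define cs where "cs = map (\<lambda>i. ev (F i) f) [0..<k]"
      have lcs: "length cs = length xs" "\<And>i. i < k \<Longrightarrow> cs ! i = ev (F i) f" by (auto simp: cs_def xs)
      let ?g = "lin_comb cs xs"
      have g: "?g \<in> free_component n m" by (rule lin_comb_component[OF xsw])
      let ?d = "f + const (- 1) * ?g"
      have d: "?d \<in> free_component n m" by (intro free_component_ops f g)
      have "?d \<in> ?I"
      proof (rule killed_component[OF d])
        fix \<phi> assume \<phi>: "\<phi> \<in> ann n R m"
        have "ev \<phi> f = (\<Sum>i<k. \<phi> (P i) * ev (F i) f)"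
        proof -
          have "ev \<phi> f = ev (\<lambda>w. \<Sum>i<k. \<phi> (P i) * F i w) f"
            by (rule arg_cong[where f = "\<lambda>\<psi>. ev \<psi> f"], rule ext) (rule dual_system_expand[OF fsub_ann FP \<phi>])
          also have "\<dots> = (\<Sum>i<k. \<phi> (P i) * ev (F i) f)"
            unfolding ev_def sum_distrib_left by (subst sum.swap) (simp add: mult_ac)
          finally show ?thesis .
        qed
        also have "\<dots> = ev \<phi> ?g" using ev_lin_comb[OF lcs(1)] lcs(2) xs by (simp add: mult.commute)
        finally show "ev \<phi> ?d = 0" by (simp add: ev_add ev_const_mult)
      qed
      then have "?q ?d = \<zero>\<^bsub>?Q\<^esub>" using q0 comp_carrier d by blast
      moreover have "f = ?d \<oplus>\<^bsub>?F\<^esub> ?g"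
      proof -
        have "const (- 1) * ?g + ?g = (const (- 1) + const 1) * ?g" by (simp add: distrib_right const_def)
        also have "const (- 1) + const 1 = (0 :: 'k ncpoly)" unfolding const_def single_add[symmetric] by simp
        finally show ?thesis by (simp add: FA_ops add.assoc)
      qed
      ultimately have "a = ?q ?g"
        using h.hom_add[of ?d ?g] comp_carrier d g f h.hom_closed by (metis Q.l_zero subsetD)
      also have "\<dots> = Q.combine (map (\<lambda>c. ?q (const c)) cs) Us"
        using comb[of xs cs] xsw by (simp add: Us_def)
      finally show "a \<in> Q.Span (ground_field n R) Us"
        unfolding Q.Span_eq_combine_set_length_version[OF sf Uc]
        by (intro CollectI exI[of _ "map (\<lambda>c. ?q (const c)) cs"]) (auto simp: lcs Us_def ground_field_def)
    qed
  qed
  have "Q.dimension k (ground_field n R) (component n R m)"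
    using Q.dimension_independent[OF indep] span by (simp add: Us_def xs)
  then show ?thesis
    using Q.dimI[OF sf] by (simp add: component_dim_def over_def)
qed

end

subsection \<open>Multilinear forms\<close>

text \<open>Gaussian elimination on the last equation: either all its entries vanish, or a pivot
  \<open>p\<close> is removed and the remaining unknowns satisfy a system whose entries are 2 by 2
  minors.\<close>

lemma homogeneous_system:
  fixes a :: "'i \<Rightarrow> nat \<Rightarrow> 'k::field"
  assumes "finite I" "k < card I"
  shows "\<exists>c. (\<exists>i\<in>I. c i \<noteq> 0) \<and> (\<forall>j<k. (\<Sum>i\<in>I. c i * a i j) = 0)"
  using assms
proof (induction k arbitrary: I a)
  case 0
  then have "I \<noteq> {}" by auto
  then show ?case by (intro exI[of _ "\<lambda>_. 1"]) auto
next
  case (Suc k)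
  show ?case
  proof (cases "\<forall>i\<in>I. a i k = 0")
    case True
    have "k < card I" using Suc.prems(2) by simp
    from Suc.IH[OF Suc.prems(1) this, of a] obtain c
      where c: "\<exists>i\<in>I. c i \<noteq> 0" "\<forall>j<k. (\<Sum>i\<in>I. c i * a i j) = 0" by blast
    have "(\<Sum>i\<in>I. c i * a i k) = 0" using True by simp
    with c have "\<forall>j<Suc k. (\<Sum>i\<in>I. c i * a i j) = 0" by (simp add: less_Suc_eq)
    with c(1) show ?thesis by blast
  next
    case False
    then obtain p where p: "p \<in> I" "a p k \<noteq> 0" by auto
    let ?J = "I - {p}"
    have "k < card ?J" using Suc.prems p by simp
    from Suc.IH[OF _ this, of "\<lambda>i j. a i j * a p k - a i k * a p j"] Suc.prems(1) obtain c
      where c: "\<exists>i\<in>?J. c i \<noteq> 0" "\<forall>j<k. (\<Sum>i\<in>?J. c i * (a i j * a p k - a i k * a p j)) = 0" by auto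
    \<comment> \<open>The solution of the smaller system is scaled by the pivot entry, which avoids
      division; the value at \<open>p\<close> is then the one that solves equation
      \<open>k\<close>.\<close>
    define d where "d = (\<lambda>i. if i = p then - (\<Sum>i\<in>?J. c i * a i k) else c i * a p k)"
    have sum: "(\<Sum>i\<in>I. d i * a i j) = (\<Sum>i\<in>?J. c i * (a i j * a p k - a i k * a p j))" for j
    proof -
      have "(\<Sum>i\<in>I. d i * a i j) = d p * a p j + (\<Sum>i\<in>?J. d i * a i j)"
        by (rule sum.remove[OF Suc.prems(1) p(1)])
      also have "(\<Sum>i\<in>?J. d i * a i j) = (\<Sum>i\<in>?J. c i * a p k * a i j)"
        by (intro sum.cong) (auto simp: d_def)
      finally show ?thesis
        by (simp add: d_def right_diff_distrib sum_subtractf sum_distrib_right sum_distrib_left mult_ac)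
    qed
    have "\<forall>j<Suc k. (\<Sum>i\<in>I. d i * a i j) = 0"
    proof (intro allI impI)
      fix j assume "j < Suc k"
      show "(\<Sum>i\<in>I. d i * a i j) = 0"
      proof (cases "j = k")
        case True
        then show ?thesis unfolding sum by (simp add: mult.commute)
      next
        case False
        then show ?thesis using c(2) \<open>j < Suc k\<close> unfolding sum by simp
      qed
    qed
    moreover have "\<exists>i\<in>I. d i \<noteq> 0" using c(1) p(2) by (auto simp: d_def)
    ultimately show ?thesis by blast
  qed
qed

text \<open>If \<open>k' > k\<close>, a nontrivial combination of the \<open>G i\<close> vanishes at
  all points \<open>P\<close> and hence is zero, although its value at \<open>Y j\<close> is its
  coefficient with index \<open>j\<close>.\<close>

lemma has_dim_le:
  assumes "fsub Q" "dual_system Q k F P"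
    and "\<And>i. i < k' \<Longrightarrow> G i \<in> Q" "\<And>i j. i < k' \<Longrightarrow> j < k' \<Longrightarrow> G i (Y j) = (if i = j then 1 else 0)"
  shows "k' \<le> k"
proof (rule ccontr)
  assume "\<not> k' \<le> k"
  then obtain c where c: "\<exists>i\<in>{..<k'}. c i \<noteq> 0" "\<forall>j<k. (\<Sum>i<k'. c i * G i (P j)) = 0"
    using homogeneous_system[of "{..<k'}" k "\<lambda>i j. G i (P j)"] by auto
  let ?f = "\<lambda>x. \<Sum>i<k'. c i * G i x"
  have "?f \<in> Q" by (intro fsub_sum assms) auto
  then have z: "?f = (\<lambda>_. 0)" by (rule dual_systemD(3)[OF assms(2)]) (use c(2) in auto)
  have "c j = 0" if "j < k'" for j
  proof -
    have "?f (Y j) = (\<Sum>i<k'. if i = j then c j else 0)" using assms(4)[OF _ that] by (intro sum.cong) auto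
    then show ?thesis using fun_cong[OF z, of "Y j"] that by simp
  qed
  then show False using c(1) by auto
qed

lemma has_dim_unique:
  assumes "fsub Q" "has_dim Q k" "has_dim Q k'"
  shows "k = k'"
proof -
  obtain F P F' P' where *: "dual_system Q k F P" "dual_system Q k' F' P'"
    using assms unfolding has_dim_def by blast
  show ?thesis
  proof (rule antisym)
    show "k \<le> k'" by (rule has_dim_le[OF assms(1) *(2)]) (rule dual_systemD[OF *(1)]; assumption)+
    show "k' \<le> k" by (rule has_dim_le[OF assms(1) *(1)]) (rule dual_systemD[OF *(2)]; assumption)+
  qed
qed

lemma has_dim_transfer:
  assumes "has_dim Q k" "\<And>f. f \<in> Q \<Longrightarrow> (\<lambda>x. f (a x)) \<in> Q'" "\<And>f. f \<in> Q' \<Longrightarrow> (\<lambda>x. f (b x)) \<in> Q"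
    and "\<And>x. a (b x) = x" "\<And>x. b (a x) = x"
  shows "has_dim Q' k"
proof -
  obtain F P where *: "dual_system Q k F P" using assms(1) unfolding has_dim_def by blast
  show ?thesis
  proof (rule has_dimI[of _ "\<lambda>i x. F i (a x)" _ "\<lambda>i. b (P i)"])
    show "(\<lambda>x. F i (a x)) \<in> Q'" if "i < k" for i using assms(2)[OF dual_systemD(1)[OF * that]] .
    show "F i (a (b (P j))) = (if i = j then 1 else 0)" if "i < k" "j < k" for i j
      using dual_systemD(2)[OF * that] assms(4) by simp
    fix f assume f: "f \<in> Q'" and z: "\<And>i. i < k \<Longrightarrow> f (b (P i)) = 0"
    have "(\<lambda>x. f (b x)) = (\<lambda>_. 0)" by (rule dual_systemD(3)[OF * assms(3)[OF f] z])
    then have "f (b (a x)) = 0" for x by (rule fun_cong)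
    then show "f = (\<lambda>_. 0)" unfolding assms(5) by blast
  qed
qed

text \<open>
  The words of length two factor through \<open>A\<^sub>2\<close> with structure constants \<open>c\<close>, so that \<open>SW c m\<close> is the
  dual of \<open>A\<^sub>m\<close>; \<open>SV \<mu> m\<close> below is its coordinate-free version, on lists of vectors.
\<close>

definition SW :: "(nat \<Rightarrow> nat \<Rightarrow> nat \<Rightarrow> 'k::field) \<Rightarrow> nat \<Rightarrow> (nat list \<Rightarrow> 'k) set" where
  "SW c m = {f. (\<forall>w. f w \<noteq> 0 \<longrightarrow> length w = m \<and> set w \<subseteq> {..<3}) \<and>
     (\<forall>p s. length p + length s + 2 = m \<longrightarrow> (\<exists>\<psi>. \<forall>i<3. \<forall>j<3. f (p @ [i, j] @ s) = (\<Sum>k<3. \<psi> k * c i j k)))}"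

lemma SWD:
  assumes "f \<in> SW c m"
  shows "f w \<noteq> 0 \<Longrightarrow> length w = m \<and> set w \<subseteq> {..<3}"
    "length p + length s + 2 = m \<Longrightarrow> \<exists>\<psi>. \<forall>i<3. \<forall>j<3. f (p @ [i, j] @ s) = (\<Sum>k<3. \<psi> k * c i j k)"
  using assms unfolding SW_def by blast+

lemma SWI:
  assumes "\<And>w. f w \<noteq> 0 \<Longrightarrow> length w = m \<and> set w \<subseteq> {..<3}"
    "\<And>p s. length p + length s + 2 = m \<Longrightarrow> \<exists>\<psi>. \<forall>i<3. \<forall>j<3. f (p @ [i, j] @ s) = (\<Sum>k<3. \<psi> k * c i j k)"
  shows "f \<in> SW c m"
  using assms unfolding SW_def by blast

text \<open>The functions \<open>F\<close> form a basis of the dual of \<open>A\<^sub>2\<close>, so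
  \<open>F k [i, j]\<close> are the coordinates of a product of two letters. A functional
  annihilates \<open>p r s\<close> for all relations \<open>r\<close> exactly if its restriction to
  the middle pair lies in the span of the \<open>F k\<close>.\<close>

lemma ann_eq_SW:
  assumes R: "quadratic_relations 3 R" and FP: "dual_system (ann 3 R 2) 3 F P"
  shows "ann 3 R m = SW (\<lambda>i j k. F k [i, j]) m"
proof (intro equalityI subsetI)
  fix \<phi> assume \<phi>: "\<phi> \<in> ann 3 R m"
  show "\<phi> \<in> SW (\<lambda>i j k. F k [i, j]) m"
  proof (rule SWI)
    show "length w = m \<and> set w \<subseteq> {..<3}" if "\<phi> w \<noteq> 0" for w using annD(1)[OF \<phi> that] .
    fix p s :: "nat list" assume l: "length p + length s + 2 = m"
    show "\<exists>\<psi>. \<forall>i<3. \<forall>j<3. \<phi> (p @ [i, j] @ s) = (\<Sum>k<3. \<psi> k * F k [i, j])"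
    proof (cases "set p \<subseteq> {..<3} \<and> set s \<subseteq> {..<3}")
      case True
      let ?\<chi> = "\<lambda>w. \<phi> (p @ w @ s)"
      have "?\<chi> \<in> ann 3 R 2"
        unfolding ann_def
      proof (intro CollectI conjI allI ballI impI)
        fix w assume "\<phi> (p @ w @ s) \<noteq> 0"
        then have "length (p @ w @ s) = m \<and> set (p @ w @ s) \<subseteq> {..<3}" by (rule annD(1)[OF \<phi>])
        then show "length w = 2" "set w \<subseteq> {..<3}" using l by auto
      next
        fix p' s' :: "nat list" and r assume r: "r \<in> R" and "length p' + length s' + 2 = 2"
        then have "p' = []" "s' = []" by auto
        then show "ev (\<lambda>w. \<phi> (p @ (p' @ w @ s') @ s)) r = 0"
          using annD(2)[OF \<phi> r l] True by simp
      qed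
      from dual_system_expand[OF fsub_ann FP this]
      have "\<phi> (p @ [i, j] @ s) = (\<Sum>k<3. \<phi> (p @ P k @ s) * F k [i, j])" for i j .
      then show ?thesis by (intro exI[of _ "\<lambda>k. \<phi> (p @ P k @ s)"]) simp
    next
      case False
      have "\<phi> (p @ [i, j] @ s) = 0" for i j
      proof (rule ccontr)
        assume "\<phi> (p @ [i, j] @ s) \<noteq> 0"
        from annD(1)[OF \<phi> this] False show False by auto
      qed
      then show ?thesis by (intro exI[of _ "\<lambda>_. 0"]) simp
    qed
  qed
next
  fix \<phi> assume \<phi>: "\<phi> \<in> SW (\<lambda>i j k. F k [i, j]) m"
  show "\<phi> \<in> ann 3 R m"
    unfolding ann_def
  proof (intro CollectI conjI allI ballI impI)
    show "length w = m" "set w \<subseteq> {..<3}" if "\<phi> w \<noteq> 0" for w using SWD(1)[OF \<phi> that] by auto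
    fix p s :: "nat list" and r assume r: "r \<in> R" and l: "length p + length s + 2 = m"
    obtain \<psi> where \<psi>: "\<And>i j. i < 3 \<Longrightarrow> j < 3 \<Longrightarrow> \<phi> (p @ [i, j] @ s) = (\<Sum>k<3. \<psi> k * F k [i, j])"
      using SWD(2)[OF \<phi> l] by blast
    have "\<phi> (p @ letters w @ s) = (\<Sum>k<3. \<psi> k * F k (letters w))" if w: "w \<in> Poly_Mapping.keys r" for w
    proof -
      have "r \<in> carrier (free_algebra 3)" "length (letters w) = 2" using R_in[OF R r] w by auto
      then have "length (letters w) = 2" "set (letters w) \<subseteq> {..<3}" using w by (auto simp: free_algebra_def)
      then obtain i j where "letters w = [i, j]" "i < 3" "j < 3"
        by (auto simp: numeral_2_eq_2 length_Suc_conv)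
      then show ?thesis using \<psi> by simp
    qed
    then have "ev (\<lambda>w. \<phi> (p @ w @ s)) r = (\<Sum>w\<in>Poly_Mapping.keys r. Poly_Mapping.lookup r w * (\<Sum>k<3. \<psi> k * F k (letters w)))"
      unfolding ev_def by (intro sum.cong) auto
    also have "\<dots> = (\<Sum>k<3. \<psi> k * ev (F k) r)"
      unfolding ev_def sum_distrib_left by (subst sum.swap) (simp add: mult_ac)
    also have "\<dots> = 0"
    proof (rule sum.neutral, rule ballI)
      fix k :: nat assume "k \<in> {..<3}"
      then have "F k \<in> ann 3 R 2" using dual_systemD(1)[OF FP] by simp
      from annD(2)[OF this r, of "[]" "[]"] show "\<psi> k * ev (F k) r = 0" by simp
    qed
    finally show "ev (\<lambda>w. \<phi> (p @ w @ s)) r = 0" .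
  qed
qed

section \<open>Extension of scalars to the algebraic closure\<close>

lemma ex_functional:
  fixes a :: "'k::field alg_closure"
  assumes "a \<noteq> 0"
  obtains \<kappa> :: "'k alg_closure \<Rightarrow> 'k"
  where "\<And>x y. \<kappa> (x + y) = \<kappa> x + \<kappa> y" "\<And>x c. \<kappa> (to_ac c * x) = c * \<kappa> x" "\<kappa> a \<noteq> 0"
proof -
  interpret V: vector_space "\<lambda>(c :: 'k) (x :: 'k alg_closure). to_ac c * x"
    by standard (auto simp: algebra_simps)
  interpret K: vector_space "(*) :: 'k \<Rightarrow> 'k \<Rightarrow> 'k"
    by standard (auto simp: algebra_simps)
  interpret VP: vector_space_pair "\<lambda>(c :: 'k) (x :: 'k alg_closure). to_ac c * x" "(*) :: 'k \<Rightarrow> 'k \<Rightarrow> 'k" ..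
  have "V.independent {a}" using assms by simp
  from VP.linear_independent_extend[OF this, of "\<lambda>_. 1"] obtain g
    where g: "Vector_Spaces.linear (\<lambda>(c :: 'k) (x :: 'k alg_closure). to_ac c * x) (*) g" "g a = 1" by auto
  interpret g: Vector_Spaces.linear "\<lambda>(c :: 'k) (x :: 'k alg_closure). to_ac c * x" "(*)" g by (rule g(1))
  show ?thesis by (rule that[of g]) (auto simp: g.add g.scale g(2))
qed

lemma functional_sum:
  assumes "\<And>x y. \<kappa> (x + y) = \<kappa> x + (\<kappa> :: 'k::field alg_closure \<Rightarrow> 'k) y"
  shows "\<kappa> (\<Sum>i\<in>A. f i) = (\<Sum>i\<in>A. \<kappa> (f i))"
proof -
  have "\<kappa> 0 = \<kappa> 0 + \<kappa> 0" using assms[of 0 0] by (simp only: add_0)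
  then have "\<kappa> 0 = 0" by (metis add_cancel_left_right)
  then show ?thesis by (induction A rule: infinite_finite_induct) (simp_all add: assms)
qed

text \<open>The dual system over \<open>K\<close> is reused over the closure. Its points still
  detect every form, by descent: if \<open>f w\<close> were nonzero, a \<open>K\<close>-linear
  functional \<open>\<kappa>\<close> that is nonzero on \<open>f w\<close> would turn
  \<open>f\<close> into a form over \<open>K\<close> vanishing at all points but not at
  \<open>w\<close>.\<close>

lemma has_dim_SW_extend:
  fixes c :: "nat \<Rightarrow> nat \<Rightarrow> nat \<Rightarrow> 'k::field"
  assumes "has_dim (SW c m) d"
  shows "has_dim (SW (\<lambda>i j k. to_ac (c i j k)) m) d"
proof -
  obtain F P where *: "dual_system (SW c m) d F P" using assms unfolding has_dim_def by blast
  show ?thesis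
  proof (rule has_dimI[of _ "\<lambda>i w. to_ac (F i w)" _ P])
    fix i assume "i < d"
    then have Fi: "F i \<in> SW c m" by (rule dual_systemD(1)[OF *])
    show "(\<lambda>w. to_ac (F i w)) \<in> SW (\<lambda>i j k. to_ac (c i j k)) m"
    proof (rule SWI)
      show "length w = m \<and> set w \<subseteq> {..<3}" if "to_ac (F i w) \<noteq> 0" for w using SWD(1)[OF Fi, of w] that by simp
      fix p s :: "nat list" assume "length p + length s + 2 = m"
      from SWD(2)[OF Fi this] obtain \<psi> where "\<And>a b. a < 3 \<Longrightarrow> b < 3 \<Longrightarrow> F i (p @ [a, b] @ s) = (\<Sum>k<3. \<psi> k * c a b k)" by blast
      then show "\<exists>\<psi>. \<forall>a<3. \<forall>b<3. to_ac (F i (p @ [a, b] @ s)) = (\<Sum>k<3. \<psi> k * to_ac (c a b k))"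
        by (intro exI[of _ "\<lambda>k. to_ac (\<psi> k)"]) (simp add: to_ac_sum)
    qed
  next
    show "to_ac (F i (P j)) = (if i = j then 1 else 0)" if "i < d" "j < d" for i j
      using dual_systemD(2)[OF * that] by simp
  next
    fix f assume f: "f \<in> SW (\<lambda>i j k. to_ac (c i j k)) m" and z: "\<And>i. i < d \<Longrightarrow> f (P i) = 0"
    show "f = (\<lambda>_. 0)"
    proof (rule ext, rule ccontr)
      fix w assume "f w \<noteq> 0"
      then obtain \<kappa> where l: "\<And>x y. \<kappa> (x + y) = \<kappa> x + \<kappa> y" "\<And>x c. \<kappa> (to_ac c * x) = c * \<kappa> x" "\<kappa> (f w) \<noteq> 0"
        using ex_functional by metis
      have l0: "\<kappa> 0 = 0" using l(2)[of 0 0] by simp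
      have "(\<lambda>w. \<kappa> (f w)) \<in> SW c m"
      proof (rule SWI)
        show "length w = m \<and> set w \<subseteq> {..<3}" if "\<kappa> (f w) \<noteq> 0" for w
          using SWD(1)[OF f, of w] that l0 by (cases "f w = 0") auto
        fix p s :: "nat list" assume "length p + length s + 2 = m"
        from SWD(2)[OF f this] obtain \<psi> where "\<And>a b. a < 3 \<Longrightarrow> b < 3 \<Longrightarrow> f (p @ [a, b] @ s) = (\<Sum>k<3. \<psi> k * to_ac (c a b k))" by blast
        moreover have "\<kappa> (\<Sum>k<3. \<psi> k * to_ac (c a b k)) = (\<Sum>k<3. \<kappa> (\<psi> k) * c a b k)" for a b
          using l(2) by (simp add: functional_sum[OF l(1)] mult.commute)
        ultimately show "\<exists>\<psi>. \<forall>a<3. \<forall>b<3. \<kappa> (f (p @ [a, b] @ s)) = (\<Sum>k<3. \<psi> k * c a b k)"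
          by (intro exI[of _ "\<lambda>k. \<kappa> (\<psi> k)"]) simp
      qed
      then have "(\<lambda>w. \<kappa> (f w)) = (\<lambda>_. 0)"
        by (rule dual_systemD(3)[OF *]) (simp add: z l0)
      from fun_cong[OF this, of w] l(3) show False by simp
    qed
  qed
qed

section \<open>Linear and bilinear maps in dimension three\<close>

definition lin :: "(('k::field)^3 \<Rightarrow> 'k) \<Rightarrow> bool" where
  "lin f \<longleftrightarrow> (\<forall>u v. f (u + v) = f u + f v) \<and> (\<forall>c v. f (c *s v) = c * f v)"

definition vlin :: "(('k::field)^3 \<Rightarrow> 'k^3) \<Rightarrow> bool" where
  "vlin f \<longleftrightarrow> (\<forall>u v. f (u + v) = f u + f v) \<and> (\<forall>c v. f (c *s v) = c *s f v)"

definition bil :: "(('k::field)^3 \<Rightarrow> 'k^3 \<Rightarrow> 'k^3) \<Rightarrow> bool" where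
  "bil \<mu> \<longleftrightarrow> (\<forall>u. vlin (\<mu> u)) \<and> (\<forall>v. vlin (\<lambda>u. \<mu> u v))"

definition dot :: "('k::field)^3 \<Rightarrow> 'k^3 \<Rightarrow> 'k" where
  "dot x y = x$1 * y$1 + x$2 * y$2 + x$3 * y$3"

definition e1 :: "('k::field)^3" where "e1 = vector [1, 0, 0]"
definition e2 :: "('k::field)^3" where "e2 = vector [0, 1, 0]"
definition e3 :: "('k::field)^3" where "e3 = vector [0, 0, 1]"

lemma e_nth [simp]: "e1$1 = 1" "e1$2 = 0" "e1$3 = 0" "e2$1 = 0" "e2$2 = 1" "e2$3 = 0" "e3$1 = 0" "e3$2 = 0" "e3$3 = 1"
  by (simp_all add: e1_def e2_def e3_def)

lemma vec3_eqI: "x$1 = y$1 \<Longrightarrow> x$2 = y$2 \<Longrightarrow> x$3 = y$3 \<Longrightarrow> x = (y :: 'a^3)"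
  by (simp add: vec_eq_iff forall_3)

lemma vec3_eq_iff: "x = (y :: 'a^3) \<longleftrightarrow> x$1 = y$1 \<and> x$2 = y$2 \<and> x$3 = y$3"
  by (simp add: vec_eq_iff forall_3)

lemma vec3_expand: "v = v$1 *s e1 + v$2 *s e2 + v$3 *s e3"
  by (rule vec3_eqI) auto

lemma linD:
  assumes "lin f"
  shows "f (u + v) = f u + f v" "f (c *s v) = c * f v" "f 0 = 0" "f (- v) = - f v" "f (u - v) = f u - f v"
proof -
  show *: "f (u + v) = f u + f v" "f (c *s v) = c * f v" for u v c using assms by (auto simp: lin_def)
  show "f 0 = 0" using *(2)[of 0 0] by simp
  show n: "f (- v) = - f v" for v using *(2)[of "-1" v] by simp
  show "f (u - v) = f u - f v" using *(1)[of u "- v"] n by simp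
qed

lemma vlinD:
  assumes "vlin f"
  shows "f (u + v) = f u + f v" "f (c *s v) = c *s f v" "f 0 = 0" "f (- v) = - f v" "f (u - v) = f u - f v"
proof -
  show *: "f (u + v) = f u + f v" "f (c *s v) = c *s f v" for u v c using assms by (auto simp: vlin_def)
  show "f 0 = 0" using *(2)[of 0 0] by simp
  show n: "f (- v) = - f v" for v using *(2)[of "-1" v] by simp
  show "f (u - v) = f u - f v" using *(1)[of u "- v"] n by simp
qed

lemma lin_expand:
  assumes "lin f"
  shows "f v = v$1 * f e1 + v$2 * f e2 + v$3 * f e3"
  using arg_cong[OF vec3_expand[of v], of f] unfolding linD[OF assms] .

lemma vlin_expand:
  assumes "vlin f"
  shows "f v = v$1 *s f e1 + v$2 *s f e2 + v$3 *s f e3"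
  using arg_cong[OF vec3_expand[of v], of f] unfolding vlinD[OF assms] .

lemma lin_dot_ex:
  assumes "lin f"
  shows "\<exists>\<psi>. \<forall>v. f v = dot \<psi> v"
proof (intro exI allI)
  fix v show "f v = dot (vector [f e1, f e2, f e3]) v"
    unfolding lin_expand[OF assms, of v] by (simp add: dot_def mult.commute)
qed

lemma lin_dot: "lin (dot \<psi>)"
  by (auto simp: lin_def dot_def algebra_simps)

lemma lin_vlin: "lin f \<Longrightarrow> vlin g \<Longrightarrow> lin (\<lambda>v. f (g v))"
  by (auto simp: lin_def vlin_def)

lemma bilD:
  assumes "bil \<mu>"
  shows "\<mu> (u + u') v = \<mu> u v + \<mu> u' v" "\<mu> (c *s u) v = c *s \<mu> u v" "\<mu> 0 v = 0"
    "\<mu> u (v + v') = \<mu> u v + \<mu> u v'" "\<mu> u (c *s v) = c *s \<mu> u v" "\<mu> u 0 = 0"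
    "\<mu> (- u) v = - \<mu> u v" "\<mu> u (- v) = - \<mu> u v" "\<mu> (u - u') v = \<mu> u v - \<mu> u' v" "\<mu> u (v - v') = \<mu> u v - \<mu> u v'"
proof -
  have 1: "vlin (\<mu> u)" "vlin (\<lambda>u. \<mu> u v)" for u v using assms by (auto simp: bil_def)
  show "\<mu> (u + u') v = \<mu> u v + \<mu> u' v" "\<mu> (c *s u) v = c *s \<mu> u v" "\<mu> 0 v = 0"
    "\<mu> (- u) v = - \<mu> u v" "\<mu> (u - u') v = \<mu> u v - \<mu> u' v"
    using vlinD[OF 1(2)[of v]] by auto
  show "\<mu> u (v + v') = \<mu> u v + \<mu> u v'" "\<mu> u (c *s v) = c *s \<mu> u v" "\<mu> u 0 = 0"
    "\<mu> u (- v) = - \<mu> u v" "\<mu> u (v - v') = \<mu> u v - \<mu> u v'"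
    using vlinD[OF 1(1)[of u]] by auto
qed

section \<open>Forms on lists of vectors and their behaviour under changes of coordinates\<close>

definition SV :: "(('k::field)^3 \<Rightarrow> 'k^3 \<Rightarrow> 'k^3) \<Rightarrow> nat \<Rightarrow> (('k^3) list \<Rightarrow> 'k) set" where
  "SV \<mu> m = {F. (\<forall>l. length l \<noteq> m \<longrightarrow> F l = 0) \<and>
     (\<forall>p s. length p + length s + 1 = m \<longrightarrow> lin (\<lambda>v. F (p @ v # s))) \<and>
     (\<forall>p s. length p + length s + 2 = m \<longrightarrow> (\<exists>\<psi>. \<forall>u v. F (p @ u # v # s) = dot \<psi> (\<mu> u v)))}"

lemma SVD:
  assumes "F \<in> SV \<mu> m"
  shows "length l \<noteq> m \<Longrightarrow> F l = 0"
    "length p + length s + 1 = m \<Longrightarrow> lin (\<lambda>v. F (p @ v # s))"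
    "length p + length s + 2 = m \<Longrightarrow> \<exists>\<psi>. \<forall>u v. F (p @ u # v # s) = dot \<psi> (\<mu> u v)"
  using assms unfolding SV_def by blast+

lemma SVI:
  assumes "\<And>l. length l \<noteq> m \<Longrightarrow> F l = 0"
    "\<And>p s. length p + length s + 1 = m \<Longrightarrow> lin (\<lambda>v. F (p @ v # s))"
    "\<And>p s. length p + length s + 2 = m \<Longrightarrow> \<exists>\<psi>. \<forall>u v. F (p @ u # v # s) = dot \<psi> (\<mu> u v)"
  shows "F \<in> SV \<mu> m"
  using assms unfolding SV_def by blast

lemma dot_add_left: "dot (x + y) z = dot x z + dot y z"
  by (simp add: dot_def algebra_simps)

lemma dot_scale_left: "dot (c *s x) z = c * dot x z"
  by (simp add: dot_def algebra_simps)

lemma dot_zero_left [simp]: "dot 0 z = 0" "dot z 0 = 0"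
  by (simp_all add: dot_def)

lemma fsub_SV: "fsub (SV \<mu> m)"
  unfolding fsub_def
proof (intro conjI ballI allI)
  show "(\<lambda>_. 0) \<in> SV \<mu> m"
    by (rule SVI) (auto simp: lin_def intro: exI[of _ 0])
  fix f g assume f: "f \<in> SV \<mu> m" and g: "g \<in> SV \<mu> m"
  show "(\<lambda>x. f x + g x) \<in> SV \<mu> m"
  proof (rule SVI)
    show "lin (\<lambda>v. f (p @ v # s) + g (p @ v # s))" if "length p + length s + 1 = m" for p s
      using SVD(2)[OF f that] SVD(2)[OF g that] by (simp add: lin_def algebra_simps)
    show "\<exists>\<psi>. \<forall>u v. f (p @ u # v # s) + g (p @ u # v # s) = dot \<psi> (\<mu> u v)" if "length p + length s + 2 = m" for p s
      using SVD(3)[OF f that] SVD(3)[OF g that] by (metis dot_add_left)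
  qed (simp add: SVD(1)[OF f] SVD(1)[OF g])
next
  fix c f assume f: "f \<in> SV \<mu> m"
  show "(\<lambda>x. c * f x) \<in> SV \<mu> m"
  proof (rule SVI)
    show "lin (\<lambda>v. c * f (p @ v # s))" if "length p + length s + 1 = m" for p s
      using SVD(2)[OF f that] by (simp add: lin_def algebra_simps)
    show "\<exists>\<psi>. \<forall>u v. c * f (p @ u # v # s) = dot \<psi> (\<mu> u v)" if "length p + length s + 2 = m" for p s
      using SVD(3)[OF f that] by (metis dot_scale_left)
  qed (simp add: SVD(1)[OF f])
qed

lemma SV_cons: "F \<in> SV \<mu> (Suc m) \<Longrightarrow> (\<lambda>l. F (v # l)) \<in> SV \<mu> m"
proof (rule SVI)
  assume F: "F \<in> SV \<mu> (Suc m)"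
  show "F (v # l) = 0" if "length l \<noteq> m" for l using SVD(1)[OF F] that by simp
  show "lin (\<lambda>u. F (v # p @ u # s))" if "length p + length s + 1 = m" for p s
    using SVD(2)[OF F, of "v # p" s] that by simp
  show "\<exists>\<psi>. \<forall>u w. F (v # p @ u # w # s) = dot \<psi> (\<mu> u w)" if "length p + length s + 2 = m" for p s
    using SVD(3)[OF F, of "v # p" s] that by simp
qed

lemma SV_snoc: "F \<in> SV \<mu> (Suc m) \<Longrightarrow> (\<lambda>l. F (l @ [v])) \<in> SV \<mu> m"
proof (rule SVI)
  assume F: "F \<in> SV \<mu> (Suc m)"
  show "F (l @ [v]) = 0" if "length l \<noteq> m" for l using SVD(1)[OF F] that by simp
  show "lin (\<lambda>u. F ((p @ u # s) @ [v]))" if "length p + length s + 1 = m" for p s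
    using SVD(2)[OF F, of p "s @ [v]"] that by simp
  show "\<exists>\<psi>. \<forall>u w. F ((p @ u # w # s) @ [v]) = dot \<psi> (\<mu> u w)" if "length p + length s + 2 = m" for p s
    using SVD(3)[OF F, of p "s @ [v]"] that by simp
qed

text \<open>The conditions with a nonempty prefix are those of the slices at a fixed head, so only
  the two conditions at the head itself remain. This lets forms be built by induction on the
  degree.\<close>

lemma SV_consI:
  assumes "\<And>v. (\<lambda>l. F (v # l)) \<in> SV \<mu> m" "F [] = 0"
    "\<And>s. length s = m \<Longrightarrow> lin (\<lambda>v. F (v # s))"
    "\<And>s. Suc (length s) = m \<Longrightarrow> \<exists>\<psi>. \<forall>u v. F (u # v # s) = dot \<psi> (\<mu> u v)"
  shows "F \<in> SV \<mu> (Suc m)"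
proof (rule SVI)
  show "F l = 0" if "length l \<noteq> Suc m" for l
    using SVD(1)[OF assms(1)] assms(2) that by (cases l) auto
  show "lin (\<lambda>v. F (p @ v # s))" if "length p + length s + 1 = Suc m" for p s
    using SVD(2)[OF assms(1), of "tl p" s "hd p"] assms(3)[of s] that by (cases p) auto
  show "\<exists>\<psi>. \<forall>u v. F (p @ u # v # s) = dot \<psi> (\<mu> u v)" if "length p + length s + 2 = Suc m" for p s
    using SVD(3)[OF assms(1), of "tl p" s "hd p"] assms(4)[of s] that by (cases p) auto
qed

lemma SV_zero:
  assumes F: "F \<in> SV \<mu> m" and z: "\<And>l. set l \<subseteq> {e1, e2, e3} \<Longrightarrow> length l = m \<Longrightarrow> F l = 0"
  shows "F = (\<lambda>_. 0)"
  using assms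
proof (induction m arbitrary: F)
  case 0
  then have "F l = 0" for l using SVD(1)[OF 0(1), of l] by (cases l) auto
  then show ?case by auto
next
  case (Suc m)
  have *: "(\<lambda>l. F (e # l)) = (\<lambda>_. 0)" if "e \<in> {e1, e2, e3}" for e
  proof (rule Suc.IH[OF SV_cons[OF Suc.prems(1)]])
    show "F (e # l) = 0" if "set l \<subseteq> {e1, e2, e3}" "length l = m" for l
      using Suc.prems(2)[of "e # l"] that \<open>e \<in> _\<close> by auto
  qed
  have "F l = 0" for l
  proof (cases l)
    case Nil
    then show ?thesis using SVD(1)[OF Suc.prems(1), of l] by simp
  next
    case (Cons v s)
    show ?thesis
    proof (cases "length s = m")
      case True
      then have "lin (\<lambda>v. F (v # s))" using SVD(2)[OF Suc.prems(1), of "[]" s] by simp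
      then have "F (v # s) = v$1 * F (e1 # s) + v$2 * F (e2 # s) + v$3 * F (e3 # s)"
        by (rule lin_expand)
      then show ?thesis using fun_cong[OF *[of e1], of s] fun_cong[OF *[of e2], of s] fun_cong[OF *[of e3], of s] Cons by simp
    next
      case False
      then show ?thesis using SVD(1)[OF Suc.prems(1), of l] Cons by simp
    qed
  qed
  then show ?case by auto
qed

lemma SV_change_mem:
  assumes "vlin g" "\<And>u v. \<mu> (g u) (g v) = h (\<mu>' u v)" "vlin h" "F \<in> SV \<mu> m"
  shows "(\<lambda>l. F (map g l)) \<in> SV \<mu>' m"
proof (rule SVI)
  show "F (map g l) = 0" if "length l \<noteq> m" for l using SVD(1)[OF assms(4)] that by simp
  show "lin (\<lambda>v. F (map g (p @ v # s)))" if "length p + length s + 1 = m" for p s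
    using lin_vlin[OF SVD(2)[OF assms(4), of "map g p" "map g s"] assms(1)] that by simp
  fix p s :: "('a^3) list" assume "length p + length s + 2 = m"
  then obtain \<psi> where "\<And>u v. F (map g p @ u # v # map g s) = dot \<psi> (\<mu> u v)"
    using SVD(3)[OF assms(4), of "map g p" "map g s"] by auto
  then have 1: "F (map g (p @ u # v # s)) = dot \<psi> (h (\<mu>' u v))" for u v
    by (simp add: assms(2)[symmetric])
  obtain \<psi>' where "\<And>x. dot \<psi> (h x) = dot \<psi>' x"
    using lin_dot_ex[OF lin_vlin[OF lin_dot assms(3)], of \<psi>] by auto
  then show "\<exists>\<psi>'. \<forall>u v. F (map g (p @ u # v # s)) = dot \<psi>' (\<mu>' u v)" unfolding 1 by (intro exI[of _ \<psi>']) simp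
qed

text \<open>One change of variables \<open>g\<close> acts on both arguments, while \<open>h\<close>
  changes the target independently: an isomorphism of quadratic algebras in terms of their
  multiplications.\<close>

lemma has_dim_SV_change:
  assumes "vlin g" "vlin g'" "\<And>v. g (g' v) = v" "\<And>v. g' (g v) = v" "vlin h" "vlin h'" "\<And>v. h (h' v) = v" "\<And>v. h' (h v) = v"
    and "\<And>u v. \<mu>' u v = h (\<mu> (g u) (g v))" "has_dim (SV \<mu> m) k"
  shows "has_dim (SV \<mu>' m) k"
proof (rule has_dim_transfer[OF assms(10), where a = "map g" and b = "map g'"])
  show "(\<lambda>l. f (map g l)) \<in> SV \<mu>' m" if "f \<in> SV \<mu> m" for f
    by (rule SV_change_mem[OF assms(1) _ assms(6) that]) (simp add: assms(8,9))
  show "(\<lambda>l. f (map g' l)) \<in> SV \<mu> m" if "f \<in> SV \<mu>' m" for f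
    by (rule SV_change_mem[OF assms(2) _ assms(5) that]) (simp add: assms(3,9))
qed (simp_all add: map_idI assms(3,4))

text \<open>Passage to the opposite algebra, which halves the later case analysis.\<close>

lemma SV_rev_mem: "F \<in> SV \<mu> m \<Longrightarrow> (\<lambda>l. F (rev l)) \<in> SV (\<lambda>u v. \<mu> v u) m"
proof (rule SVI)
  assume F: "F \<in> SV \<mu> m"
  show "F (rev l) = 0" if "length l \<noteq> m" for l using SVD(1)[OF F] that by simp
  show "lin (\<lambda>v. F (rev (p @ v # s)))" if "length p + length s + 1 = m" for p s
    using SVD(2)[OF F, of "rev s" "rev p"] that by (simp add: add.commute)
  show "\<exists>\<psi>. \<forall>u v. F (rev (p @ u # v # s)) = dot \<psi> (\<mu> v u)" if "length p + length s + 2 = m" for p s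
    using SVD(3)[OF F, of "rev s" "rev p"] that by (auto simp: add.commute)
qed

lemma has_dim_SV_rev:
  assumes "has_dim (SV \<mu> m) k"
  shows "has_dim (SV (\<lambda>u v. \<mu> v u) m) k"
  using assms
proof (rule has_dim_transfer[where a = rev and b = rev])
  show "(\<lambda>l. f (rev l)) \<in> SV (\<lambda>u v. \<mu> v u) m" if "f \<in> SV \<mu> m" for f using SV_rev_mem[OF that] .
  show "(\<lambda>l. f (rev l)) \<in> SV \<mu> m" if "f \<in> SV (\<lambda>u v. \<mu> v u) m" for f using SV_rev_mem[OF that] .
qed simp_all

text \<open>\<open>idx\<close> and \<open>bv\<close> translate the letters 0, 1, 2 into the indices
  and basis vectors for the type \<open>3\<close>, whose elements are written 1, 2, 3.\<close>

definition idx :: "nat \<Rightarrow> 3" where "idx i = (if i = 0 then 1 else if i = 1 then 2 else 3)"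
definition bv :: "nat \<Rightarrow> ('k::field)^3" where "bv i = (if i = 0 then e1 else if i = 1 then e2 else e3)"

text \<open>The multilinear extension of a functional on words, letters being identified with basis
  vectors.\<close>

primrec ext :: "(nat list \<Rightarrow> 'k::field) \<Rightarrow> ('k^3) list \<Rightarrow> 'k" where
  "ext f [] = f []"
| "ext f (v # l) = (\<Sum>i<3. v $ idx i * ext (\<lambda>w. f (i # w)) l)"

lemma sum_less_3: "(\<Sum>i<3::nat. f i) = f 0 + f 1 + f (2::nat)"
  by (simp add: numeral_3_eq_3 numeral_2_eq_2)

lemma idx_simps [simp]: "idx 0 = 1" "idx 1 = 2" "idx (Suc 0) = 2" "idx 2 = 3"
  by (simp_all add: idx_def)

definition mu_of :: "(nat \<Rightarrow> nat \<Rightarrow> nat \<Rightarrow> 'k::field) \<Rightarrow> 'k^3 \<Rightarrow> 'k^3 \<Rightarrow> 'k^3" where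
  "mu_of c u v = vector [\<Sum>i<3. \<Sum>j<3. u $ idx i * v $ idx j * c i j 0,
     \<Sum>i<3. \<Sum>j<3. u $ idx i * v $ idx j * c i j 1, \<Sum>i<3. \<Sum>j<3. u $ idx i * v $ idx j * c i j 2]"

lemma bil_mu_of: "bil (mu_of c)"
  unfolding bil_def vlin_def mu_of_def
  by (auto intro!: vec3_eqI simp: sum_less_3 algebra_simps)

lemma ext_bv: "set w \<subseteq> {..<3} \<Longrightarrow> ext f (map bv w) = f w"
proof (induction w arbitrary: f)
  case (Cons i w)
  then have "i = 0 \<or> i = 1 \<or> i = 2" by auto
  then show ?case using Cons by (auto simp: sum_less_3 bv_def)
qed simp

lemma ext_add: "ext (\<lambda>w. f w + g w) l = ext f l + ext g l"
  by (induction l arbitrary: f g) (simp_all add: distrib_left sum.distrib)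

lemma ext_scale: "ext (\<lambda>w. c * f w) l = c * ext f l"
  by (induction l arbitrary: f) (simp_all add: sum_distrib_left mult_ac)

lemma ext_scale_right: "ext (\<lambda>w. f w * c) l = ext f l * c"
  using ext_scale[of c f l] by (simp add: mult.commute)

lemma ext_zero: "ext (\<lambda>w. 0) l = 0"
  by (induction l) simp_all

lemma ext_length: "(\<And>w. f w \<noteq> 0 \<Longrightarrow> length w = m) \<Longrightarrow> length l \<noteq> m \<Longrightarrow> ext f l = 0"
proof (induction l arbitrary: f m)
  case Nil
  show ?case using Nil(1)[of "[]"] Nil(2) by auto
next
  case (Cons v l)
  have "ext (\<lambda>w. f (i # w)) l = 0" for i
  proof (cases m)
    case 0
    have "f (i # w) = 0" for w using Cons.prems(1)[of "i # w"] 0 by auto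
    then show ?thesis by (simp add: ext_zero)
  next
    case (Suc m')
    show ?thesis
    proof (rule Cons.IH[of _ m'])
      show "length w = m'" if "f (i # w) \<noteq> 0" for w using Cons.prems(1)[OF that] Suc by simp
      show "length l \<noteq> m'" using Cons.prems(2) Suc by simp
    qed
  qed
  then show ?case by simp
qed

lemma ext_lin: "lin (\<lambda>v. ext f (p @ v # s))"
proof (induction p arbitrary: f)
  case Nil
  show ?case by (simp add: lin_def sum_less_3 algebra_simps)
next
  case (Cons a p)
  then show ?case by (simp add: lin_def sum_less_3 algebra_simps)
qed

text \<open>The coefficients through which a pair of letters factors depend on the word that
  follows. Since \<open>ext\<close> is linear, extending these coefficients along the vectors
  \<open>s\<close> gives the \<open>\<psi>\<close> for the pair; further letters in front are added
  by induction.\<close>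

lemma ext_SV:
  assumes "f \<in> SW c m"
  shows "ext f \<in> SV (mu_of c) m"
proof (rule SVI)
  show "ext f l = 0" if "length l \<noteq> m" for l
    by (rule ext_length[OF _ that]) (use SWD(1)[OF assms] in blast)
  show "lin (\<lambda>v. ext f (p @ v # s))" for p s by (rule ext_lin)
  fix p s :: "('a^3) list" assume "length p + length s + 2 = m"
  then show "\<exists>\<psi>. \<forall>u v. ext f (p @ u # v # s) = dot \<psi> (mu_of c u v)" using assms
  proof (induction p arbitrary: f m)
    case Nil
    \<comment> \<open>For \<open>w\<close> of the wrong length \<open>f\<close> vanishes and zero
      coefficients do. This makes the choice of coefficients total in \<open>w\<close>.\<close>
    have "\<exists>\<psi>. \<forall>i<3. \<forall>j<3. f (i # j # w) = (\<Sum>k<3. \<psi> k * c i j k)" for w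
    proof (cases "length w = length s")
      case True
      then show ?thesis using SWD(2)[OF Nil.prems(2), of "[]" w] Nil.prems(1) by simp
    next
      case False
      have "f (i # j # w) = 0" for i j
        using SWD(1)[OF Nil.prems(2), of "i # j # w"] False Nil.prems(1) by auto
      then show ?thesis by (intro exI[of _ "\<lambda>_. 0"]) simp
    qed
    then obtain \<psi> where \<psi>: "\<And>w i j. i < 3 \<Longrightarrow> j < 3 \<Longrightarrow> f (i # j # w) = (\<Sum>k<3. \<psi> w k * c i j k)" by metis
    have "ext f (u # v # s) = dot (vector [ext (\<lambda>w. \<psi> w 0) s, ext (\<lambda>w. \<psi> w 1) s, ext (\<lambda>w. \<psi> w 2) s]) (mu_of c u v)" for u v
    proof -
      have "ext f (u # v # s) = (\<Sum>i<3. \<Sum>j<3. u $ idx i * v $ idx j * ext (\<lambda>w. f (i # j # w)) s)"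
        by (simp add: sum_distrib_left mult.assoc)
      also have "\<dots> = (\<Sum>i<3. \<Sum>j<3. u $ idx i * v $ idx j * ext (\<lambda>w. \<Sum>k<3. \<psi> w k * c i j k) s)"
        by (intro sum.cong refl) (simp add: \<psi>)
      also have "\<dots> = dot (vector [ext (\<lambda>w. \<psi> w 0) s, ext (\<lambda>w. \<psi> w 1) s, ext (\<lambda>w. \<psi> w 2) s]) (mu_of c u v)"
        unfolding sum_less_3 ext_add ext_scale_right
        by (simp add: dot_def mu_of_def sum_less_3) (simp add: algebra_simps)
      finally show ?thesis .
    qed
    then show ?case by auto
  next
    case (Cons a p)
    then obtain m' where m': "m = Suc m'" by (cases m) auto
    have SWi: "(\<lambda>w. f (i # w)) \<in> SW c m'" for i
    proof (rule SWI)
      show "length w = m' \<and> set w \<subseteq> {..<3}" if "f (i # w) \<noteq> 0" for w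
        using SWD(1)[OF Cons.prems(2) that] m' by simp
      show "\<exists>\<psi>. \<forall>a<3. \<forall>b<3. f (i # p @ [a, b] @ s) = (\<Sum>k<3. \<psi> k * c a b k)" if "length p + length s + 2 = m'" for p s
        using SWD(2)[OF Cons.prems(2), of "i # p" s] that m' by simp
    qed
    have "\<exists>\<psi>. \<forall>u v. ext (\<lambda>w. f (i # w)) (p @ u # v # s) = dot \<psi> (mu_of c u v)" for i
      using Cons.IH[OF _ SWi] Cons.prems(1) m' by simp
    then obtain \<psi> where "\<And>i u v. ext (\<lambda>w. f (i # w)) (p @ u # v # s) = dot (\<psi> i) (mu_of c u v)" by metis
    then have "ext f ((a # p) @ u # v # s) = dot (a $ idx 0 *s \<psi> 0 + a $ idx 1 *s \<psi> 1 + a $ idx 2 *s \<psi> 2) (mu_of c u v)" for u v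
      by (simp add: sum_less_3 dot_add_left dot_scale_left)
    then show ?case by blast
  qed
qed

lemma SV_SW:
  assumes F: "F \<in> SV (mu_of c) m"
  shows "(\<lambda>w. if length w = m \<and> set w \<subseteq> {..<3} then F (map bv w) else 0) \<in> SW c m"
proof (rule SWI)
  fix p s :: "nat list" assume l: "length p + length s + 2 = m"
  let ?f = "\<lambda>w. if length w = m \<and> set w \<subseteq> {..<3} then F (map bv w) else 0"
  show "\<exists>\<psi>. \<forall>i<3. \<forall>j<3. ?f (p @ [i, j] @ s) = (\<Sum>k<3. \<psi> k * c i j k)"
  proof (cases "set p \<subseteq> {..<3} \<and> set s \<subseteq> {..<3}")
    case True
    obtain \<psi> where \<psi>: "\<And>u v. F (map bv p @ u # v # map bv s) = dot \<psi> (mu_of c u v)"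
      using SVD(3)[OF F, of "map bv p" "map bv s"] l by auto
    have "?f (p @ [i, j] @ s) = (\<Sum>k<3. \<psi> $ idx k * c i j k)" if "i < 3" "j < 3" for i j
    proof -
      have "i = 0 \<or> i = 1 \<or> i = 2" "j = 0 \<or> j = 1 \<or> j = 2" using that by auto
      moreover have "?f (p @ [i, j] @ s) = dot \<psi> (mu_of c (bv i) (bv j))"
        using \<psi>[of "bv i" "bv j"] l True that by auto
      ultimately show ?thesis
        by (auto simp: dot_def mu_of_def sum_less_3 bv_def)
    qed
    then show ?thesis by (intro exI[of _ "\<lambda>k. \<psi> $ idx k"]) blast
  next
    case False
    then show ?thesis by (intro exI[of _ "\<lambda>_. 0"]) auto
  qed
qed (auto split: if_splits)

lemma has_dim_SW_SV:
  assumes "has_dim (SW c m) k"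
  shows "has_dim (SV (mu_of c) m) k"
proof -
  obtain F P where *: "dual_system (SW c m) k F P" using assms unfolding has_dim_def by blast
  have P: "length (P i) = m" "set (P i) \<subseteq> {..<3}" if "i < k" for i
    using SWD(1)[OF dual_systemD(1)[OF * that], of "P i"] dual_systemD(2)[OF * that that] by auto
  show ?thesis
  proof (rule has_dimI[of _ "\<lambda>i. ext (F i)" _ "\<lambda>i. map bv (P i)"])
    show "ext (F i) \<in> SV (mu_of c) m" if "i < k" for i by (rule ext_SV[OF dual_systemD(1)[OF * that]])
    show "ext (F i) (map bv (P j)) = (if i = j then 1 else 0)" if "i < k" "j < k" for i j
      unfolding ext_bv[OF P(2)[OF that(2)]] by (rule dual_systemD(2)[OF * that])
    fix f assume f: "f \<in> SV (mu_of c) m" and z: "\<And>i. i < k \<Longrightarrow> f (map bv (P i)) = 0"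
    let ?g = "\<lambda>w. if length w = m \<and> set w \<subseteq> {..<3} then f (map bv w) else 0"
    have g: "?g = (\<lambda>_. 0)" by (rule dual_systemD(3)[OF * SV_SW[OF f]]) (simp add: z P)
    show "f = (\<lambda>_. 0)"
    proof (rule SV_zero[OF f])
      fix l :: "('a^3) list" assume l: "set l \<subseteq> {e1, e2, e3}" "length l = m"
      then have "\<exists>w. l = map bv w \<and> set w \<subseteq> {..<3}"
      proof (induction l arbitrary: m)
        case (Cons v l)
        then obtain w where w: "l = map bv w" "set w \<subseteq> {..<3}" by auto
        have "\<exists>i<3. v = bv i"
          using Cons.prems(1) by (auto simp: bv_def intro: exI[of _ 0] exI[of _ 1] exI[of _ 2])
        then obtain i where "i < 3" "v = bv i" by auto
        with w show ?case by (intro exI[of _ "i # w"]) auto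
      qed simp
      then obtain w where "l = map bv w" "set w \<subseteq> {..<3}" by auto
      then show "f l = 0" using fun_cong[OF g, of w] l(2) by simp
    qed
  qed
qed

subsection \<open>A bijective multiplication\<close>

text \<open>An element of \<open>Q\<close> outside \<open>Q'\<close>, corrected to vanish at the
  points of \<open>Q'\<close>, would extend the dual system of \<open>Q'\<close> to
  \<open>k + 1\<close> biorthogonal pairs inside \<open>Q\<close>.\<close>

lemma has_dim_subset_eq:
  assumes "fsub Q" "fsub Q'" "Q' \<subseteq> Q" "has_dim Q k" "has_dim Q' k"
  shows "Q' = Q"
proof (rule ccontr)
  assume "Q' \<noteq> Q"
  then obtain f where f: "f \<in> Q" "f \<notin> Q'" using assms(3) by blast
  obtain G Y where G: "dual_system Q k G Y" using assms(4) unfolding has_dim_def by blast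
  obtain F P where *: "dual_system Q' k F P" using assms(5) unfolding has_dim_def by blast
  have FQ: "F i \<in> Q" if "i < k" for i using dual_systemD(1)[OF * that] assms(3) by blast
  define g where "g = (\<lambda>x. f x - (\<Sum>i<k. f (P i) * F i x))"
  have gQ: "g \<in> Q" unfolding g_def by (intro fsub_diff fsub_sum assms(1) f FQ) simp
  have gP: "g (P j) = 0" if "j < k" for j
  proof -
    have "(\<Sum>i<k. f (P i) * F i (P j)) = (\<Sum>i<k. if i = j then f (P j) else 0)"
      using dual_systemD(2)[OF * _ that] by (intro sum.cong) auto
    then show ?thesis using that by (simp add: g_def)
  qed
  have "\<exists>y. g y \<noteq> 0"
  proof (rule ccontr)
    assume "\<not> (\<exists>y. g y \<noteq> 0)"
    then have "g x = 0" for x by blast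
    then have "f x = (\<Sum>i<k. f (P i) * F i x)" for x unfolding g_def by (metis eq_iff_diff_eq_0)
    then have "f = (\<lambda>x. \<Sum>i<k. f (P i) * F i x)" by (rule ext)
    moreover have "(\<lambda>x. \<Sum>i<k. f (P i) * F i x) \<in> Q'"
      by (intro fsub_sum assms(2)) (auto intro: dual_systemD(1)[OF *])
    ultimately show False using f(2) by simp
  qed
  then obtain y where y: "g y \<noteq> 0" by blast
  define g' where "g' = (\<lambda>x. inverse (g y) * g x)"
  have g': "g' \<in> Q" "g' y = 1" "\<And>j. j < k \<Longrightarrow> g' (P j) = 0"
    using fsubD(3)[OF assms(1) gQ, of "inverse (g y)"] y gP by (auto simp: g'_def)
  have "Suc k \<le> k"
  proof (rule has_dim_le[OF assms(1) G])
    show "(if i = k then g' else (\<lambda>x. F i x - F i y * g' x)) \<in> Q" if "i < Suc k" for i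
      using g'(1) FQ that fsub_diff[OF assms(1) FQ fsubD(3)[OF assms(1) g'(1)]] by (cases "i = k") auto
    show "(if i = k then g' else (\<lambda>x. F i x - F i y * g' x)) (if j = k then y else P j) = (if i = j then 1 else 0)"
      if "i < Suc k" "j < Suc k" for i j
      using g' dual_systemD(2)[OF *, of i j] that by (cases "i = k"; cases "j = k") auto
  qed
  then show False by simp
qed

lemma has_dim_mono:
  assumes "fsub Q" "Q' \<subseteq> Q" "has_dim Q k" "has_dim Q' k'"
  shows "k' \<le> k"
proof -
  obtain G Y where G: "dual_system Q k G Y" using assms(3) unfolding has_dim_def by blast
  obtain F P where *: "dual_system Q' k' F P" using assms(4) unfolding has_dim_def by blast
  show ?thesis
  proof (rule has_dim_le[OF assms(1) G])
    show "F i \<in> Q" if "i < k'" for i using dual_systemD(1)[OF * that] assms(2) by blast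
    show "F i (P j) = (if i = j then 1 else 0)" if "i < k'" "j < k'" for i j by (rule dual_systemD(2)[OF * that])
  qed
qed

text \<open>The disjuncts are the coefficient sequences of H_1 to H_11, in this order, from degree 3
  on.\<close>

definition allowed :: "(nat \<Rightarrow> nat) \<Rightarrow> bool" where
  "allowed d \<longleftrightarrow> (\<forall>m\<ge>3. d m = 0) \<or> (d 3 = 1 \<and> (\<forall>m\<ge>4. d m = 0)) \<or> (\<forall>m\<ge>3. d m = 1) \<or>
     (d 3 = 2 \<and> (\<forall>m\<ge>4. d m = 0)) \<or> (d 3 = 2 \<and> d 4 = 1 \<and> (\<forall>m\<ge>5. d m = 0)) \<or> (d 3 = 2 \<and> (\<forall>m\<ge>4. d m = 1)) \<or>
     (\<forall>m\<ge>3. d m = 2) \<or> (\<forall>m\<ge>3. d m = 3) \<or> (\<forall>m\<ge>3. d m = 4) \<or> (\<forall>m\<ge>3. d m = m + 1) \<or>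
     (d 3 = 5 \<and> d 4 = 8 \<and> (\<forall>m\<ge>3. d (m + 2) = d (m + 1) + d m))"

lemma stable_from:
  fixes d :: "nat \<Rightarrow> nat"
  assumes "\<And>m. m \<ge> 2 \<Longrightarrow> d (Suc m) = d m \<Longrightarrow> d (Suc (Suc m)) = d (Suc m)"
    and "m \<ge> 2" "d (Suc m) = d m"
  shows "n \<ge> m \<Longrightarrow> d n = d m"
proof -
  have "d (Suc n) = d n \<and> d n = d m" if "n \<ge> m" for n
    using that by (induction n rule: dec_induct) (use assms in auto)
  then show "n \<ge> m \<Longrightarrow> d n = d m" by blast
qed

text \<open>Such a sequence falls strictly from 3 until two neighbours agree and is constant from
  there on. This leaves exactly the first eight disjuncts of \<open>allowed\<close>.\<close>

lemma allowed_nonincreasing: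
  fixes d :: "nat \<Rightarrow> nat"
  assumes "d 2 = 3" "\<And>m. m \<ge> 2 \<Longrightarrow> d (Suc m) \<le> d m"
    and st: "\<And>m. m \<ge> 2 \<Longrightarrow> d (Suc m) = d m \<Longrightarrow> d (Suc (Suc m)) = d (Suc m)"
  shows "allowed d"
proof -
  note stab = stable_from[of d, OF st]
  have S: "d n = d m" if "n \<ge> m" "m \<ge> 2" "d (Suc m) = d m" for n m using stab that by blast
  have le: "d 3 \<le> 3" "d 4 \<le> d 3" "d 5 \<le> d 4" "d 6 \<le> d 5"
    using assms(2)[of 2] assms(2)[of 3] assms(2)[of 4] assms(2)[of 5] assms(1) by (simp_all add: eval_nat_numeral)
  have s2: "n \<ge> 2 \<Longrightarrow> d n = 3" if "d 3 = 3" for n using S[of 2 n] that assms(1) by (simp add: eval_nat_numeral)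
  have s3: "n \<ge> 3 \<Longrightarrow> d n = d 3" if "d 4 = d 3" for n using S[of 3 n] that by (simp add: eval_nat_numeral)
  have s4: "n \<ge> 4 \<Longrightarrow> d n = d 4" if "d 5 = d 4" for n using S[of 4 n] that by (simp add: eval_nat_numeral)
  have s5: "n \<ge> 5 \<Longrightarrow> d n = d 5" if "d 6 = d 5" for n using S[of 5 n] that by (simp add: eval_nat_numeral)
  have "d 3 = 0 \<or> d 3 = 1 \<or> d 3 = 2 \<or> d 3 = 3" "d 4 = 0 \<or> d 4 = 1 \<or> d 4 = 2 \<or> d 4 = 3" using le by linarith+
  then consider "d 3 = 3" | "d 4 = d 3" "d 3 = 0 \<or> d 3 = 1 \<or> d 3 = 2" | "d 3 = 1" "d 4 = 0" | "d 3 = 2" "d 4 = 0" | "d 3 = 2" "d 4 = 1"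
    using le(2) by linarith
  then show ?thesis
  proof cases
    case 1
    have "\<forall>m\<ge>3. d m = 3" using s2[OF 1] by simp
    then show ?thesis unfolding allowed_def by blast
  next
    case 2
    have "\<forall>m\<ge>3. d m = c" if c: "d 3 = c" for c
    proof (intro allI impI)
      fix m :: nat assume "3 \<le> m"
      from s3[OF 2(1) this] c show "d m = c" by (rule trans)
    qed
    then show ?thesis using 2(2) unfolding allowed_def by blast
  next
    case 3
    have "d 5 = d 4" using le 3 by simp
    from s4[OF this] have "\<forall>m\<ge>4. d m = 0" using 3 by simp
    then show ?thesis using 3 unfolding allowed_def by blast
  next
    case 4
    have "d 5 = d 4" using le 4 by simp
    from s4[OF this] have "\<forall>m\<ge>4. d m = 0" using 4 by simp
    then show ?thesis using 4 unfolding allowed_def by blast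
  next
    case 5
    show ?thesis
    proof (cases "d 5 = d 4")
      case True
      from s4[OF this] have "\<forall>m\<ge>4. d m = 1" using 5 by simp
      then show ?thesis using 5 unfolding allowed_def by blast
    next
      case False
      then have "d 5 = 0" "d 6 = d 5" using le 5 by auto
      from s5[OF this(2)] this(1) have "\<forall>m\<ge>5. d m = 0" by simp
      then show ?thesis using 5 unfolding allowed_def by blast
    qed
  qed
qed

text \<open>
  Once \<open>z\<close> acts as the identity from the left, \<open>u z\<^sup>k v = z\<^sup>k\<^sup>+\<^sup>1 (\<sigma>\<^sup>k u \<cdot> v)\<close> with \<open>\<sigma> u = u \<cdot> z\<close>, so a word
  of length \<open>m\<close> equals \<open>z\<^sup>m\<^sup>-\<^sup>1\<close> times a single vector, its value.
\<close>

primrec word_value :: "(('k::field)^3 \<Rightarrow> 'k^3 \<Rightarrow> 'k^3) \<Rightarrow> 'k^3 \<Rightarrow> ('k^3) list \<Rightarrow> 'k^3" where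
  "word_value \<mu> z [] = 0"
| "word_value \<mu> z (u # l) = (if l = [] then u else \<mu> (((\<lambda>u. \<mu> u z) ^^ (length l - 1)) u) (word_value \<mu> z l))"

context
  fixes \<mu> :: "('k::field)^3 \<Rightarrow> 'k^3 \<Rightarrow> 'k^3" and z :: "'k^3"
  assumes bil: "bil \<mu>" and unit: "\<And>v. \<mu> z v = v"
begin

abbreviation (input) "sg \<equiv> (\<lambda>u. \<mu> u z)"
abbreviation (input) "wv \<equiv> word_value \<mu> z"

text \<open>Every word of length \<open>m\<close> equals \<open>z\<^sup>m\<^sup>-\<^sup>1\<close>
  times its value, so a form is determined by this linear form on \<open>V\<close>. The duals of all
  \<open>A\<^sub>m\<close> with \<open>m \<ge> 1\<close> thereby become subspaces of one space, the
  dual of \<open>V\<close>, where they can be compared.\<close>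

definition WF :: "nat \<Rightarrow> ('k^3 \<Rightarrow> 'k) set" where
  "WF m = (\<lambda>F v. F (replicate (m - 1) z @ [v])) ` SV \<mu> m"

lemma sg_swap: "(sg ^^ k) (\<mu> u z) = \<mu> ((sg ^^ k) u) z"
  by (induction k) simp_all

lemma WFE:
  assumes "\<psi> \<in> WF (Suc m)"
  obtains F where "F \<in> SV \<mu> (Suc m)" "\<psi> = (\<lambda>v. F (replicate m z @ [v]))"
  using assms unfolding WF_def by auto

lemma sg_z: "(sg ^^ k) z = z"
  by (induction k) (simp_all add: unit)

text \<open>\<open>u v\<close> and \<open>z (u v)\<close> are the same element of
  \<open>A\<^sub>2\<close>, because \<open>z\<close> acts as the identity.\<close>

lemma SV_move:
  assumes "F \<in> SV \<mu> m" "length p + length s + 2 = m"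
  shows "F (p @ u # v # s) = F (p @ z # \<mu> u v # s)"
  using SVD(3)[OF assms] unit by force

lemma SV_sweep:
  assumes "F \<in> SV \<mu> m" "length p + k + 2 = m"
  shows "F (p @ u # replicate k z @ [b]) = F (p @ replicate (Suc k) z @ [\<mu> ((sg ^^ k) u) b])"
  using assms(2)
proof (induction k arbitrary: p u)
  case 0
  then show ?case using SV_move[OF assms(1), of p "[]" u b] by simp
next
  case (Suc k)
  have "F (p @ u # replicate (Suc k) z @ [b]) = F ((p @ [z]) @ sg u # replicate k z @ [b])"
    using SV_move[OF assms(1), of p "replicate k z @ [b]" u z] Suc.prems by simp
  also have "\<dots> = F ((p @ [z]) @ replicate (Suc k) z @ [\<mu> ((sg ^^ k) (sg u)) b])"
    by (rule Suc.IH) (use Suc.prems in simp)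
  finally show ?case by (simp add: sg_swap)
qed

lemma SV_word_value:
  assumes "F \<in> SV \<mu> (Suc m)" "length l = Suc m"
  shows "F l = F (replicate m z @ [wv l])"
  using assms
proof (induction m arbitrary: F l)
  case 0
  then show ?case by (cases l) auto
next
  case (Suc m)
  then obtain u l' where l: "l = u # l'" "length l' = Suc m" by (cases l) auto
  then have ne: "l' \<noteq> []" by auto
  have "F (u # l') = F (u # replicate m z @ [wv l'])"
    using Suc.IH[OF SV_cons[OF Suc.prems(1), of u] l(2)] .
  also have "\<dots> = F (replicate (Suc m) z @ [\<mu> ((sg ^^ m) u) (wv l')])"
    using SV_sweep[OF Suc.prems(1), of "[]" m u] by simp
  finally show ?case using l ne by simp
qed

lemma WF_lin: "\<psi> \<in> WF (Suc m) \<Longrightarrow> lin \<psi>"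
proof (erule WFE)
  fix F assume F: "F \<in> SV \<mu> (Suc m)" "\<psi> = (\<lambda>v. F (replicate m z @ [v]))"
  then show "lin \<psi>" using SVD(2)[OF F(1), of "replicate m z" "[]"] by simp
qed

text \<open>By \<open>SV_word_value\<close> the form behind \<open>\<psi>\<close> is
  \<open>\<psi>\<close> composed with the value of a word. Together with \<open>WFI\<close> this
  characterizes membership in \<open>WF\<close>.\<close>

lemma WF_functional:
  assumes "\<psi> \<in> WF (Suc m)"
  shows "(\<lambda>l. if length l = Suc m then \<psi> (wv l) else 0) \<in> SV \<mu> (Suc m)"
proof -
  obtain F where F: "F \<in> SV \<mu> (Suc m)" "\<psi> = (\<lambda>v. F (replicate m z @ [v]))"
    using assms by (rule WFE)
  have "F = (\<lambda>l. if length l = Suc m then \<psi> (wv l) else 0)"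
  proof (rule ext)
    fix l
    show "F l = (if length l = Suc m then \<psi> (wv l) else 0)"
    proof (cases "length l = Suc m")
      case True
      then show ?thesis unfolding F(2) if_P[OF True] by (rule SV_word_value[OF F(1)])
    next
      case False
      then show ?thesis using SVD(1)[OF F(1) False] by simp
    qed
  qed
  then show ?thesis using F(1) by simp
qed

lemma wv_replicate: "wv (replicate k z @ [b]) = b"
  by (induction k) (simp_all add: sg_z unit)

lemma wv_replicate2: "wv (replicate k z @ [v, b]) = \<mu> v b"
  by (induction k) (simp_all add: sg_z unit)

lemma WFI:
  assumes "(\<lambda>l. if length l = Suc m then \<psi> (wv l) else 0) \<in> SV \<mu> (Suc m)"
  shows "\<psi> \<in> WF (Suc m)"
  unfolding WF_def by (rule image_eqI[OF _ assms]) (simp add: wv_replicate)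

lemma fsub_WF: "fsub (WF (Suc m))"
  unfolding fsub_def
proof (intro conjI ballI allI)
  show "(\<lambda>_. 0) \<in> WF (Suc m)" by (rule WFI) (use fsubD(1)[OF fsub_SV, of \<mu> "Suc m"] in simp)
  fix f g assume "f \<in> WF (Suc m)" "g \<in> WF (Suc m)"
  from fsubD(2)[OF fsub_SV this[THEN WF_functional]]
  have "(\<lambda>l. if length l = Suc m then f (wv l) + g (wv l) else 0) \<in> SV \<mu> (Suc m)"
    by (rule back_subst[of "\<lambda>f. f \<in> SV \<mu> (Suc m)"]) auto
  then show "(\<lambda>x. f x + g x) \<in> WF (Suc m)" by (rule WFI)
next
  fix c f assume "f \<in> WF (Suc m)"
  from fsubD(3)[OF fsub_SV this[THEN WF_functional], of c]
  have "(\<lambda>l. if length l = Suc m then c * f (wv l) else 0) \<in> SV \<mu> (Suc m)"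
    by (rule back_subst[of "\<lambda>f. f \<in> SV \<mu> (Suc m)"]) auto
  then show "(\<lambda>x. c * f x) \<in> WF (Suc m)" by (rule WFI)
qed

lemma has_dim_WF:
  assumes "has_dim (SV \<mu> (Suc m)) k"
  shows "has_dim (WF (Suc m)) k"
proof -
  obtain F P where *: "dual_system (SV \<mu> (Suc m)) k F P" using assms unfolding has_dim_def by blast
  have len: "length (P i) = Suc m" if "i < k" for i
    using SVD(1)[OF dual_systemD(1)[OF * that], of "P i"] dual_systemD(2)[OF * that that] by auto
  show ?thesis
  proof (rule has_dimI[of _ "\<lambda>i v. F i (replicate m z @ [v])" _ "\<lambda>i. wv (P i)"])
    show "(\<lambda>v. F i (replicate m z @ [v])) \<in> WF (Suc m)" if "i < k" for i
      unfolding WF_def using dual_systemD(1)[OF * that] by auto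
    show "F i (replicate m z @ [wv (P j)]) = (if i = j then 1 else 0)" if "i < k" "j < k" for i j
      using SV_word_value[OF dual_systemD(1)[OF * that(1)] len[OF that(2)]] dual_systemD(2)[OF * that] by simp
    fix \<psi> assume \<psi>: "\<psi> \<in> WF (Suc m)" and zz: "\<And>i. i < k \<Longrightarrow> \<psi> (wv (P i)) = 0"
    have "(\<lambda>l. if length l = Suc m then \<psi> (wv l) else 0) = (\<lambda>_. 0)"
      by (rule dual_systemD(3)[OF * WF_functional[OF \<psi>]]) (simp add: zz)
    from fun_cong[OF this, of "replicate m z @ [v]" for v]
    show "\<psi> = (\<lambda>_. 0)" by (intro ext) (simp add: wv_replicate)
  qed
qed

text \<open>Restricting a form to the words that begin with \<open>z\<close> is dual to left
  multiplication by \<open>z\<close>, and it does not change the linear form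
  \<open>\<psi>\<close>.\<close>

lemma WF_Suc_subset: "WF (Suc (Suc m)) \<subseteq> WF (Suc m)"
proof
  fix \<psi> assume "\<psi> \<in> WF (Suc (Suc m))"
  then obtain F where F: "F \<in> SV \<mu> (Suc (Suc m))" "\<psi> = (\<lambda>v. F (replicate (Suc m) z @ [v]))"
    by (rule WFE)
  show "\<psi> \<in> WF (Suc m)"
    unfolding WF_def by (rule image_eqI[OF _ SV_cons[OF F(1), of z]]) (simp add: F(2))
qed

lemma WF_antimono: "m \<le> n \<Longrightarrow> WF (Suc n) \<subseteq> WF (Suc m)"
  by (induction n rule: dec_induct) (use WF_Suc_subset in blast)+

text \<open>This and \<open>WF_right\<close> express prefixing \<open>u\<close> and appending
  \<open>b\<close> in terms of values: the value of \<open>u # l\<close> is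
  \<open>\<mu> ((sg ^^ m) u) (wv l)\<close>, and that of \<open>z\<^sup>m v b\<close> is
  \<open>\<mu> v b\<close>.\<close>

lemma WF_left:
  assumes "\<psi> \<in> WF (Suc (Suc m))"
  shows "(\<lambda>v. \<psi> (\<mu> ((sg ^^ m) u) v)) \<in> WF (Suc m)"
proof (rule WFI)
  have "(\<lambda>l. if length (u # l) = Suc (Suc m) then \<psi> (wv (u # l)) else 0) \<in> SV \<mu> (Suc m)"
    using SV_cons[OF WF_functional[OF assms], of u] .
  also have "(\<lambda>l. if length (u # l) = Suc (Suc m) then \<psi> (wv (u # l)) else 0) =
      (\<lambda>l. if length l = Suc m then \<psi> (\<mu> ((sg ^^ m) u) (wv l)) else 0)"
    by (intro ext) auto
  finally show "(\<lambda>l. if length l = Suc m then \<psi> (\<mu> ((sg ^^ m) u) (wv l)) else 0) \<in> SV \<mu> (Suc m)" .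
qed

lemma WF_right:
  assumes "\<psi> \<in> WF (Suc (Suc m))"
  shows "(\<lambda>v. \<psi> (\<mu> v b)) \<in> WF (Suc m)"
proof -
  have *: "(\<lambda>l. if length (l @ [b]) = Suc (Suc m) then \<psi> (wv (l @ [b])) else 0) \<in> SV \<mu> (Suc m)"
    using SV_snoc[OF WF_functional[OF assms], of b] .
  show ?thesis
    unfolding WF_def by (rule image_eqI[OF _ *]) (simp add: wv_replicate2)
qed

text \<open>The two arguments of \<open>\<psi>\<close> are the values of
  \<open>u v z\<^sup>m b\<close> and \<open>z (u v) z\<^sup>m b\<close>, which no form
  distinguishes. The identity takes the place of associativity, which \<open>\<mu>\<close> itself
  need not satisfy.\<close>

lemma WF_assoc:
  assumes "\<psi> \<in> WF (Suc (Suc (Suc m)))"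
  shows "\<psi> (\<mu> ((sg ^^ Suc m) u) (\<mu> ((sg ^^ m) v) b)) = \<psi> (\<mu> ((sg ^^ m) (\<mu> u v)) b)"
proof -
  let ?s = "replicate m z @ [b]"
  have "wv (u # v # ?s) = \<mu> ((sg ^^ Suc m) u) (\<mu> ((sg ^^ m) v) b)"
    "wv (z # \<mu> u v # ?s) = \<mu> ((sg ^^ m) (\<mu> u v)) b"
    by (simp_all add: wv_replicate sg_z unit del: funpow.simps)
  then show ?thesis using SV_move[OF WF_functional[OF assms], of "[]" ?s u v] by simp
qed

text \<open>If \<open>z : A\<^sub>m \<rightarrow> A\<^sub>m\<^sub>+\<^sub>1\<close> is injective for some \<open>m \<ge> 2\<close>, it stays so in all higher degrees.\<close>

lemma WF_stable:
  assumes eq: "WF (Suc (Suc (Suc m))) = WF (Suc (Suc m))"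
  shows "WF (Suc (Suc (Suc (Suc m)))) = WF (Suc (Suc (Suc m)))"
proof (intro equalityI WF_Suc_subset subsetI)
  fix \<psi> assume \<psi>: "\<psi> \<in> WF (Suc (Suc (Suc m)))"
  let ?n = "Suc (Suc (Suc m))"
  have lin: "lin \<psi>" by (rule WF_lin[OF \<psi>])
  have sglin: "vlin ((sg ^^ k))" for k
  proof (induction k)
    case (Suc k)
    then show ?case by (simp add: vlin_def bilD[OF bil])
  qed (simp add: vlin_def)
  show "\<psi> \<in> WF (Suc ?n)"
  proof (rule WFI, rule SV_consI)
    let ?F = "\<lambda>l. if length l = Suc ?n then \<psi> (wv l) else 0"
    show "(\<lambda>l. ?F (u # l)) \<in> SV \<mu> ?n" for u
    proof -
      \<comment> \<open>Applying \<open>sg\<close> \<open>m + 2\<close> times to \<open>u\<close> is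
        applying it \<open>m + 1\<close> times to \<open>sg u\<close>. So the slice at
        \<open>u\<close> has the shape given by \<open>WF_left\<close> one degree lower, and
        \<open>eq\<close> lifts it to the degree required.\<close>
      have "(\<lambda>v. \<psi> (\<mu> ((sg ^^ Suc m) (sg u)) v)) \<in> WF (Suc (Suc (Suc m)))"
        unfolding eq by (rule WF_left[OF \<psi>])
      from WF_functional[OF this]
      have "(\<lambda>l. if length l = ?n then \<psi> (\<mu> ((sg ^^ Suc (Suc m)) u) (wv l)) else 0) \<in> SV \<mu> ?n"
        by (simp only: funpow_Suc_right o_apply)
      also have "(\<lambda>l. if length l = ?n then \<psi> (\<mu> ((sg ^^ Suc (Suc m)) u) (wv l)) else 0) = (\<lambda>l. ?F (u # l))"
        by (intro ext) auto
      finally show ?thesis .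
    qed
    show "?F [] = 0" by simp
    show "lin (\<lambda>v. ?F (v # s))" if "length s = ?n" for s
    proof -
      have "s \<noteq> []" using that by auto
      then show ?thesis
        using that vlinD(1,2)[OF sglin, of _ ] by (simp add: lin_def bilD[OF bil] linD[OF lin] del: funpow.simps)
    qed
    fix s :: "('k^3) list" assume "Suc (length s) = ?n"
    then have s: "length s = Suc (Suc m)" "s \<noteq> []" by auto
    let ?b = "wv s"
    have "?F (u # v # s) = \<psi> (\<mu> ((sg ^^ Suc m) (\<mu> u v)) ?b)" for u v
    proof -
      have right: "(\<lambda>v. \<xi> (\<mu> v c)) \<in> WF (Suc (Suc m))" if "\<xi> \<in> WF (Suc (Suc m))" for \<xi> c
        by (rule WF_right) (use that eq in simp)
      have iter: "(\<lambda>v. \<xi> ((sg ^^ k) v)) \<in> WF (Suc (Suc m))" if "\<xi> \<in> WF (Suc (Suc m))" for \<xi> k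
      proof (induction k)
        case (Suc k)
        from right[OF this, of z] show ?case by (simp only: funpow_Suc_right o_apply)
      qed (simp add: that)
      \<comment> \<open>The pair at the head has to enter through its product.
        \<open>WF_assoc\<close> for \<open>\<psi>\<close> reduces this to an identity for
        \<open>\<theta>\<close>; \<open>eq\<close> and the decreasing chain place
        \<open>\<theta>\<close> in degree 3, where \<open>WF_assoc\<close> with \<open>b = z\<close>
        supplies that identity.\<close>
      define \<theta> where "\<theta> = (\<lambda>v. \<psi> (\<mu> ((sg ^^ m) v) ?b))"
      have "\<theta> \<in> WF (Suc (Suc m))"
        unfolding \<theta>_def by (rule iter) (rule WF_right[OF \<psi>])
      then have "\<theta> \<in> WF (Suc (Suc 0 + Suc 0))" using WF_antimono[of "Suc (Suc 0)" "Suc (Suc m)"] eq by auto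
      from WF_assoc[of \<theta> 0 u v z] this have \<theta>: "\<theta> (\<mu> (sg u) (sg v)) = \<theta> (sg (\<mu> u v))" by simp
      have "?F (u # v # s) = \<psi> (\<mu> ((sg ^^ Suc m) (sg u)) (\<mu> ((sg ^^ m) (sg v)) ?b))"
        using s by (simp add: sg_swap)
      also have "\<dots> = \<theta> (\<mu> (sg u) (sg v))"
        unfolding \<theta>_def by (rule WF_assoc[OF \<psi>])
      also have "\<dots> = \<psi> (\<mu> ((sg ^^ Suc m) (\<mu> u v)) ?b)"
        unfolding \<theta> unfolding \<theta>_def by (simp add: sg_swap)
      finally show ?thesis .
    qed
    note F_eq = this
    have "lin (\<lambda>w. \<psi> (\<mu> ((sg ^^ Suc m) w) ?b))"
      using vlinD(1,2)[OF sglin[of "Suc m"]] by (simp add: lin_def bilD[OF bil] linD[OF lin] del: funpow.simps)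
    from lin_dot_ex[OF this] obtain \<psi>' where "\<forall>w. \<psi> (\<mu> ((sg ^^ Suc m) w) ?b) = dot \<psi>' w" ..
    then show "\<exists>\<psi>'. \<forall>u v. ?F (u # v # s) = dot \<psi>' (\<mu> u v)"
      unfolding F_eq by blast
  qed
qed

lemma has_dim_SV_unit_2: "has_dim (SV \<mu> 2) 3"
proof -
  have sp: "dot \<psi> (\<mu> z v) = dot \<psi> v" for \<psi> v by (simp add: unit)
  let ?E = "\<lambda>i::nat. if i = 0 then e1 else if i = 1 then e2 else e3 :: 'k^3"
  show ?thesis
  proof (rule has_dimI[of _ "\<lambda>i l. if length l = 2 then dot (?E i) (\<mu> (l ! 0) (l ! 1)) else 0" _ "\<lambda>i. [z, ?E i]"])
    fix i :: nat assume "i < 3"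
    show "(\<lambda>l. if length l = 2 then dot (?E i) (\<mu> (l ! 0) (l ! 1)) else 0) \<in> SV \<mu> 2"
    proof (rule SVI)
      fix p s :: "('k^3) list" assume "length p + length s + 1 = 2"
      then have "(p = [] \<and> (\<exists>a. s = [a])) \<or> (s = [] \<and> (\<exists>a. p = [a]))"
        by (cases p; cases s) auto
      then show "lin (\<lambda>v. if length (p @ v # s) = 2 then dot (?E i) (\<mu> ((p @ v # s) ! 0) ((p @ v # s) ! 1)) else 0)"
        using linD[OF lin_dot[of "?E i"]] by (auto simp: lin_def bilD[OF bil])
    next
      fix p s :: "('k^3) list" assume "length p + length s + 2 = 2"
      then show "\<exists>\<psi>. \<forall>u v. (if length (p @ u # v # s) = 2 then dot (?E i) (\<mu> ((p @ u # v # s) ! 0) ((p @ u # v # s) ! 1)) else 0) = dot \<psi> (\<mu> u v)"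
        by (intro exI[of _ "?E i"]) simp
    qed simp
  next
    show "(if length [z, ?E j] = 2 then dot (?E i) (\<mu> ([z, ?E j] ! 0) ([z, ?E j] ! 1)) else 0) = (if i = j then 1 else 0)"
      if "i < 3" "j < 3" for i j
      using that by (auto simp: unit dot_def numeral_3_eq_3 less_Suc_eq)
  next
    fix f assume f: "f \<in> SV \<mu> 2" and zz: "\<And>i. i < 3 \<Longrightarrow> f [z, ?E i] = 0"
    obtain \<psi> where \<psi>: "\<And>u v. f [u, v] = dot \<psi> (\<mu> u v)" using SVD(3)[OF f, of "[]" "[]"] by auto
    have "dot \<psi> e1 = 0" "dot \<psi> e2 = 0" "dot \<psi> e3 = 0"
      using zz[of 0] zz[of 1] zz[of 2] by (auto simp: \<psi> unit)
    then have "\<psi> = 0" by (intro vec3_eqI) (simp_all add: dot_def)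
    then have "f [u, v] = 0" for u v using \<psi> by simp
    then have "f l = 0" if "length l = 2" for l using that by (auto simp: numeral_2_eq_2 length_Suc_conv)
    then show "f = (\<lambda>_. 0)" using SVD(1)[OF f] by blast
  qed
qed

lemma allowed_unit:
  assumes "\<And>m. has_dim (SV \<mu> m) (d m)"
  shows "allowed d"
proof (rule allowed_nonincreasing)
  show "d 2 = 3" by (rule has_dim_unique[OF fsub_SV assms has_dim_SV_unit_2])
  fix m :: nat assume "m \<ge> 2"
  then obtain m' where m: "m = Suc (Suc m')" using le_Suc_ex[of 2 m] by auto
  show "d (Suc m) \<le> d m"
    unfolding m by (rule has_dim_mono[OF fsub_WF WF_Suc_subset has_dim_WF[OF assms] has_dim_WF[OF assms]])
  assume "d (Suc m) = d m"
  then have "has_dim (WF (Suc (Suc (Suc m')))) (d m)" using has_dim_WF[OF assms, of "Suc (Suc m')"] m by simp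
  then have "WF (Suc (Suc (Suc m'))) = WF (Suc (Suc m'))"
    using has_dim_subset_eq[OF fsub_WF fsub_WF WF_Suc_subset has_dim_WF[OF assms]] m by blast
  from WF_stable[OF this] show "d (Suc (Suc m)) = d (Suc m)"
    using has_dim_WF[OF assms, of "Suc (Suc m')"] has_dim_WF[OF assms, of "Suc (Suc (Suc m'))"]
      has_dim_unique[OF fsub_WF] m by metis
qed

end

definition singular :: "(('k::field)^3 \<Rightarrow> 'k^3) \<Rightarrow> bool" where
  "singular f \<longleftrightarrow> (\<exists>v. v \<noteq> 0 \<and> f v = 0)"

lemma vlin_nonsingular_inverse:
  assumes f: "vlin (f :: ('k::field)^3 \<Rightarrow> 'k^3)" and "\<not> singular f"
  obtains g where "vlin g" "\<And>v. f (g v) = v" "\<And>v. g (f v) = v"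
proof -
  have lf: "Vector_Spaces.linear (*s) (*s) f"
    by unfold_locales (rule vlinD[OF f])+
  interpret f: Vector_Spaces.linear "(*s)" "(*s)" f by (rule lf)
  have "inj f" using assms(2) unfolding singular_def by (auto simp: f.inj_iff_eq_0)
  then obtain g where g: "Vector_Spaces.linear (*s) (*s) g" "\<forall>x. g (f x) = x" "\<forall>x. f (g x) = x"
    using vec.linear_injective_isomorphism[OF lf] by blast
  interpret g: Vector_Spaces.linear "(*s)" "(*s)" g by (rule g(1))
  show ?thesis by (rule that[of g]) (use g in \<open>auto simp: vlin_def g.add g.scale\<close>)
qed

text \<open>Composing \<open>\<mu>\<close> with the inverse of \<open>\<mu> z\<close> changes only
  the coordinates of the target and makes \<open>z\<close> act as the identity.\<close>

theorem allowed_nonsingular: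
  assumes "bil \<mu>" "\<not> singular (\<mu> z)" "\<And>m. has_dim (SV \<mu> m) (d m)"
  shows "allowed d"
proof -
  have "vlin (\<mu> z)" using assms(1) by (simp add: bil_def)
  then obtain h where h: "vlin h" "\<And>v. \<mu> z (h v) = v" "\<And>v. h (\<mu> z v) = v"
    using vlin_nonsingular_inverse assms(2) by blast
  show ?thesis
  proof (rule allowed_unit[of "\<lambda>u v. h (\<mu> u v)" z])
    show "bil (\<lambda>u v. h (\<mu> u v))" using assms(1) h(1) by (auto simp: bil_def vlin_def)
    show "has_dim (SV (\<lambda>u v. h (\<mu> u v)) m) (d m)" for m
      by (rule has_dim_SV_change[of "\<lambda>x. x" "\<lambda>x. x" h "\<mu> z", OF _ _ _ _ h(1) \<open>vlin (\<mu> z)\<close> h(3) h(2) _ assms(3)])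
        (auto simp: vlin_def)
  qed (rule h(3))
qed

subsection \<open>Spaces of singular matrices\<close>

text \<open>The determinant of the matrix with columns \<open>p\<close>, \<open>q\<close>,
  \<open>r\<close>; \<open>lc3 p q r\<close> is multiplication by this matrix.\<close>

definition det3 :: "('k::field)^3 \<Rightarrow> 'k^3 \<Rightarrow> 'k^3 \<Rightarrow> 'k" where
  "det3 p q r = p$1 * (q$2 * r$3 - r$2 * q$3) - q$1 * (p$2 * r$3 - r$2 * p$3) + r$1 * (p$2 * q$3 - q$2 * p$3)"

definition lc3 :: "('k::field)^3 \<Rightarrow> 'k^3 \<Rightarrow> 'k^3 \<Rightarrow> 'k^3 \<Rightarrow> 'k^3" where
  "lc3 p q r x = x$1 *s p + x$2 *s q + x$3 *s r"

lemma vlin_lc3: "vlin (lc3 p q r)"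
  by (auto simp: vlin_def lc3_def intro!: vec3_eqI) (simp_all add: algebra_simps)

text \<open>Cramer's rule.\<close>

lemma det3_lc3:
  "det3 (lc3 p q r x) q r = x$1 * det3 p q r" "det3 p (lc3 p q r x) r = x$2 * det3 p q r" "det3 p q (lc3 p q r x) = x$3 * det3 p q r"
  by (simp_all add: det3_def lc3_def algebra_simps)

lemma det3_zero [simp]: "det3 0 q r = 0" "det3 p 0 r = 0" "det3 p q 0 = 0"
  by (simp_all add: det3_def)

lemma nonsingular_lc3:
  assumes "det3 p q r \<noteq> 0"
  shows "\<not> singular (lc3 p q r)"
  unfolding singular_def
proof
  assume "\<exists>v. v \<noteq> 0 \<and> lc3 p q r v = 0"
  then obtain v where v: "v \<noteq> 0" "lc3 p q r v = 0" by blast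
  have "v$1 = 0" "v$2 = 0" "v$3 = 0" using det3_lc3[of p q r v] assms v(2) by auto
  then show False using v(1) by (simp add: vec3_eq_iff)
qed

lemma vlin_eq_lc3: "vlin f \<Longrightarrow> f = lc3 (f e1) (f e2) (f e3)"
  by (rule ext) (simp only: lc3_def, rule vlin_expand)

lemma singular_det3:
  assumes "vlin f" "singular f"
  shows "det3 (f e1) (f e2) (f e3) = 0"
proof (rule ccontr)
  assume "det3 (f e1) (f e2) (f e3) \<noteq> 0"
  then have "\<not> singular (lc3 (f e1) (f e2) (f e3))" by (rule nonsingular_lc3)
  then show False using assms(2) unfolding vlin_eq_lc3[OF assms(1), symmetric] by blast
qed

definition indep2 :: "('k::field)^3 \<Rightarrow> 'k^3 \<Rightarrow> bool" where
  "indep2 p q \<longleftrightarrow> (\<forall>a b. a *s p + b *s q = 0 \<longrightarrow> a = 0 \<and> b = 0)"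

lemma indep2_minor:
  assumes "indep2 p q"
  shows "p$1 * q$2 - q$1 * p$2 \<noteq> 0 \<or> p$1 * q$3 - q$1 * p$3 \<noteq> 0 \<or> p$2 * q$3 - q$2 * p$3 \<noteq> 0"
proof (rule ccontr)
  assume "\<not> ?thesis"
  then have z: "p$1 * q$2 = q$1 * p$2" "p$1 * q$3 = q$1 * p$3" "p$2 * q$3 = q$2 * p$3" by auto
  have "(q$i) *s p + (- (p$i)) *s q = 0" for i
    using z exhaust_3[of i] by (auto simp: vec3_eq_iff algebra_simps)
  then have "q$i = 0" for i using assms unfolding indep2_def by blast
  then have "0 *s p + 1 *s q = 0" by (simp add: vec3_eq_iff)
  then show False using assms unfolding indep2_def by (metis zero_neq_one)
qed

lemma indep2_complete:
  assumes "indep2 p q"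
  obtains r where "det3 p q r \<noteq> 0"
proof -
  have "det3 p q e3 = p$1 * q$2 - q$1 * p$2" "det3 p q e2 = - (p$1 * q$3 - q$1 * p$3)" "det3 p q e1 = p$2 * q$3 - q$2 * p$3"
    by (simp_all add: det3_def algebra_simps)
  then show ?thesis using indep2_minor[OF assms] that[of e1] that[of e2] that[of e3] by auto
qed

lemma lin_product_zero:
  assumes "lin f" "lin g" "\<And>u. f u * g u = 0"
  shows "(\<forall>u. f u = 0) \<or> (\<forall>u. g u = 0)"
proof (rule ccontr)
  assume "\<not> ?thesis"
  then obtain u w where uw: "f u \<noteq> 0" "g w \<noteq> 0" by blast
  then have "g u = 0" "f w = 0" using assms(3)[of u] assms(3)[of w] by auto
  then show False using assms(3)[of "u + w"] uw by (simp add: linD[OF assms(1)] linD[OF assms(2)])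
qed

lemma infinite_avoid:
  assumes "infinite (UNIV :: 'k set)" "finite A"
  obtains t :: 'k where "t \<notin> A"
  using assms ex_new_if_finite by blast

text \<open>For three factors the size of the field matters: over two elements the product of a, b
  and a + b vanishes everywhere. Starting at a point where \<open>f\<close> and \<open>g\<close> are
  nonzero, one moves in a direction with \<open>h\<close> nonzero and avoids the parameters 0 and
  the zeros of \<open>f\<close> and \<open>g\<close> on that line.\<close>

lemma lin_product_zero3:
  fixes f :: "('k::field)^3 \<Rightarrow> 'k"
  assumes "infinite (UNIV :: 'k set)" "lin f" "lin g" "lin h" "\<And>u. f u * g u * h u = 0"
  shows "(\<forall>u. f u = 0) \<or> (\<forall>u. g u = 0) \<or> (\<forall>u. h u = 0)"
proof (rule ccontr)
  assume c: "\<not> ?thesis"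
  then obtain u where u: "f u * g u \<noteq> 0" using lin_product_zero[OF assms(2,3)] by blast
  obtain w where w: "h w \<noteq> 0" using c by blast
  have hu: "h u = 0" using assms(5)[of u] u by simp
  obtain t where t: "t \<notin> {0, - f u / f w, - g u / g w}"
    using infinite_avoid[OF assms(1), of "{0, - f u / f w, - g u / g w}"] by auto
  have nz: "a + t * b \<noteq> 0" if "a \<noteq> 0" "t \<noteq> - a / b" for a b
  proof
    assume "a + t * b = 0"
    then have e: "a = - (t * b)" by (simp add: eq_neg_iff_add_eq_0)
    with that(1) have "b \<noteq> 0" by auto
    with e that(2) show False by simp
  qed
  have "f (u + t *s w) \<noteq> 0" "g (u + t *s w) \<noteq> 0"
    using nz[of "f u" "f w"] nz[of "g u" "g w"] u t by (auto simp: linD[OF assms(2)] linD[OF assms(3)])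
  moreover have "h (u + t *s w) \<noteq> 0" using hu w t by (auto simp: linD[OF assms(4)])
  ultimately show False using assms(5)[of "u + t *s w"] by simp
qed

definition spanning :: "(('k::field)^3 \<Rightarrow> 'k^3 \<Rightarrow> 'k^3) \<Rightarrow> bool" where
  "spanning \<mu> \<longleftrightarrow> (\<forall>\<psi>. (\<forall>u v. dot \<psi> (\<mu> u v) = 0) \<longrightarrow> \<psi> = 0)"

definition right_kernel :: "(('k::field)^3 \<Rightarrow> 'k^3 \<Rightarrow> 'k^3) \<Rightarrow> bool" where
  "right_kernel \<mu> \<longleftrightarrow> (\<exists>v. v \<noteq> 0 \<and> (\<forall>u. \<mu> u v = 0))"

definition compressed :: "(('k::field)^3 \<Rightarrow> 'k^3 \<Rightarrow> 'k^3) \<Rightarrow> bool" where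
  "compressed \<mu> \<longleftrightarrow> (\<exists>v w p. indep2 v w \<and> (\<forall>u. (\<exists>a. \<mu> u v = a *s p) \<and> (\<exists>b. \<mu> u w = b *s p)))"

text \<open>That is, \<open>\<lambda>v w. \<mu> (\<phi> v) w\<close> is alternating for some
  automorphism \<open>\<phi>\<close>.\<close>

definition twisted_skew :: "(('k::field)^3 \<Rightarrow> 'k^3 \<Rightarrow> 'k^3) \<Rightarrow> bool" where
  "twisted_skew \<mu> \<longleftrightarrow> (\<exists>\<phi>. vlin \<phi> \<and> \<not> singular \<phi> \<and> (\<forall>v. \<mu> (\<phi> v) v = 0))"

lemma dot_e [simp]: "dot e1 x = x$1" "dot e2 x = x$2" "dot e3 x = x$3"
  by (simp_all add: dot_def)

lemma lin_component: "vlin f \<Longrightarrow> lin (\<lambda>u. f u $ i)"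
  by (auto simp: vlin_def lin_def)

text \<open>A group is not the union of two proper subgroups, which enter here through closure under
  differences.\<close>

lemma union_of_subspaces:
  fixes P Q :: "'a::ab_group_add \<Rightarrow> bool"
  assumes "\<And>x. P x \<or> Q x" "\<And>x y. P x \<Longrightarrow> P (x + y) \<Longrightarrow> P y" "\<And>x y. Q x \<Longrightarrow> Q (y + x) \<Longrightarrow> Q y"
  shows "(\<forall>x. P x) \<or> (\<forall>x. Q x)"
  using assms by metis

lemma lin_ker_nonzero:
  assumes "lin f"
  obtains v where "v \<noteq> 0" "f v = 0"
proof (cases "f e1 = 0")
  case True
  then show ?thesis using that[of e1] by (simp add: vec3_eq_iff)
next
  case False
  have "f (f e1 *s e2 - f e2 *s e1) = 0" by (simp add: linD[OF assms])
  moreover have "(f e1 *s e2 - f e2 *s e1) $ 2 \<noteq> 0" using False by simp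
  then have "f e1 *s e2 - f e2 *s e1 \<noteq> 0" by (metis zero_index)
  ultimately show ?thesis using that by blast
qed

lemma not_indep2: "\<not> indep2 p q \<Longrightarrow> p \<noteq> 0 \<Longrightarrow> \<exists>c. q = c *s p"
proof -
  assume "\<not> indep2 p q" "p \<noteq> 0"
  then obtain a b where ab: "a *s p + b *s q = 0" "a \<noteq> 0 \<or> b \<noteq> 0" unfolding indep2_def by blast
  have b: "b \<noteq> 0"
  proof
    assume "b = 0"
    then have "a *s p = 0" "a \<noteq> 0" using ab by auto
    then show False using \<open>p \<noteq> 0\<close> by (simp add: vec3_eq_iff)
  qed
  have "q = (- a / b) *s p"
    using ab(1) b by (intro vec3_eqI) (simp_all add: vec3_eq_iff field_simps eq_neg_iff_add_eq_0 add.commute)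
  then show ?thesis by blast
qed

lemma not_indep2': "\<not> indep2 p q \<Longrightarrow> q \<noteq> 0 \<Longrightarrow> \<exists>c. p = c *s q"
proof (rule not_indep2)
  show "\<not> indep2 p q \<Longrightarrow> \<not> indep2 q p" unfolding indep2_def by (metis add.commute)
qed auto

text \<open>In a linear space of matrices of rank at most one, all share a kernel plane or all share
  an image line. A common image line contradicts \<open>spanning\<close>; a common kernel plane
  contains the vector sought.\<close>

lemma rank_one_case:
  assumes bil: "bil \<mu>" and sp: "spanning \<mu>" and r: "\<And>u v w. \<not> indep2 (\<mu> u v) (\<mu> u w)"
  shows "right_kernel \<mu>"
proof -
  have "\<exists>u0 v0. \<mu> u0 v0 \<noteq> 0"
  proof (rule ccontr)
    assume "\<not> (\<exists>u0 v0. \<mu> u0 v0 \<noteq> 0)"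
    then have "\<forall>u v. dot e1 (\<mu> u v) = 0" by simp
    then have "e1 = (0 :: 'a^3)" using sp unfolding spanning_def by blast
    then show False by (simp add: vec3_eq_iff)
  qed
  then obtain u0 v0 where p: "\<mu> u0 v0 \<noteq> 0" by blast
  let ?p = "\<mu> u0 v0"
  have "\<exists>c. \<mu> u0 v = c *s ?p" for v using not_indep2[OF r p] .
  then obtain \<alpha> where \<alpha>: "\<And>v. \<mu> u0 v = \<alpha> v *s ?p" by metis
  have inj: "a *s ?p = b *s ?p \<Longrightarrow> a = b" for a b using p by (auto simp: vec3_eq_iff)
  have lin\<alpha>: "lin \<alpha>"
    unfolding lin_def
  proof (intro conjI allI)
    show "\<alpha> (u + v) = \<alpha> u + \<alpha> v" for u v
    proof (rule inj)
      have "\<mu> u0 (u + v) = \<mu> u0 u + \<mu> u0 v" by (simp add: bilD[OF bil])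
      then show "\<alpha> (u + v) *s ?p = (\<alpha> u + \<alpha> v) *s ?p"
        unfolding \<alpha>[of "u + v"] \<alpha>[of u] \<alpha>[of v] by (simp add: vector_sadd_rdistrib)
    qed
    show "\<alpha> (c *s v) = c * \<alpha> v" for c v
    proof (rule inj)
      have "\<mu> u0 (c *s v) = c *s \<mu> u0 v" by (simp add: bilD[OF bil])
      then show "\<alpha> (c *s v) *s ?p = (c * \<alpha> v) *s ?p"
        unfolding \<alpha>[of "c *s v"] \<alpha>[of v] by simp
    qed
  qed
  \<comment> \<open>\<open>A u\<close> says that \<open>\<mu> u\<close> kills the kernel plane of
    \<open>\<mu> u0\<close>, and \<open>B u\<close> that its image lies in the image line of
    \<open>\<mu> u0\<close>. Each \<open>u\<close> satisfies one of them and both are closed under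
    differences, so one of them holds throughout.\<close>
  define A where "A = (\<lambda>u. \<forall>v. \<alpha> v = 0 \<longrightarrow> \<mu> u v = 0)"
  define B where "B = (\<lambda>u. \<forall>v. \<exists>c. \<mu> u v = c *s ?p)"
  have "(\<forall>u. A u) \<or> (\<forall>u. B u)"
  proof (rule union_of_subspaces)
    fix u
    show "A u \<or> B u"
    proof (cases "A u")
      case False
      \<comment> \<open>Here \<open>\<mu> u v\<close> is nonzero while
        \<open>\<mu> u0 v = 0\<close>. Comparing \<open>u\<close> with \<open>u + u0\<close>, both
        of rank at most one, shows that \<open>\<mu> u0 v0\<close> is a multiple of
        \<open>\<mu> u v\<close>.\<close>
      then obtain v where v: "\<alpha> v = 0" "\<mu> u v \<noteq> 0" unfolding A_def by blast
      have 0: "\<mu> u0 v = 0" using \<alpha>[of v] v(1) by simp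
      obtain c where c: "\<mu> u v0 = c *s \<mu> u v" using not_indep2[OF r v(2)] by blast
      have "\<mu> (u + u0) v = \<mu> u v" by (simp add: bilD[OF bil] 0)
      then obtain d where "\<mu> (u + u0) v0 = d *s \<mu> u v" using not_indep2[OF r[of "u + u0" v v0]] v(2) by auto
      then have "?p = (d - c) *s \<mu> u v" using c by (simp add: bilD[OF bil] vec.scale_left_diff_distrib algebra_simps)
      moreover have "d - c \<noteq> 0" using calculation p by auto
      ultimately have uv: "\<mu> u v = (1 / (d - c)) *s ?p" by (simp add: vec3_eq_iff)
      have "B u" unfolding B_def
      proof
        fix w
        obtain e where "\<mu> u w = e *s \<mu> u v" using not_indep2[OF r v(2)] by blast
        then have "\<mu> u w = (e * (1 / (d - c))) *s ?p" using uv by simp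
        then show "\<exists>c. \<mu> u w = c *s ?p" ..
      qed
      then show ?thesis ..
    qed simp
  next
    show "A y" if "A x" "A (x + y)" for x y using that unfolding A_def by (simp add: bilD[OF bil])
    show "B y" if hB: "B x" "B (y + x)" for x y
      unfolding B_def
    proof
      fix v
      obtain c d where "\<mu> x v = c *s ?p" "\<mu> (y + x) v = d *s ?p" using hB unfolding B_def by blast
      then have "\<mu> y v = (d - c) *s ?p" by (simp add: bilD[OF bil] vec.scale_left_diff_distrib algebra_simps)
      then show "\<exists>c. \<mu> y v = c *s ?p" ..
    qed
  qed
  then show ?thesis
  proof
    assume "\<forall>u. A u"
    moreover obtain v where "v \<noteq> 0" "\<alpha> v = 0" using lin_ker_nonzero[OF lin\<alpha>] .
    ultimately show ?thesis unfolding A_def right_kernel_def by blast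
  next
    assume B: "\<forall>u. B u"
    obtain \<psi> where \<psi>: "\<psi> \<noteq> 0" "dot ?p \<psi> = 0" using lin_ker_nonzero[OF lin_dot[of ?p]] .
    have "dot \<psi> (\<mu> u v) = 0" for u v
    proof -
      obtain c where "\<mu> u v = c *s ?p" using B unfolding B_def by blast
      then have "dot \<psi> (\<mu> u v) = c * dot ?p \<psi>" by (simp add: dot_def algebra_simps)
      then show ?thesis using \<psi> by simp
    qed
    then show ?thesis using \<psi>(1) sp unfolding spanning_def by blast
  qed
qed

text \<open>\<open>Aij u\<close> are the entries of the matrix of \<open>\<mu> u\<close>, and
  \<open>u0\<close> has the matrix diag(1, 1, 0). Let M be the upper left 2 by 2 block, b the column
  next to it and c the row below it. Expanding the determinant along \<open>u + t u0\<close> gives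
  \<open>A33 = 0\<close>, c b = 0 and c adj(M) b = 0. The row c is not identically zero, by
  \<open>spanning\<close>. The three alternatives arise, in this order, when b is zero, when its two
  entries are proportional as linear forms in \<open>u\<close>, and when they are
  independent.\<close>

lemma rank_two_case:
  fixes \<mu> :: "('k::field)^3 \<Rightarrow> 'k^3 \<Rightarrow> 'k^3"
  assumes inf: "infinite (UNIV :: 'k set)"
    and bil: "bil \<mu>" and sp: "spanning \<mu>" and sing: "\<And>u. singular (\<mu> u)"
    and u0: "\<And>v. \<mu> u0 v = vector [v$1, v$2, 0]"
  shows "right_kernel \<mu> \<or> compressed \<mu> \<or> twisted_skew \<mu>"
proof -
  define A11 where "A11 = (\<lambda>u. \<mu> u e1 $ 1)" define A12 where "A12 = (\<lambda>u. \<mu> u e2 $ 1)" define A13 where "A13 = (\<lambda>u. \<mu> u e3 $ 1)"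
  define A21 where "A21 = (\<lambda>u. \<mu> u e1 $ 2)" define A22 where "A22 = (\<lambda>u. \<mu> u e2 $ 2)" define A23 where "A23 = (\<lambda>u. \<mu> u e3 $ 2)"
  define A31 where "A31 = (\<lambda>u. \<mu> u e1 $ 3)" define A32 where "A32 = (\<lambda>u. \<mu> u e2 $ 3)" define A33 where "A33 = (\<lambda>u. \<mu> u e3 $ 3)"
  note A_defs = A11_def A12_def A13_def A21_def A22_def A23_def A31_def A32_def A33_def
  have vl: "vlin (\<mu> u)" "vlin (\<lambda>u. \<mu> u v)" for u v using bil by (auto simp: bil_def)
  have lins: "lin A11" "lin A12" "lin A13" "lin A21" "lin A22" "lin A23" "lin A31" "lin A32" "lin A33"
    unfolding A_defs by (rule lin_component[OF vl(2)])+
  note lD = linD(1,2,4,5)[OF lins(1)] linD(1,2,4,5)[OF lins(2)] linD(1,2,4,5)[OF lins(3)] linD(1,2,4,5)[OF lins(4)] linD(1,2,4,5)[OF lins(5)]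
    linD(1,2,4,5)[OF lins(6)] linD(1,2,4,5)[OF lins(7)] linD(1,2,4,5)[OF lins(8)] linD(1,2,4,5)[OF lins(9)]
  have A0: "A11 u0 = 1" "A12 u0 = 0" "A13 u0 = 0" "A21 u0 = 0" "A22 u0 = 1" "A23 u0 = 0" "A31 u0 = 0" "A32 u0 = 0" "A33 u0 = 0"
    by (simp_all add: A_defs u0)
  have cmp: "\<mu> u v $ 1 = v$1 * A11 u + v$2 * A12 u + v$3 * A13 u"
    "\<mu> u v $ 2 = v$1 * A21 u + v$2 * A22 u + v$3 * A23 u"
    "\<mu> u v $ 3 = v$1 * A31 u + v$2 * A32 u + v$3 * A33 u" for u v
    using vlin_expand[OF vl(1)[of u], of v] by (simp_all add: A_defs)
  have det: "A11 u * (A22 u * A33 u - A23 u * A32 u) - A12 u * (A21 u * A33 u - A23 u * A31 u)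
      + A13 u * (A21 u * A32 u - A22 u * A31 u) = 0" for u
    using singular_det3[OF vl(1)[of u] sing[of u]] by (simp add: det3_def A_defs algebra_simps)
  obtain t0 :: 'k where t0: "t0 \<noteq> 0" "t0 \<noteq> 1" using infinite_avoid[OF inf, of "{0, 1}"] by auto
  \<comment> \<open>The difference of the determinants at \<open>u + t u0\<close> and at
    \<open>u\<close> is \<open>t * t * A33 u + t * q\<close>; the values \<open>t = 1\<close> and
    \<open>t = t0\<close> make both coefficients zero.\<close>
  have quad: "A33 u = 0 \<and> A33 u * (A11 u + A22 u) - A13 u * A31 u - A23 u * A32 u = 0" for u
  proof -
    define q where "q = A33 u * (A11 u + A22 u) - A13 u * A31 u - A23 u * A32 u"
    have e: "t * t * A33 u + t * q = 0" for t
    proof -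
      have "t * t * A33 u + t * q = (A11 u + t) * ((A22 u + t) * A33 u - A23 u * A32 u) - A12 u * (A21 u * A33 u - A23 u * A31 u)
        + A13 u * (A21 u * A32 u - (A22 u + t) * A31 u) - (A11 u * (A22 u * A33 u - A23 u * A32 u) - A12 u * (A21 u * A33 u - A23 u * A31 u)
        + A13 u * (A21 u * A32 u - A22 u * A31 u))"
        unfolding q_def by (simp add: algebra_simps)
      also have "\<dots> = 0" using det[of "u + t *s u0"] det[of u] by (simp add: lD A0)
      finally show ?thesis .
    qed
    have 1: "q = - A33 u" using e[of 1] by (simp add: eq_neg_iff_add_eq_0 add.commute)
    have "t0 * (t0 - 1) * A33 u = 0" using e[of t0] unfolding 1 by (simp add: algebra_simps)
    then have "A33 u = 0" using t0 by simp
    then show ?thesis using 1 unfolding q_def by simp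
  qed
  have A33: "A33 u = 0" and Q: "A13 u * A31 u + A23 u * A32 u = 0" for u
    using quad[of u] by (auto simp: algebra_simps add_eq_0_iff)
  have D: "A12 u * A23 u * A31 u + A13 u * A21 u * A32 u - A13 u * A22 u * A31 u - A11 u * A23 u * A32 u = 0" for u
    using det[of u] by (simp add: A33 algebra_simps)
  have c0: "\<not> (\<forall>u. A31 u = 0 \<and> A32 u = 0)"
  proof
    assume z: "\<forall>u. A31 u = 0 \<and> A32 u = 0"
    have "\<forall>u v. dot e3 (\<mu> u v) = 0" by (simp add: cmp A33 z)
    then have "e3 = (0 :: 'k^3)" using sp unfolding spanning_def by blast
    then show False by (simp add: vec3_eq_iff)
  qed
  show ?thesis
  proof (cases "\<forall>u. A13 u = 0 \<and> A23 u = 0")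
    case True
    then have "\<mu> u e3 = 0" for u by (simp add: vec3_eq_iff cmp A33)
    moreover have "e3 \<noteq> (0 :: 'k^3)" by (simp add: vec3_eq_iff)
    ultimately show ?thesis unfolding right_kernel_def by blast
  next
    case b0: False
    show ?thesis
    proof (cases "\<exists>s t. (s \<noteq> 0 \<or> t \<noteq> 0) \<and> (\<forall>u. s * A13 u + t * A23 u = 0)")
      case True
      then obtain s t where st: "s \<noteq> 0 \<or> t \<noteq> 0" "\<And>u. s * A13 u + t * A23 u = 0" by blast
      have "compressed \<mu>"
      proof (cases "t = 0")
        case True
        \<comment> \<open>The column b is always a multiple of \<open>e2\<close>; the plane of
          \<open>e2\<close> and \<open>e3\<close> turns out to be mapped into the line of
          \<open>e2\<close>.\<close>
        then have A13: "A13 u = 0" for u using st(1) st(2)[of u] by simp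
        have "A32 u = 0" for u
          using lin_product_zero[OF lins(6,8)] Q A13 b0 by auto
        note A32 = this
        have "A12 u * A23 u * A31 u = 0" for u using D[of u] A13 A32 by simp
        then have A12: "A12 u = 0" for u
          using lin_product_zero3[OF inf lins(2,6,7)] c0 b0 A32 A13 by blast
        have "indep2 (e2 :: 'k^3) e3" by (simp add: indep2_def vec3_eq_iff)
        moreover have "\<mu> u e2 = A22 u *s e2" "\<mu> u e3 = A23 u *s e2" for u
          by (simp_all add: vec3_eq_iff cmp A12 A32 A13 A33)
        ultimately show ?thesis unfolding compressed_def by blast
      next
        case False
        \<comment> \<open>The column b is always a multiple of \<open>e1 + k e2\<close>. This vector
          spans the image line and, together with \<open>e3\<close>, the plane mapped into
          it.\<close>
        define k where "k = - s / t"
        have A23: "A23 u = k * A13 u" for u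
          using st(2)[of u] False by (simp add: k_def field_simps eq_neg_iff_add_eq_0 add.commute)
        have A13: "\<not> (\<forall>u. A13 u = 0)" using b0 A23 by auto
        have "lin (\<lambda>u. A31 u + k * A32 u)" using lins by (simp add: lin_def algebra_simps)
        from lin_product_zero[OF lins(3) this] Q A13 have "A31 u + k * A32 u = 0" for u
          by (simp add: A23 algebra_simps)
        then have A31: "A31 u = - k * A32 u" for u by (simp add: eq_neg_iff_add_eq_0)
        have A32: "\<not> (\<forall>u. A32 u = 0)" using c0 A31 by auto
        have "lin (\<lambda>u. A21 u + k * A22 u - k * A11 u - k * k * A12 u)" using lins by (simp add: lin_def algebra_simps)
        from lin_product_zero3[OF inf lins(3,8) this]
        have "(\<forall>u. A13 u * A32 u * (A21 u + k * A22 u - k * A11 u - k * k * A12 u) = 0) \<Longrightarrow>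
          A21 u + k * A22 u - k * A11 u - k * k * A12 u = 0" for u using A13 A32 by blast
        moreover have "A13 u * A32 u * (A21 u + k * A22 u - k * A11 u - k * k * A12 u) = 0" for u
          using D[of u] by (simp add: A23 A31 algebra_simps)
        ultimately have L: "A21 u + k * A22 u - k * A11 u - k * k * A12 u = 0" for u by blast
        let ?p = "e1 + k *s e2 :: 'k^3"
        have "indep2 ?p e3" by (auto simp: indep2_def vec3_eq_iff)
        moreover have "\<mu> u ?p = (A11 u + k * A12 u) *s ?p" "\<mu> u e3 = A13 u *s ?p" for u
          using L[of u] by (simp_all add: vec3_eq_iff cmp A23 A31 A33 algebra_simps)
        ultimately show ?thesis unfolding compressed_def by blast
      qed
      then show ?thesis by blast
    next
      case ind: False
      obtain x where x: "A13 x \<noteq> 0 \<or> A23 x \<noteq> 0" using b0 by blast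
      then obtain y where y: "A23 x * A13 y + (- A13 x) * A23 y \<noteq> 0" using ind by (metis neg_equal_0_iff_equal)
      define \<Delta> where "\<Delta> = A23 x * A13 y - A13 x * A23 y"
      have \<Delta>: "\<Delta> \<noteq> 0" using y by (simp add: \<Delta>_def)
      \<comment> \<open>Dual vectors to the independent forms \<open>A13\<close> and
        \<open>A23\<close>, found by Cramer's rule. With \<open>u0\<close>, on which both forms
        vanish, \<open>w1\<close> and \<open>w2\<close> make a basis.\<close>
      define w1 where "w1 = (A23 x / \<Delta>) *s y + (- A23 y / \<Delta>) *s x"
      define w2 where "w2 = (- A13 x / \<Delta>) *s y + (A13 y / \<Delta>) *s x"
      have w: "A13 w1 = 1" "A23 w1 = 0" "A13 w2 = 0" "A23 w2 = 1"
        using \<Delta> by (simp_all add: w1_def w2_def lD field_simps) (simp_all add: \<Delta>_def algebra_simps)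
      have A31w1: "A31 w1 = 0" using Q[of w1] w by simp
      have A32w2: "A32 w2 = 0" using Q[of w2] w by simp
      \<comment> \<open>The quadratic identity \<open>Q\<close>, evaluated on this basis, forces the
        bottom row to be \<open>k\<close> times \<open>(- A23, A13)\<close>.\<close>
      define k where "k = A32 w1"
      have A31w2: "A31 w2 = - k" using Q[of "w1 + w2"] w by (simp add: lD k_def A31w1 A32w2 eq_neg_iff_add_eq_0)
      have u0nz: "u0 \<noteq> 0" using A0(1) linD(3)[OF lins(1)] by auto
      have "\<not> singular (lc3 u0 w1 w2)"
        unfolding singular_def
      proof
        assume "\<exists>v. v \<noteq> 0 \<and> lc3 u0 w1 w2 v = 0"
        then obtain v where v: "v \<noteq> 0" "lc3 u0 w1 w2 v = 0" by blast
        have "A13 (lc3 u0 w1 w2 v) = v$2" "A23 (lc3 u0 w1 w2 v) = v$3" by (simp_all add: lc3_def lD A0 w)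
        then have "v$2 = 0" "v$3 = 0" using v(2) linD(3)[OF lins(3)] linD(3)[OF lins(6)] by auto
        moreover from this have "v$1 = 0" using v(2) u0nz by (simp add: lc3_def)
        ultimately show False using v(1) by (simp add: vec3_eq_iff)
      qed
      then obtain g where g: "\<And>v. lc3 u0 w1 w2 (g v) = v" using vlin_nonsingular_inverse[OF vlin_lc3] by metis
      have "A31 (lc3 u0 w1 w2 x) = - k * A23 (lc3 u0 w1 w2 x)" "A32 (lc3 u0 w1 w2 x) = k * A13 (lc3 u0 w1 w2 x)" for x
        by (simp_all add: lc3_def lD A0 w A31w1 A31w2 A32w2 k_def[symmetric])
      from this[of "g u" for u] have third: "A31 u = - k * A23 u" "A32 u = k * A13 u" for u unfolding g by blast+
      have k: "k \<noteq> 0" using c0 third by auto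
      have cub: "A12 u * (- A23 u * A23 u) + A21 u * A13 u * A13 u + (A22 u - A11 u) * A13 u * A23 u = 0" for u
      proof -
        have "k * (A12 u * (- A23 u * A23 u) + A21 u * A13 u * A13 u + (A22 u - A11 u) * A13 u * A23 u) = 0"
          using D[of u] by (simp add: third algebra_simps)
        then show ?thesis using k by simp
      qed
      have A21w1: "A21 w1 = 0" using cub[of w1] by (simp add: w)
      have A12w2: "A12 w2 = 0" using cub[of w2] by (simp add: w)
      \<comment> \<open>On the line \<open>w1 + t w2\<close> the remaining cubic becomes
        \<open>t * (B + t * C)\<close>; two nonzero values of \<open>t\<close> kill \<open>B\<close>
        and \<open>C\<close>.\<close>
      define B where "B = A21 w2 + A22 w1 - A11 w1" define C where "C = - A12 w1 + A22 w2 - A11 w2"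
      have BC: "t * (B + t * C) = 0" for t
        using cub[of "w1 + t *s w2"] by (simp add: lD w A21w1 A12w2 B_def C_def algebra_simps)
      have "B + C = 0" using BC[of 1] by simp
      moreover have "B + t0 * C = 0" using BC[of t0] t0 by simp
      moreover have "(t0 - 1) * C = (B + t0 * C) - (B + C)" by (simp add: algebra_simps)
      ultimately have "(t0 - 1) * C = 0" by simp
      then have C: "C = 0" using t0 by simp
      then have B: "B = 0" using \<open>B + C = 0\<close> by simp
      define a where "a = A11 w1 - A22 w1"
      define p where "p = A12 w1"
      have aB: "A21 w2 = a" using B by (simp add: B_def a_def algebra_simps eq_neg_iff_add_eq_0)
      have pC: "A22 w2 = A11 w2 + p" using C by (simp add: C_def p_def algebra_simps)
      have A11w1: "A11 w1 = a + A22 w1" by (simp add: a_def)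
      \<comment> \<open>The last coordinate of \<open>\<mu> (\<phi> v) v\<close> vanishes once
        \<open>w1\<close> and \<open>w2\<close> get the coefficients \<open>v$1\<close> and
        \<open>v$2\<close>. The coefficient of \<open>u0\<close> is solved from the first
        coordinate, and \<open>B = C = 0\<close> makes the second one vanish with the same
        choice.\<close>
      define \<phi> :: "'k^3 \<Rightarrow> 'k^3" where "\<phi> = (\<lambda>v. v$1 *s w1 + v$2 *s w2 + (- (v$1 * A22 w1) - v$2 * A11 w2 - (v$3 + a * v$1 + p * v$2)) *s u0)"
      have "vlin \<phi>" unfolding vlin_def \<phi>_def by (auto intro!: vec3_eqI simp: algebra_simps)
      moreover have "\<not> singular \<phi>"
        unfolding singular_def
      proof
        assume "\<exists>v. v \<noteq> 0 \<and> \<phi> v = 0"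
        then obtain v where v: "v \<noteq> 0" "\<phi> v = 0" by blast
        have "A13 (\<phi> v) = v$1" "A23 (\<phi> v) = v$2" by (simp_all add: \<phi>_def lD A0 w)
        then have z: "v$1 = 0" "v$2 = 0" using v(2) linD(3)[OF lins(3)] linD(3)[OF lins(6)] by auto
        then have "v$3 = 0" using v(2) u0nz by (simp add: \<phi>_def)
        with z show False using v(1) by (simp add: vec3_eq_iff)
      qed
      moreover have "\<mu> (\<phi> v) v = 0" for v
        by (rule vec3_eqI)
          (simp_all add: cmp \<phi>_def lD A0 w third A33 A21w1 A12w2 aB pC A11w1 p_def[symmetric], simp_all add: algebra_simps)
      ultimately show ?thesis unfolding twisted_skew_def by blast
    qed
  qed
qed

text \<open>A \<open>\<mu> u0\<close> of rank two becomes diag(1, 1, 0) after a change of basis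
  \<open>g\<close> in the right argument and \<open>h\<close> in the target. The left argument stays
  as it is, so each alternative is carried back by \<open>g\<close> and the inverse \<open>k\<close>
  of \<open>h\<close>. The remaining type of singular space, with all values in one plane, is
  excluded by \<open>spanning\<close>.\<close>

theorem singular_spaces:
  fixes \<mu> :: "('k::field)^3 \<Rightarrow> 'k^3 \<Rightarrow> 'k^3"
  assumes inf: "infinite (UNIV :: 'k set)"
    and bil: "bil \<mu>" and sp: "spanning \<mu>" and sing: "\<And>u. singular (\<mu> u)"
  shows "right_kernel \<mu> \<or> compressed \<mu> \<or> twisted_skew \<mu>"
proof (cases "\<exists>u v w. indep2 (\<mu> u v) (\<mu> u w)")
  case False
  then show ?thesis using rank_one_case[OF bil sp] by blast
next
  case True
  then obtain u0 v w where ind: "indep2 (\<mu> u0 v) (\<mu> u0 w)" by blast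
  obtain b where b: "b \<noteq> 0" "\<mu> u0 b = 0" using sing[of u0] unfolding singular_def by blast
  define g where "g = lc3 v w b"
  have g: "vlin g" unfolding g_def by (rule vlin_lc3)
  have gn: "\<not> singular g"
    unfolding singular_def
  proof
    assume "\<exists>x. x \<noteq> 0 \<and> g x = 0"
    then obtain x where x: "x \<noteq> 0" "g x = 0" by blast
    have "\<mu> u0 (g x) = x$1 *s \<mu> u0 v + x$2 *s \<mu> u0 w" by (simp add: g_def lc3_def bilD[OF bil] b)
    then have z: "x$1 = 0" "x$2 = 0" using x(2) ind by (auto simp: bilD[OF bil] indep2_def)
    then have "x$3 = 0" using x(2) b(1) by (simp add: g_def lc3_def)
    with z show False using x(1) by (simp add: vec3_eq_iff)
  qed
  obtain g' where g': "vlin g'" "\<And>x. g (g' x) = x" "\<And>x. g' (g x) = x" using vlin_nonsingular_inverse[OF g gn] by blast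
  obtain r where r: "det3 (\<mu> u0 v) (\<mu> u0 w) r \<noteq> 0" using indep2_complete[OF ind] .
  obtain h where h: "vlin h" "\<And>x. lc3 (\<mu> u0 v) (\<mu> u0 w) r (h x) = x" "\<And>x. h (lc3 (\<mu> u0 v) (\<mu> u0 w) r x) = x"
    using vlin_nonsingular_inverse[OF vlin_lc3 nonsingular_lc3[OF r]] by blast
  define k where "k = lc3 (\<mu> u0 v) (\<mu> u0 w) r"
  note h = h[folded k_def]
  have k: "vlin k" unfolding k_def by (rule vlin_lc3)
  define \<nu> where "\<nu> = (\<lambda>u x. h (\<mu> u (g x)))"
  have bn: "bil \<nu>" unfolding bil_def vlin_def \<nu>_def by (simp add: bilD[OF bil] vlinD[OF g] vlinD[OF h(1)])
  have \<mu>_eq: "\<mu> u x = k (\<nu> u (g' x))" for u x by (simp add: \<nu>_def h(2) g'(2))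
  have h0: "h x = 0 \<longleftrightarrow> x = 0" for x using h(2)[of x] vlinD(3)[OF k] vlinD(3)[OF h(1)] by metis
  have "spanning \<nu>"
    unfolding spanning_def
  proof (intro allI impI)
    fix \<psi> assume "\<forall>u v. dot \<psi> (\<nu> u v) = 0"
    then have 1: "dot \<psi> (h (\<mu> u x)) = 0" for u x using g'(2)[of x] unfolding \<nu>_def by metis
    obtain \<psi>' where \<psi>': "\<forall>x. dot \<psi> (h x) = dot \<psi>' x" using lin_dot_ex[OF lin_vlin[OF lin_dot h(1)]] ..
    then have "\<forall>u x. dot \<psi>' (\<mu> u x) = 0" using 1 by metis
    then have "\<psi>' = 0" using sp unfolding spanning_def by blast
    then have "dot \<psi> x = 0" for x using \<psi>' h(3)[of x] by (metis dot_zero_left(1))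
    from this[of e1] this[of e2] this[of e3] show "\<psi> = 0" by (intro vec3_eqI) (simp_all add: dot_def)
  qed
  moreover have "singular (\<nu> u)" for u
  proof -
    obtain x where "x \<noteq> 0" "\<mu> u x = 0" using sing[of u] unfolding singular_def by blast
    then have "g' x \<noteq> 0" "\<nu> u (g' x) = 0" using g'(2)[of x] vlinD(3)[OF g] by (auto simp: \<nu>_def vlinD[OF h(1)])
    then show ?thesis unfolding singular_def by blast
  qed
  moreover have "\<nu> u0 x = vector [x$1, x$2, 0]" for x
  proof -
    have "\<mu> u0 (g x) = k (vector [x$1, x$2, 0])" by (simp add: g_def k_def lc3_def bilD[OF bil] b)
    then show ?thesis by (simp add: \<nu>_def h(3))
  qed
  ultimately have "right_kernel \<nu> \<or> compressed \<nu> \<or> twisted_skew \<nu>"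
    using rank_two_case[OF inf bn] by blast
  then show ?thesis
  proof (elim disjE)
    assume "right_kernel \<nu>"
    then obtain x where x: "x \<noteq> 0" "\<forall>u. \<nu> u x = 0" unfolding right_kernel_def by blast
    have "g x \<noteq> 0" using x(1) gn unfolding singular_def by blast
    moreover have "\<mu> u (g x) = 0" for u using x(2) h0 unfolding \<nu>_def by blast
    ultimately show ?thesis unfolding right_kernel_def by blast
  next
    assume "compressed \<nu>"
    then obtain x y p where xy: "indep2 x y" "\<forall>u. (\<exists>a. \<nu> u x = a *s p) \<and> (\<exists>b. \<nu> u y = b *s p)" unfolding compressed_def by blast
    have "indep2 (g x) (g y)"
      unfolding indep2_def
    proof (intro allI impI)
      fix a b assume "a *s g x + b *s g y = 0"
      then have "g (a *s x + b *s y) = 0" by (simp add: vlinD[OF g])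
      then have "a *s x + b *s y = 0" using gn unfolding singular_def by blast
      then show "a = 0 \<and> b = 0" using xy(1) unfolding indep2_def by blast
    qed
    moreover have "(\<exists>a. \<mu> u (g x) = a *s k p) \<and> (\<exists>b. \<mu> u (g y) = b *s k p)" for u
      using xy(2)[rule_format, of u] \<mu>_eq[of u "g x"] \<mu>_eq[of u "g y"] g'(3) by (auto simp: vlinD[OF k])
    ultimately show ?thesis unfolding compressed_def by blast
  next
    assume "twisted_skew \<nu>"
    then obtain \<phi> where \<phi>: "vlin \<phi>" "\<not> singular \<phi>" "\<forall>v. \<nu> (\<phi> v) v = 0" unfolding twisted_skew_def by blast
    have "vlin (\<lambda>v. \<phi> (g' v))" using \<phi>(1) g'(1) by (simp add: vlin_def)
    moreover have "\<not> singular (\<lambda>v. \<phi> (g' v))"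
      using \<phi>(2) g'(2) vlinD(3)[OF g] unfolding singular_def by metis
    moreover have "\<mu> (\<phi> (g' v)) v = 0" for v using \<phi>(3) \<mu>_eq vlinD(3)[OF k] by simp
    ultimately show ?thesis unfolding twisted_skew_def by blast
  qed
qed

section \<open>Vanishing rules for forms and dual systems of small size\<close>

lemma SV_pair:
  assumes "F \<in> SV \<mu> m"
  shows "\<exists>\<psi>. \<forall>u v. F (p @ u # v # s) = dot \<psi> (\<mu> u v)"
proof (cases "length p + length s + 2 = m")
  case True
  then show ?thesis by (rule SVD(3)[OF assms])
next
  case False
  have "F (p @ u # v # s) = dot 0 (\<mu> u v)" for u v using SVD(1)[OF assms, of "p @ u # v # s"] False by simp
  then show ?thesis by blast
qed

lemma SV_pair_zero:
  assumes "F \<in> SV \<mu> m" "\<mu> u v = 0"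
  shows "F (p @ u # v # s) = 0"
proof -
  obtain \<psi> where "\<forall>u v. F (p @ u # v # s) = dot \<psi> (\<mu> u v)" using SV_pair[OF assms(1)] by blast
  then show ?thesis using assms(2) by simp
qed

lemma SV_lin:
  assumes "F \<in> SV \<mu> m"
  shows "lin (\<lambda>v. F (p @ v # s))"
proof (cases "length p + length s + 1 = m")
  case False
  have "F (p @ v # s) = 0" for v using SVD(1)[OF assms, of "p @ v # s"] False by simp
  then show ?thesis by (simp add: lin_def)
qed (rule SVD(2)[OF assms])

lemma SV_expand_head:
  assumes "F \<in> SV \<mu> m"
  shows "F (v # s) = v$1 * F (e1 # s) + v$2 * F (e2 # s) + v$3 * F (e3 # s)"
  using lin_expand[OF SV_lin[OF assms, of "[]" s], of v] by simp

lemma SV_prefix: "F \<in> SV \<mu> (length p + m) \<Longrightarrow> (\<lambda>l. F (p @ l)) \<in> SV \<mu> m"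
proof (induction p arbitrary: F)
  case (Cons a p)
  then show ?case using Cons.IH[OF SV_cons[of F \<mu> "length p + m" a]] by simp
qed simp

lemma SV_suffix: "F \<in> SV \<mu> (m + length s) \<Longrightarrow> (\<lambda>l. F (l @ s)) \<in> SV \<mu> m"
proof (induction s arbitrary: F rule: rev_induct)
  case (snoc a s)
  then show ?case using snoc.IH[OF SV_snoc[of F \<mu> "m + length s" a]] by simp
qed simp

lemma SV_trivial_mono:
  assumes "\<And>F. F \<in> SV \<mu> m \<Longrightarrow> F = (\<lambda>_. 0)" "m \<le> n" "F \<in> SV \<mu> n"
  shows "F = (\<lambda>_. 0)"
proof (rule ext)
  fix l
  show "F l = 0"
  proof (cases "length l = n")
    case True
    let ?p = "take (n - m) l" and ?s = "drop (n - m) l"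
    have "(\<lambda>s. F (?p @ s)) \<in> SV \<mu> m" using assms(2,3) True by (intro SV_prefix) simp
    from fun_cong[OF assms(1)[OF this], of ?s] show ?thesis by simp
  qed (use SVD(1)[OF assms(3)] in simp)
qed

lemma has_dim_zero: "(\<And>F. F \<in> Q \<Longrightarrow> F = (\<lambda>_. 0)) \<Longrightarrow> has_dim Q 0"
  by (rule has_dimI[of 0 "\<lambda>_ _. 0" _ "\<lambda>_. undefined"]) auto

lemma has_dim_one:
  assumes "F \<in> Q" "F P = 1" "\<And>f. f \<in> Q \<Longrightarrow> f P = 0 \<Longrightarrow> f = (\<lambda>_. 0)"
  shows "has_dim Q 1"
  by (rule has_dimI[of _ "\<lambda>_. F" _ "\<lambda>_. P"]) (use assms in auto)

lemma has_dim_two: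
  assumes "F \<in> Q" "G \<in> Q" "F P = 1" "F R = 0" "G P = 0" "G R = 1"
    "\<And>f. f \<in> Q \<Longrightarrow> f P = 0 \<Longrightarrow> f R = 0 \<Longrightarrow> f = (\<lambda>_. 0)"
  shows "has_dim Q 2"
proof (rule has_dimI[of _ "\<lambda>i. if i = 0 then F else G" _ "\<lambda>i. if i = 0 then P else R"])
  fix f assume f: "f \<in> Q" "\<And>i::nat. i < 2 \<Longrightarrow> f (if i = 0 then P else R) = 0"
  show "f = (\<lambda>_. 0)" by (rule assms(7)[OF f(1)]) (use f(2)[of 0] f(2)[of 1] in auto)
qed (use assms(1-6) in \<open>auto simp: less_2_cases_iff\<close>)

subsection \<open>Functionals supported on the last coordinate\<close>

text \<open>The product of the third coordinates of all arguments but the last and of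
  \<open>\<phi>\<close> at the last one: the form dual to the words
  \<open>e3 ... e3 v\<close>.\<close>

primrec tail_form :: "(('k::field)^3 \<Rightarrow> 'k) \<Rightarrow> ('k^3) list \<Rightarrow> 'k" where
  "tail_form \<phi> [] = 0"
| "tail_form \<phi> (v # l) = (if l = [] then \<phi> v else v$3 * tail_form \<phi> l)"

lemma lin_times: "lin f \<Longrightarrow> lin (\<lambda>v. f v * c)"
  by (simp add: lin_def algebra_simps)

lemma lin_nth: "lin (\<lambda>v. v $ i)"
  by (simp add: lin_def)

lemma fsub_SV_scale: "F \<in> SV \<mu> m \<Longrightarrow> (\<lambda>l. c * F l) \<in> SV \<mu> m"
  using fsubD(3)[OF fsub_SV] .

lemma SV_1I: "lin \<phi> \<Longrightarrow> (\<lambda>l. if length l = 1 then \<phi> (hd l) else 0) \<in> SV \<mu> 1"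
  by (rule SVI) auto

text \<open>An adjacent pair contributes two third coordinates or, at the end, a third coordinate
  and a value of \<open>\<phi>\<close>; the hypotheses say that both products factor through
  \<open>\<mu>\<close>.\<close>

lemma tail_form_SV:
  assumes "lin \<phi>" "\<And>u v. u$3 * v$3 = dot \<psi> (\<mu> u v)" "\<And>u v. u$3 * \<phi> v = dot \<psi>' (\<mu> u v)" "m \<ge> 1"
  shows "(\<lambda>l. if length l = m then tail_form \<phi> l else 0) \<in> SV \<mu> m"
  using assms(4)
proof (induction m rule: dec_induct)
  case base
  have "(\<lambda>l. if length l = 1 then tail_form \<phi> l else 0) = (\<lambda>l. if length l = 1 then \<phi> (hd l) else 0)"
    by (rule ext) (auto simp: length_Suc_conv)
  then show ?case using SV_1I[OF assms(1)] by simp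
next
  case (step m)
  have m: "length s = m \<Longrightarrow> s \<noteq> []" for s :: "('a^3) list" using step.hyps by auto
  show ?case
  proof (rule SV_consI)
    show "(\<lambda>l. if length (v # l) = Suc m then tail_form \<phi> (v # l) else 0) \<in> SV \<mu> m" for v
      using fsub_SV_scale[OF step.IH, of "v$3"]
      by (rule back_subst[of "\<lambda>f. f \<in> SV \<mu> m"]) (use m in auto)
    show "lin (\<lambda>v. if length (v # s) = Suc m then tail_form \<phi> (v # s) else 0)" if "length s = m" for s
      using that m[OF that] lin_times[OF lin_nth] by simp
    fix s :: "('a^3) list" assume s: "Suc (length s) = m"
    show "\<exists>\<psi>. \<forall>u v. (if length (u # v # s) = Suc m then tail_form \<phi> (u # v # s) else 0) = dot \<psi> (\<mu> u v)"
    proof (cases "s = []")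
      case True
      then show ?thesis using s assms(3) by auto
    next
      case False
      have "(if length (u # v # s) = Suc m then tail_form \<phi> (u # v # s) else 0) = dot (tail_form \<phi> s *s \<psi>) (\<mu> u v)" for u v
        using s False by (simp add: dot_scale_left assms(2)[symmetric])
      then show ?thesis by blast
    qed
  qed simp
qed

lemma tail_form_replicate: "tail_form \<phi> (replicate k e3 @ [v]) = \<phi> v"
  by (induction k) auto

text \<open>Any position other than the last lies in a window of three letters in which it comes
  first or second, and restricting \<open>F\<close> to this window gives a form of degree 3.\<close>

lemma SV_not_last:
  assumes "\<And>F v w. F \<in> SV \<mu> 3 \<Longrightarrow> F [e, v, w] = 0" "\<And>F v w. F \<in> SV \<mu> 3 \<Longrightarrow> F [v, e, w] = 0"
    and "F \<in> SV \<mu> m" "m \<ge> 3" "s \<noteq> []"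
  shows "F (p @ e # s) = 0"
proof (cases "length p + length s + 1 = m")
  case False
  then show ?thesis using SVD(1)[OF assms(3), of "p @ e # s"] by simp
next
  case True
  obtain w s' where s: "s = w # s'" using assms(5) by (cases s) auto
  show ?thesis
  proof (cases p rule: rev_cases)
    case Nil
    then obtain w' s'' where s': "s' = w' # s''" using True s assms(4) by (cases s') auto
    have "(\<lambda>l. F (l @ s'')) \<in> SV \<mu> 3" by (rule SV_suffix) (use assms(3) True Nil s s' in \<open>auto simp: eval_nat_numeral\<close>)
    from assms(1)[OF this, of w w'] show ?thesis using Nil s s' by simp
  next
    case (snoc p' a)
    have "(\<lambda>l. F (p' @ l)) \<in> SV \<mu> (3 + length s')"
      by (rule SV_prefix) (use assms(3) True snoc s in \<open>simp add: add_ac eval_nat_numeral\<close>)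
    then have "(\<lambda>l. F (p' @ l @ s')) \<in> SV \<mu> 3" by (rule SV_suffix)
    from assms(2)[OF this, of a w] show ?thesis using snoc s by simp
  qed
qed

lemma basis_list_cases:
  assumes "set l \<subseteq> {e1, e2, e3}" "length l = Suc m"
  shows "(\<exists>p s e. l = p @ e # s \<and> s \<noteq> [] \<and> e \<in> {e1, e2}) \<or> (\<exists>e\<in>{e1, e2, e3}. l = replicate m e3 @ [e])"
  using assms
proof (induction m arbitrary: l)
  case 0
  then show ?case by (auto simp: length_Suc_conv)
next
  case (Suc m)
  then obtain a l' where l: "l = a # l'" "length l' = Suc m" by (cases l) auto
  have ne: "l' \<noteq> []" using l by auto
  show ?case
  proof (cases "a \<in> {e1, e2}")
    case True
    then show ?thesis using l(1) ne by (intro disjI1 exI[of _ "[]"] exI[of _ l'] exI[of _ a]) simp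
  next
    case False
    then have a: "a = e3" using Suc.prems l by auto
    from Suc.IH[of l'] Suc.prems l
    have "(\<exists>p s e. l' = p @ e # s \<and> s \<noteq> [] \<and> e \<in> {e1, e2}) \<or> (\<exists>e\<in>{e1, e2, e3}. l' = replicate m e3 @ [e])" by auto
    then show ?thesis
    proof
      assume "\<exists>p s e. l' = p @ e # s \<and> s \<noteq> [] \<and> e \<in> {e1, e2}"
      then obtain p s e where "l' = p @ e # s" "s \<noteq> []" "e \<in> {e1, e2}" by blast
      then show ?thesis using l(1) by (intro disjI1 exI[of _ "a # p"] exI[of _ s] exI[of _ e]) simp
    next
      assume "\<exists>e\<in>{e1, e2, e3}. l' = replicate m e3 @ [e]"
      then show ?thesis using l(1) a by auto
    qed
  qed
qed

text \<open>The degree 3 hypotheses confine \<open>e1\<close> and \<open>e2\<close> to the end of a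
  word, and \<open>e1\<close> is excluded there as well because every product \<open>u e1\<close>
  vanishes. The words \<open>e3 ... e3 e3\<close> and \<open>e3 ... e3 e2\<close> remain, and the
  two product forms are dual to them.\<close>

lemma has_dim_tail_two:
  assumes A: "\<And>F e v w. F \<in> SV \<mu> 3 \<Longrightarrow> e \<in> {e1, e2} \<Longrightarrow> F [e, v, w] = 0"
    and B: "\<And>F e v w. F \<in> SV \<mu> 3 \<Longrightarrow> e \<in> {e1, e2} \<Longrightarrow> F [v, e, w] = 0"
    and k: "\<And>u. \<mu> u e1 = 0"
    and 3: "\<And>u v. u$3 * v$3 = dot \<psi> (\<mu> u v)" and 2: "\<And>u v. u$3 * v$2 = dot \<psi>' (\<mu> u v)"
    and m: "m \<ge> 3"
  shows "has_dim (SV \<mu> m) 2"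
proof -
  obtain m' where m': "m = Suc (Suc (Suc m'))" using le_Suc_ex[OF m] by (auto simp: eval_nat_numeral)
  show ?thesis
  proof (rule has_dim_two[of "\<lambda>l. if length l = m then tail_form (\<lambda>v. v$3) l else 0" _
        "\<lambda>l. if length l = m then tail_form (\<lambda>v. v$2) l else 0" "replicate (m - 1) e3 @ [e3]" "replicate (m - 1) e3 @ [e2]"])
    show "(\<lambda>l. if length l = m then tail_form (\<lambda>v. v$3) l else 0) \<in> SV \<mu> m"
      by (rule tail_form_SV[OF lin_nth 3 3]) (use m in simp)
    show "(\<lambda>l. if length l = m then tail_form (\<lambda>v. v$2) l else 0) \<in> SV \<mu> m"
      by (rule tail_form_SV[OF lin_nth 3 2]) (use m in simp)
    fix F assume F: "F \<in> SV \<mu> m" and z: "F (replicate (m - 1) e3 @ [e3]) = 0" "F (replicate (m - 1) e3 @ [e2]) = 0"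
    have z1: "F (replicate (m - 1) e3 @ [e1]) = 0"
      using SV_pair_zero[OF F k, of "replicate (m - 2) e3" e3 "[]"] m' by (simp add: replicate_app_Cons_same)
    show "F = (\<lambda>_. 0)"
    proof (rule SV_zero[OF F])
      fix l :: "('a^3) list" assume l: "set l \<subseteq> {e1, e2, e3}" "length l = m"
      then have "(\<exists>p s e. l = p @ e # s \<and> s \<noteq> [] \<and> e \<in> {e1, e2}) \<or> (\<exists>e\<in>{e1, e2, e3}. l = replicate (m - 1) e3 @ [e])"
        using basis_list_cases[of l "m - 1"] m by simp
      then show "F l = 0"
      proof
        assume "\<exists>p s e. l = p @ e # s \<and> s \<noteq> [] \<and> e \<in> {e1, e2}"
        then obtain p s e where e: "l = p @ e # s" "s \<noteq> []" "e \<in> {e1, e2}" by blast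
        show ?thesis
          unfolding e(1)
        proof (rule SV_not_last[where \<mu> = \<mu> and m = m])
          show "G [e, v, w] = 0" if "G \<in> SV \<mu> 3" for G v w by (rule A[OF that e(3)])
          show "G [v, e, w] = 0" if "G \<in> SV \<mu> 3" for G v w by (rule B[OF that e(3)])
        qed (use F m e(2) in auto)
      next
        assume "\<exists>e\<in>{e1, e2, e3}. l = replicate (m - 1) e3 @ [e]"
        then show ?thesis using z z1 by auto
      qed
    qed
  qed (use m in \<open>simp_all add: tail_form_replicate\<close>)
qed

subsection \<open>Normal forms with left and right kernel\<close>

text \<open>Since every product \<open>u e1\<close> vanishes, \<open>e1\<close> can only be the
  first letter; since every product \<open>e2 v\<close> vanishes, \<open>e2\<close> can only be the
  last. All interior letters are therefore \<open>e3\<close>.\<close>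

lemma kernels_shape:
  fixes l :: "(('k::field)^3) list"
  assumes k1: "\<And>u. \<mu> u e1 = 0" and k2: "\<And>v. \<mu> e2 v = 0" and F: "F \<in> SV \<mu> (Suc (Suc m))"
    and l: "set l \<subseteq> {e1, e2, e3}" "length l = Suc (Suc m)"
    and z: "\<And>a c. a \<in> {e1, e3} \<Longrightarrow> c \<in> {e2, e3} \<Longrightarrow> F (a # replicate m e3 @ [c]) = 0"
  shows "F l = 0"
proof -
  obtain a l' where al: "l = a # l'" "length l' = Suc m" using l by (cases l) auto
  have "(\<exists>p s e. l' = p @ e # s \<and> s \<noteq> [] \<and> e \<in> {e1, e2}) \<or> (\<exists>e\<in>{e1, e2, e3}. l' = replicate m e3 @ [e])"
    using l al by (intro basis_list_cases) auto
  then show ?thesis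
  proof
    assume "\<exists>p s e. l' = p @ e # s \<and> s \<noteq> [] \<and> e \<in> {e1, e2}"
    then obtain p s e where e: "l' = p @ e # s" "s \<noteq> []" "e \<in> {e1, e2}" by blast
    show ?thesis
    proof (cases "e = e1")
      case True
      show ?thesis
      proof (cases p rule: rev_cases)
        case Nil
        then show ?thesis using SV_pair_zero[OF F k1, of "[]" a s] al e True by simp
      next
        case (snoc p' b)
        then show ?thesis using SV_pair_zero[OF F k1, of "a # p'" b s] al e True by simp
      qed
    next
      case False
      then obtain w s' where "s = w # s'" "e = e2" using e by (cases s) auto
      then show ?thesis using SV_pair_zero[OF F k2, of "a # p" w s'] al e by simp
    qed
  next
    assume "\<exists>e\<in>{e1, e2, e3}. l' = replicate m e3 @ [e]"
    then obtain e where e: "e \<in> {e1, e2, e3}" "l' = replicate m e3 @ [e]" by blast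
    show ?thesis
    proof (cases "e = e1")
      case True
      show ?thesis
      proof (cases m)
        case 0
        then show ?thesis using SV_pair_zero[OF F k1, of "[]" a "[]"] al e True by simp
      next
        case (Suc k)
        then show ?thesis using SV_pair_zero[OF F k1, of "a # replicate k e3" e3 "[]"] al e True
          by (simp add: replicate_app_Cons_same)
      qed
    next
      case False
      show ?thesis
      proof (cases "a = e2")
        case True
        obtain w s' where "l' = w # s'" using al by (cases l') auto
        then show ?thesis using SV_pair_zero[OF F k2, of "[]" w s'] al True by simp
      next
        case ne: False
        then have "a \<in> {e1, e3}" using l al by auto
        moreover have "e \<in> {e2, e3}" using e(1) False by auto
        ultimately show ?thesis using z[of a e] al e by simp
      qed
    qed
  qed
qed

text \<open>Product forms matching the words left by \<open>kernels_shape\<close>. From length 3 on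
  the two end factors are not adjacent, so no condition on the product of \<open>\<xi>1\<close> and
  \<open>\<xi>2\<close> arises.\<close>

lemma sandwich_SV:
  assumes "lin \<xi>1" "lin \<xi>2" "\<And>u v. u$3 * v$3 = dot \<psi> (\<mu> u v)" "\<And>u v. u$3 * \<xi>2 v = dot \<psi>' (\<mu> u v)"
    "\<And>u v. \<xi>1 u * v$3 = dot \<psi>'' (\<mu> u v)" "m \<ge> 2"
  shows "(\<lambda>l. if length l = Suc m then \<xi>1 (hd l) * tail_form \<xi>2 (tl l) else 0) \<in> SV \<mu> (Suc m)"
proof (rule SV_consI)
  have T: "(\<lambda>l. if length l = m then tail_form \<xi>2 l else 0) \<in> SV \<mu> m"
    by (rule tail_form_SV[OF assms(2-4)]) (use assms(6) in simp)
  show "(\<lambda>l. if length (v # l) = Suc m then \<xi>1 (hd (v # l)) * tail_form \<xi>2 (tl (v # l)) else 0) \<in> SV \<mu> m" for v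
    using fsub_SV_scale[OF T, of "\<xi>1 v"] by (rule back_subst[of "\<lambda>f. f \<in> SV \<mu> m"]) auto
  show "lin (\<lambda>v. if length (v # s) = Suc m then \<xi>1 (hd (v # s)) * tail_form \<xi>2 (tl (v # s)) else 0)" if "length s = m" for s
    using that lin_times[OF assms(1)] by simp
  fix s :: "('a^3) list" assume s: "Suc (length s) = m"
  have ne: "s \<noteq> []" using s assms(6) by auto
  have "(if length (u # v # s) = Suc m then \<xi>1 (hd (u # v # s)) * tail_form \<xi>2 (tl (u # v # s)) else 0) = dot (tail_form \<xi>2 s *s \<psi>'') (\<mu> u v)" for u v
    using s ne by (simp add: dot_scale_left assms(5)[symmetric])
  then show "\<exists>\<psi>. \<forall>u v. (if length (u # v # s) = Suc m then \<xi>1 (hd (u # v # s)) * tail_form \<xi>2 (tl (u # v # s)) else 0) = dot \<psi> (\<mu> u v)"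
    by blast
qed simp

lemma ge3_cases: "(m::nat) \<ge> 3 \<Longrightarrow> (\<And>k. m = Suc (Suc (Suc k)) \<Longrightarrow> P) \<Longrightarrow> P"
  using le_Suc_ex[of 3 m] by (auto simp: eval_nat_numeral)

text \<open>Write x, y, z for the basis vectors; here and in the next three lemmas u x = 0 and y u =
  0 for all u. The remaining relation is x y = 0, and it leaves all four words with first letter x
  or z, last letter y or z and z in between independent.\<close>

lemma dim_kernels_4:
  fixes \<mu> :: "('k::field)^3 \<Rightarrow> 'k^3 \<Rightarrow> 'k^3"
  assumes \<mu>: "\<And>u v. \<mu> u v = vector [u$3 * v$2, u$1 * v$3, u$3 * v$3]" and m: "m \<ge> 3"
  shows "has_dim (SV \<mu> m) 4"
proof -
  obtain k where k: "m = Suc (Suc (Suc k))" using ge3_cases[OF m] by blast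
  let ?f = "\<lambda>\<xi>1 \<xi>2 l. if length l = m then \<xi>1 (hd l) * tail_form \<xi>2 (tl l) else 0 :: 'k"
  let ?p = "\<lambda>a c. a # replicate (Suc k) e3 @ [c]"
  have mem: "?f (\<lambda>v. v$i) (\<lambda>v. v$j) \<in> SV \<mu> m" if "i \<in> {1, 3}" "j \<in> {2, 3}" for i j
    unfolding k
  proof (rule sandwich_SV[OF lin_nth lin_nth])
    show "u$3 * v$3 = dot e3 (\<mu> u v)" for u v by (simp add: \<mu>)
    show "u$3 * v$j = dot (if j = 2 then e1 else e3) (\<mu> u v)" for u v using that by (auto simp: \<mu>)
    show "u$i * v$3 = dot (if i = 1 then e2 else e3) (\<mu> u v)" for u v using that by (auto simp: \<mu>)
  qed simp
  have k1: "\<mu> u e1 = 0" "\<mu> e2 u = 0" for u by (simp_all add: \<mu> vec3_eq_iff)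
  have val: "?f (\<lambda>v. v$i) (\<lambda>v. v$j) (?p a c) = a$i * c$j" for i j a c
    using tail_form_replicate[of "\<lambda>v. v$j" "Suc k" c] by (simp add: k)
  show ?thesis
  proof (rule has_dimI[of 4 "\<lambda>i. ?f (\<lambda>v. v$(if i < 2 then 1 else 3)) (\<lambda>v. v$(if even i then 2 else 3))" _
        "\<lambda>i. ?p (if i < 2 then e1 else e3) (if even i then e2 else e3)"])
    fix i j :: nat assume ij: "i < 4" "j < 4"
    then have "i = 0 \<or> i = 1 \<or> i = 2 \<or> i = 3" "j = 0 \<or> j = 1 \<or> j = 2 \<or> j = 3" by auto
    then show "?f (\<lambda>v. v$(if i < 2 then 1 else 3)) (\<lambda>v. v$(if even i then 2 else 3))
        (?p (if j < 2 then e1 else e3) (if even j then e2 else e3)) = (if i = j then 1 else 0)"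
      unfolding val by auto
  next
    fix F assume F: "F \<in> SV \<mu> m" and z: "\<And>i::nat. i < 4 \<Longrightarrow> F (?p (if i < 2 then e1 else e3) (if even i then e2 else e3)) = 0"
    show "F = (\<lambda>_. 0)"
    proof (rule SV_zero[OF F])
      fix l :: "('k^3) list" assume l: "set l \<subseteq> {e1, e2, e3}" "length l = m"
      show "F l = 0"
        by (rule kernels_shape[OF k1 F[unfolded k] l(1) l(2)[unfolded k]])
          (use z[of 0] z[of 1] z[of 2] z[of 3] in auto)
    qed
  qed (use mem in auto)
qed

text \<open>The remaining relation is x z = a x y. As y w = 0, it gives x z w = a x y w = 0, so x
  disappears from degree 3 on.\<close>

lemma dim_kernels_2:
  fixes \<mu> :: "('k::field)^3 \<Rightarrow> 'k^3 \<Rightarrow> 'k^3"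
  assumes \<mu>: "\<And>u v. \<mu> u v = vector [u$1 * v$2 + a * (u$1 * v$3), u$3 * v$2, u$3 * v$3]" and m: "m \<ge> 3"
  shows "has_dim (SV \<mu> m) 2"
proof (rule has_dim_tail_two)
  have k2: "\<mu> e2 v = 0" for v by (simp add: \<mu> vec3_eq_iff)
  show k1: "\<mu> u e1 = 0" for u by (simp add: \<mu> vec3_eq_iff)
  show "u$3 * v$3 = dot e3 (\<mu> u v)" "u$3 * v$2 = dot e2 (\<mu> u v)" for u v by (simp_all add: \<mu>)
  fix F :: "('k^3) list \<Rightarrow> 'k" and e v w :: "'k^3" assume F: "F \<in> SV \<mu> 3" and e: "e \<in> {e1, e2}"
  have y: "F [v, e2, w] = 0" for v w using SV_pair_zero[OF F k2, of "[v]" w "[]"] by simp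
  then show "F [v, e, w] = 0" using SV_pair_zero[OF F k1, of "[]" v "[w]"] e by auto
  have "F [e1, v, w] = 0"
  proof -
    obtain \<psi> where \<psi>: "\<And>u v. F ([] @ u # v # [w]) = dot \<psi> (\<mu> u v)" using SV_pair[OF F, of "[]" "[w]"] by blast
    then have "\<psi>$1 = 0" using y[of e1 w] \<psi>[of e1 e2] by (simp add: dot_def \<mu>)
    then show ?thesis using \<psi>[of e1 v] by (simp add: dot_def \<mu>)
  qed
  then show "F [e, v, w] = 0" using SV_pair_zero[OF F k2, of "[]" v "[w]"] e by auto
qed (rule m)

text \<open>The remaining relation is z y = a x y + c x z with c nonzero. It gives x z w = 0,
  because y w = 0, and w z y = 0, because w x = 0. Only the powers of z survive.\<close>

lemma dim_kernels_1:
  fixes \<mu> :: "('k::field)^3 \<Rightarrow> 'k^3 \<Rightarrow> 'k^3"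
  assumes \<mu>: "\<And>u v. \<mu> u v = vector [u$1 * v$2 + a * (u$3 * v$2), u$1 * v$3 + c * (u$3 * v$2), u$3 * v$3]"
    and c: "c \<noteq> 0" and m: "m \<ge> 3"
  shows "has_dim (SV \<mu> m) 1"
proof -
  obtain k where k: "m = Suc (Suc (Suc k))" using ge3_cases[OF m] by blast
  have k1: "\<mu> u e1 = 0" "\<mu> e2 u = 0" for u by (simp_all add: \<mu> vec3_eq_iff)
  let ?p = "\<lambda>a c. a # replicate (Suc k) e3 @ [c]"
  show ?thesis
  proof (rule has_dim_one[of "\<lambda>l. if length l = m then tail_form (\<lambda>v. v$3) l else 0" _ "?p e3 e3"])
    show "(\<lambda>l. if length l = m then tail_form (\<lambda>v. v$3) l else 0) \<in> SV \<mu> m"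
      by (rule tail_form_SV[OF lin_nth, of e3 _ _ e3]) (use m in \<open>simp_all add: \<mu>\<close>)
    show "(if length (?p e3 e3) = m then tail_form (\<lambda>v. v$3) (?p e3 e3) else 0) = 1"
      using tail_form_replicate[of "\<lambda>v. v$3" "Suc k" e3] by (simp add: k)
    fix F assume F: "F \<in> SV \<mu> m" and z: "F (?p e3 e3) = 0"
    have 1: "F (e1 # e3 # w # s) = 0" for w s
    proof -
      obtain \<psi> where \<psi>: "\<And>u v. F ([] @ u # v # w # s) = dot \<psi> (\<mu> u v)" using SV_pair[OF F, of "[]" "w # s"] by blast
      have "F ([e1] @ e2 # w # s) = 0" "F ([e3] @ e2 # w # s) = 0" by (rule SV_pair_zero[OF F k1(2)])+
      then have "\<psi>$1 = 0" "\<psi>$2 = 0" using \<psi>[of e1 e2] \<psi>[of e3 e2] c by (auto simp: dot_def \<mu>)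
      then show ?thesis using \<psi>[of e1 e3] by (simp add: dot_def \<mu>)
    qed
    have 2: "F (p @ w # e3 # [e2]) = 0" for w p
    proof -
      obtain \<psi> where \<psi>: "\<And>u v. F ((p @ [w]) @ u # v # []) = dot \<psi> (\<mu> u v)" using SV_pair[OF F, of "(p @ [w])" "[]"] by blast
      have "F (p @ w # e1 # e2 # []) = 0" "F (p @ w # e1 # e3 # []) = 0" by (rule SV_pair_zero[OF F k1(1)])+
      then have "\<psi>$1 = 0" "\<psi>$2 = 0" using \<psi>[of e1 e2] \<psi>[of e1 e3] by (auto simp: dot_def \<mu>)
      then show ?thesis using \<psi>[of e3 e2] by (simp add: dot_def \<mu>)
    qed
    show "F = (\<lambda>_. 0)"
    proof (rule SV_zero[OF F])
      fix l :: "('k^3) list" assume l: "set l \<subseteq> {e1, e2, e3}" "length l = m"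
      have x: "F (?p e1 c) = 0" for c using 1[of "hd (replicate k e3 @ [c])" "tl (replicate k e3 @ [c])"] by (cases k) simp_all
      have y: "F (?p a e2) = 0" for a
      proof (cases k)
        case 0
        then show ?thesis using 2[of "[]" a] by simp
      next
        case (Suc j)
        then show ?thesis using 2[of "a # replicate j e3" e3] by (simp add: replicate_app_Cons_same)
      qed
      show "F l = 0"
        by (rule kernels_shape[OF k1 F[unfolded k] l(1) l(2)[unfolded k]]) (use x y z in auto)
    qed
  qed
qed

text \<open>The remaining relation expresses z z by x y, z y and x z. In degree 4 a square z z in
  the middle vanishes: x y and x z are killed by the letter before them, z y by the letter after
  it.\<close>

lemma dim_kernels_0:
  fixes \<mu> :: "('k::field)^3 \<Rightarrow> 'k^3 \<Rightarrow> 'k^3"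
  assumes \<mu>: "\<And>u v. \<mu> u v = vector [u$1 * v$2 + a * (u$3 * v$3), u$3 * v$2 + b * (u$3 * v$3), u$1 * v$3 + c * (u$3 * v$3)]"
  shows "has_dim (SV \<mu> 3) 1" "m \<ge> 4 \<Longrightarrow> has_dim (SV \<mu> m) 0"
proof -
  have k1: "\<mu> u e1 = 0" "\<mu> e2 u = 0" for u by (simp_all add: \<mu> vec3_eq_iff)
  show "has_dim (SV \<mu> 3) 1"
  proof (rule has_dim_one[of "\<lambda>l. if length l = 3 then ((l!0)$1 + c * (l!0)$3) * (l!1)$3 * ((l!2)$2 + b * (l!2)$3) else 0" _ "[e1, e3, e2]"])
    \<comment> \<open>The form dual to x z y. The terms with \<open>c\<close> and \<open>b\<close>
      reflect z z w = c x z w and w z z = b w z y, which hold in degree 3.\<close>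
    let ?F = "\<lambda>l::('k^3) list. if length l = 3 then ((l!0)$1 + c * (l!0)$3) * (l!1)$3 * ((l!2)$2 + b * (l!2)$3) else 0"
    show "?F \<in> SV \<mu> 3"
    proof (rule SVI)
      fix p s :: "('k^3) list" assume "length p + length s + 1 = 3"
      then have "(\<exists>x y. p = [] \<and> s = [x, y]) \<or> (\<exists>x y. p = [x] \<and> s = [y]) \<or> (\<exists>x y. p = [x, y] \<and> s = [])"
        by (cases p rule: list.exhaust[case_product list.exhaust[of "tl p"]]) (auto simp: length_Suc_conv eval_nat_numeral)
      then show "lin (\<lambda>v. ?F (p @ v # s))" by (auto simp: lin_def algebra_simps)
    next
      fix p s :: "('k^3) list" assume "length p + length s + 2 = 3"
      then have "(\<exists>x. p = [] \<and> s = [x]) \<or> (\<exists>x. p = [x] \<and> s = [])"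
        by (cases p) (auto simp: length_Suc_conv eval_nat_numeral)
      then show "\<exists>\<psi>. \<forall>u v. ?F (p @ u # v # s) = dot \<psi> (\<mu> u v)"
      proof (elim disjE exE conjE)
        fix x assume "p = []" "s = [x]"
        then show ?thesis by (intro exI[of _ "vector [0, 0, x$2 + b * x$3]"]) (auto simp: dot_def \<mu> algebra_simps)
      next
        fix x assume "p = [x]" "s = []"
        then show ?thesis by (intro exI[of _ "vector [0, x$1 + c * x$3, 0]"]) (auto simp: dot_def \<mu> algebra_simps)
      qed
    qed simp
    show "?F [e1, e3, e2] = 1" by simp
    fix F assume F: "F \<in> SV \<mu> 3" and z: "F [e1, e3, e2] = 0"
    have L: "F [w, e3, e3] = b * F [w, e3, e2]" for w
    proof -
      obtain \<psi> where \<psi>: "\<And>u v. F ([w] @ u # v # []) = dot \<psi> (\<mu> u v)" using SV_pair[OF F, of "[w]" "[]"] by blast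
      have "F ([] @ w # e1 # [e2]) = 0" "F ([] @ w # e1 # [e3]) = 0" by (rule SV_pair_zero[OF F k1(1)])+
      then have "\<psi>$1 = 0" "\<psi>$3 = 0" using \<psi>[of e1 e2] \<psi>[of e1 e3] by (auto simp: dot_def \<mu>)
      then show ?thesis using \<psi>[of e3 e3] \<psi>[of e3 e2] by (simp add: dot_def \<mu>)
    qed
    have R: "F [e3, e3, w] = c * F [e1, e3, w]" for w
    proof -
      obtain \<psi> where \<psi>: "\<And>u v. F ([] @ u # v # [w]) = dot \<psi> (\<mu> u v)" using SV_pair[OF F, of "[]" "[w]"] by blast
      have "F ([e1] @ e2 # w # []) = 0" "F ([e3] @ e2 # w # []) = 0" by (rule SV_pair_zero[OF F k1(2)])+
      then have "\<psi>$1 = 0" "\<psi>$2 = 0" using \<psi>[of e1 e2] \<psi>[of e3 e2] by (auto simp: dot_def \<mu>)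
      then show ?thesis using \<psi>[of e3 e3] \<psi>[of e1 e3] by (simp add: dot_def \<mu>)
    qed
    show "F = (\<lambda>_. 0)"
    proof (rule SV_zero[OF F])
      fix l :: "('k^3) list" assume l: "set l \<subseteq> {e1, e2, e3}" "length l = 3"
      show "F l = 0"
        by (rule kernels_shape[where \<mu> = \<mu> and m = 1]) (use F l z L R k1 in \<open>auto simp: eval_nat_numeral\<close>)
    qed
  qed
  show "m \<ge> 4 \<Longrightarrow> has_dim (SV \<mu> m) 0"
  proof (rule has_dim_zero, rule SV_trivial_mono[where m = 4])
    fix F assume F: "F \<in> SV \<mu> 4"
    show "F = (\<lambda>_. 0)"
    proof (rule SV_zero[OF F])
      fix l :: "('k^3) list" assume l: "set l \<subseteq> {e1, e2, e3}" "length l = 4"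
      have z: "F [x, e3, e3, w] = 0" for x w
      proof -
        obtain \<psi> where \<psi>: "\<And>u v. F ([x] @ u # v # [w]) = dot \<psi> (\<mu> u v)" using SV_pair[OF F, of "[x]" "[w]"] by blast
        have "F ([] @ x # e1 # [e2, w]) = 0" "F ([] @ x # e1 # [e3, w]) = 0" by (rule SV_pair_zero[OF F k1(1)])+
        moreover have "F ([x, e3] @ e2 # w # []) = 0" by (rule SV_pair_zero[OF F k1(2)])
        ultimately have "\<psi>$1 = 0" "\<psi>$2 = 0" "\<psi>$3 = 0"
          using \<psi>[of e1 e2] \<psi>[of e3 e2] \<psi>[of e1 e3] by (auto simp: dot_def \<mu>)
        then show ?thesis using \<psi>[of e3 e3] by (simp add: dot_def)
      qed
      show "F l = 0"
        by (rule kernels_shape[where \<mu> = \<mu> and m = 2]) (use F l z k1 in \<open>auto simp: eval_nat_numeral\<close>)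
    qed
  qed auto
qed

text \<open>Left factors \<open>e1\<close> and \<open>e2\<close> have all their products in one
  line, through a nondegenerate matrix. Since \<open>v e1 w = 0\<close>, a letter in front kills
  this line, and then a letter behind kills it as well; so \<open>e1\<close> and \<open>e2\<close>
  can only end a word.\<close>

lemma dim_compressed_2:
  fixes \<mu> :: "('k::field)^3 \<Rightarrow> 'k^3 \<Rightarrow> 'k^3"
  assumes \<mu>: "\<And>u v. \<mu> u v = vector [u$1 * (a * v$2 + b * v$3) + u$2 * (c * v$2 + d * v$3), u$3 * v$2, u$3 * v$3]"
    and nz: "a * d \<noteq> b * c" and m: "m \<ge> 3"
  shows "has_dim (SV \<mu> m) 2"
proof (rule has_dim_tail_two)
  show k1: "\<mu> u e1 = 0" for u by (simp add: \<mu> vec3_eq_iff)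
  show "u$3 * v$3 = dot e3 (\<mu> u v)" "u$3 * v$2 = dot e2 (\<mu> u v)" for u v by (simp_all add: \<mu>)
  fix F :: "('k^3) list \<Rightarrow> 'k" and e v w :: "'k^3" assume F: "F \<in> SV \<mu> 3" and e: "e \<in> {e1, e2}"
  have B: "F [v, e, w] = 0" if "e \<in> {e1, e2}" for v e w
  proof -
    obtain \<psi> where \<psi>: "\<And>u w. F ([v] @ u # w # []) = dot \<psi> (\<mu> u w)" using SV_pair[OF F, of "[v]" "[]"] by blast
    have "F ([] @ v # e1 # [e2]) = 0" "F ([] @ v # e1 # [e3]) = 0" by (rule SV_pair_zero[OF F k1])+
    then have "\<psi>$1 * a = 0" "\<psi>$1 * b = 0" using \<psi>[of e1 e2] \<psi>[of e1 e3] by (simp_all add: dot_def \<mu>)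
    then have "\<psi>$1 = 0" using nz by auto
    then show ?thesis using \<psi>[of e w] that by (auto simp: dot_def \<mu>)
  qed
  show "F [v, e, w] = 0" by (rule B[OF e])
  obtain \<psi> where \<psi>: "\<And>u v. F ([] @ u # v # [w]) = dot \<psi> (\<mu> u v)" using SV_pair[OF F, of "[]" "[w]"] by blast
  have "F [e1, e2, w] = 0" "F [e2, e2, w] = 0" by (rule B; simp)+
  then have "\<psi>$1 * a = 0" "\<psi>$1 * c = 0" using \<psi>[of e1 e2] \<psi>[of e2 e2] by (simp_all add: dot_def \<mu>)
  then have "\<psi>$1 = 0" using nz by auto
  then show "F [e, v, w] = 0" using \<psi>[of e v] e by (auto simp: dot_def \<mu>)
qed (rule m)

lemma list_split_3:
  "length p + length s + 1 = 3 \<Longrightarrow> (\<exists>x y. p = [] \<and> s = [x, y]) \<or> (\<exists>x y. p = [x] \<and> s = [y]) \<or> (\<exists>x y. p = [x, y] \<and> s = [])"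
  by (cases p rule: list.exhaust[case_product list.exhaust[of "tl p"]]) (auto simp: length_Suc_conv eval_nat_numeral)

lemma list_split_2:
  "length p + length s + 2 = 3 \<Longrightarrow> (\<exists>x. p = [] \<and> s = [x]) \<or> (\<exists>x. p = [x] \<and> s = [])"
  by (cases p) (auto simp: length_Suc_conv eval_nat_numeral)

lemma SV_3I:
  assumes "\<And>v w. lin (\<lambda>u. f u v w)" "\<And>u w. lin (\<lambda>v. f u v w)" "\<And>u v. lin (\<lambda>w. f u v w)"
    and "\<And>w. \<exists>\<psi>. \<forall>u v. f u v w = dot \<psi> (\<mu> u v)" "\<And>u. \<exists>\<psi>. \<forall>v w. f u v w = dot \<psi> (\<mu> v w)"
  shows "(\<lambda>l. if length l = 3 then f (l!0) (l!1) (l!2) else 0) \<in> SV \<mu> 3"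
proof (rule SVI)
  show "lin (\<lambda>v. if length (p @ v # s) = 3 then f ((p @ v # s)!0) ((p @ v # s)!1) ((p @ v # s)!2) else 0)"
    if "length p + length s + 1 = 3" for p s
    using list_split_3[OF that] assms(1-3) by auto
  show "\<exists>\<psi>. \<forall>u v. (if length (p @ u # v # s) = 3 then f ((p @ u # v # s)!0) ((p @ u # v # s)!1) ((p @ u # v # s)!2) else 0) = dot \<psi> (\<mu> u v)"
    if "length p + length s + 2 = 3" for p s
    using list_split_2[OF that] assms(4,5) by auto
qed simp

lemma has_dim_one_scaled:
  assumes "fsub Q" "F \<in> Q" "F P \<noteq> 0" "\<And>f. f \<in> Q \<Longrightarrow> f P = 0 \<Longrightarrow> f = (\<lambda>_. 0)"
  shows "has_dim Q 1"
  by (rule has_dim_one[of "\<lambda>x. inverse (F P) * F x" _ P]) (use assms fsubD(3)[OF assms(1,2)] in auto)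

lemma list3_E:
  assumes "length l = 3"
  obtains x y z where "l = [x, y, z]"
  using assms by (auto simp: length_Suc_conv eval_nat_numeral)

text \<open>Left factors \<open>e2\<close> and \<open>e3\<close> have their products in one line,
  through a nondegenerate matrix, while \<open>e1 e2\<close> and \<open>e1 e3\<close> complete
  \<open>A\<^sub>2\<close>. By fact \<open>C\<close> no word of length 3 beginning with
  \<open>e2\<close> or \<open>e3\<close> survives, so degree 3 is \<open>e1\<close> times the line.
  In length 4, \<open>C\<close> applies at the first or second letter unless the word begins with
  \<open>e1 e1\<close>, which is zero.\<close>

lemma dim_compressed_0:
  fixes \<mu> :: "('k::field)^3 \<Rightarrow> 'k^3 \<Rightarrow> 'k^3"
  assumes \<mu>: "\<And>u v. \<mu> u v = vector [u$2 * (a * v$2 + b * v$3) + u$3 * (c * v$2 + d * v$3), u$1 * v$2, u$1 * v$3]"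
    and nz: "a * d \<noteq> b * c"
  shows "has_dim (SV \<mu> 3) 1" "m \<ge> 4 \<Longrightarrow> has_dim (SV \<mu> m) 0"
proof -
  have k1: "\<mu> u e1 = 0" for u by (simp add: \<mu> vec3_eq_iff)
  have C: "F [u, v, w] = 0" if F: "F \<in> SV \<mu> 3" and u: "u \<in> {e2, e3}" for F u v w
  proof -
    obtain \<xi> where \<xi>: "\<And>v w. F ([u] @ v # w # []) = dot \<xi> (\<mu> v w)" using SV_pair[OF F, of "[u]" "[]"] by blast
    have x: "F [u, x$2 *s e2 + x$3 *s e3, w] = 0" if "\<mu> u (x$2 *s e2 + x$3 *s e3) = 0" for x w
      using SV_pair_zero[OF F that, of "[]" "[w]"] by simp
    have "\<xi>$1 = 0"
    proof (rule ccontr)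
      assume n: "\<xi>$1 \<noteq> 0"
      show False
      proof (cases "u = e2")
        case True
        \<comment> \<open>\<open>b e2 - a e3\<close> is annihilated by left multiplication with
          \<open>e2\<close>, so \<open>\<xi>\<close> vanishes on all its products. If the line
          coefficient of \<open>\<xi>\<close> were nonzero, the matrix would be degenerate; the case
          \<open>u = e3\<close> uses \<open>d e2 - c e3\<close> in the same way.\<close>
        have "\<mu> u (b *s e2 + (- a) *s e3) = 0" unfolding True by (simp add: \<mu> vec3_eq_iff)
        then have "F ([u] @ (b *s e2 + (- a) *s e3) # w # []) = 0" for w
          using SV_pair_zero[OF F, of u "b *s e2 + (- a) *s e3" "[]" "[w]"] by simp
        then have "dot \<xi> (\<mu> (b *s e2 + (- a) *s e3) w) = 0" for w unfolding \<xi> .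
        from this[of e2] this[of e3] have "\<xi>$1 * (b * a - a * c) = 0" "\<xi>$1 * (b * b - a * d) = 0"
          by (simp_all add: dot_def \<mu>)
        then have "a * (b - c) = 0" "b * b = a * d" using n by (auto simp: algebra_simps)
        then show False using nz by auto
      next
        case False
        then have u3: "u = e3" using u by auto
        have "\<mu> u (d *s e2 + (- c) *s e3) = 0" unfolding u3 by (simp add: \<mu> vec3_eq_iff)
        then have "F ([u] @ (d *s e2 + (- c) *s e3) # w # []) = 0" for w
          using SV_pair_zero[OF F, of u "d *s e2 + (- c) *s e3" "[]" "[w]"] by simp
        then have "dot \<xi> (\<mu> (d *s e2 + (- c) *s e3) w) = 0" for w unfolding \<xi> .
        from this[of e2] this[of e3] have "\<xi>$1 * (d * a - c * c) = 0" "\<xi>$1 * (d * b - c * d) = 0"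
          by (simp_all add: dot_def \<mu>)
        then have "d * (b - c) = 0" "c * c = a * d" using n by (auto simp: algebra_simps)
        then show False using nz by auto
      qed
    qed
    then have z: "F [u, e2, w] = 0" "F [u, e3, w] = 0" for w using \<xi>[of e2 w] \<xi>[of e3 w] by (simp_all add: dot_def \<mu>)
    have "F [u, e1, w] = 0" using SV_pair_zero[OF F k1, of "[]" u "[w]"] by simp
    then show ?thesis using lin_expand[OF SV_lin[OF F, of "[u]" "[w]"], of v] z by simp
  qed
  show "has_dim (SV \<mu> 3) 1"
  proof -
    have "a \<noteq> 0 \<or> b \<noteq> 0" using nz by auto
    then have "\<exists>y\<in>{e2, e3 :: 'k^3}. a * y$2 + b * y$3 \<noteq> 0" by simp
    then obtain y :: "'k^3" where y: "y \<in> {e2, e3}" "a * y$2 + b * y$3 \<noteq> 0" ..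
    let ?f = "\<lambda>u v w :: 'k^3. u$1 * (v$2 * (a * w$2 + b * w$3) + v$3 * (c * w$2 + d * w$3))"
    show ?thesis
    proof (rule has_dim_one_scaled[OF fsub_SV, of "\<lambda>l. if length l = 3 then ?f (l!0) (l!1) (l!2) else 0" _ _ "[e1, e2, y]"])
      show "(\<lambda>l. if length l = 3 then ?f (l!0) (l!1) (l!2) else 0) \<in> SV \<mu> 3"
      proof (rule SV_3I)
        show "\<exists>\<psi>. \<forall>u v. ?f u v w = dot \<psi> (\<mu> u v)" for w
          by (intro exI[of _ "vector [0, a * w$2 + b * w$3, c * w$2 + d * w$3]"]) (simp add: dot_def \<mu> algebra_simps)
        show "\<exists>\<psi>. \<forall>v w. ?f u v w = dot \<psi> (\<mu> v w)" for u
          by (intro exI[of _ "vector [u$1, 0, 0]"]) (simp add: dot_def \<mu>)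
      qed (simp_all add: lin_def algebra_simps)
      show "(if length [e1, e2, y] = 3 then ?f ([e1, e2, y]!0) ([e1, e2, y]!1) ([e1, e2, y]!2) else 0) \<noteq> 0"
        using y(2) by simp
      fix F assume F: "F \<in> SV \<mu> 3" and z: "F [e1, e2, y] = 0"
      obtain \<xi> where \<xi>: "\<And>v w. F ([e1] @ v # w # []) = dot \<xi> (\<mu> v w)" using SV_pair[OF F, of "[e1]" "[]"] by blast
      have "F [e1, e1, w] = 0" for w using SV_pair_zero[OF F k1, of "[]" e1 "[w]"] by simp
      then have "\<xi>$2 = 0" "\<xi>$3 = 0" using \<xi>[of e1 e2] \<xi>[of e1 e3] by (simp_all add: dot_def \<mu>)
      moreover have "\<xi>$1 = 0" using \<xi>[of e2 y] y z by (simp add: dot_def \<mu>)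
      ultimately have e: "F [e1, v, w] = 0" for v w using \<xi>[of v w] by (simp add: dot_def)
      have "F [u, v, w] = 0" for u v w
        using lin_expand[OF SV_lin[OF F, of "[]" "[v, w]"], of u] C[OF F, of e2 v w] C[OF F, of e3 v w] e[of v w] by simp
      then have "F l = 0" if "length l = 3" for l using that by (metis list3_E)
      then show "F = (\<lambda>_. 0)" using SVD(1)[OF F] by blast
    qed
  qed
  show "m \<ge> 4 \<Longrightarrow> has_dim (SV \<mu> m) 0"
  proof (rule has_dim_zero, rule SV_trivial_mono[where m = 4])
    fix F assume F: "F \<in> SV \<mu> 4"
    show "F = (\<lambda>_. 0)"
    proof (rule SV_zero[OF F])
      fix l :: "('k^3) list" assume l: "set l \<subseteq> {e1, e2, e3}" "length l = 4"
      then obtain p q r t where l': "l = [p, q, r, t]" by (auto simp: length_Suc_conv eval_nat_numeral)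
      show "F l = 0"
      proof (cases "p = e1")
        case False
        have "(\<lambda>l. F (l @ [t])) \<in> SV \<mu> 3" by (rule SV_snoc) (use F in \<open>simp add: eval_nat_numeral\<close>)
        from C[OF this, of p q r] show ?thesis using l l' False by auto
      next
        case True
        show ?thesis
        proof (cases "q = e1")
          case q: True
          show ?thesis using SV_pair_zero[OF F k1, of "[]" e1 "[r, t]"] l' True q by simp
        next
          case False
          have "(\<lambda>l. F (e1 # l)) \<in> SV \<mu> 3" by (rule SV_cons) (use F in \<open>simp add: eval_nat_numeral\<close>)
          from C[OF this, of q r t] show ?thesis using l l' False True by auto
        qed
      qed
    qed
  qed auto
qed

subsection \<open>Twisted exterior algebras\<close>

definition cr :: "('k::field)^3 \<Rightarrow> 'k^3 \<Rightarrow> 'k^3" where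
  "cr a b = vector [a$2 * b$3 - a$3 * b$2, a$3 * b$1 - a$1 * b$3, a$1 * b$2 - a$2 * b$1]"

lemma cr_self: "cr a a = 0"
  by (simp add: cr_def vec3_eq_iff mult.commute)

lemma det3_lin: "lin (\<lambda>p. det3 p q r)" "lin (\<lambda>q. det3 p q r)" "lin (\<lambda>r. det3 p q r)"
  by (simp_all add: lin_def det3_def algebra_simps)

text \<open>The cross product is the universal alternating bilinear map in dimension three.
  Alternating is meant in the strong sense \<open>f u u = 0\<close>, which is the right condition
  also in characteristic two.\<close>

lemma alternating_cr:
  assumes "\<And>v. lin (\<lambda>u. f u v)" "\<And>u. lin (f u)" "\<And>u. f u u = 0"
  shows "f u v = dot (vector [f e2 e3, f e3 e1, f e1 e2]) (cr u v)"
proof -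
  have sk: "f a b = - f b a" for a b
  proof -
    have "f (a + b) (a + b) = f a a + f a b + f b a + f b b"
      using linD(1)[OF assms(1)] linD(1)[OF assms(2)] by (simp add: algebra_simps)
    then show ?thesis using assms(3) by (simp add: eq_neg_iff_add_eq_0)
  qed
  have "f u v = u$1 * (v$1 * f e1 e1 + v$2 * f e1 e2 + v$3 * f e1 e3) + u$2 * (v$1 * f e2 e1 + v$2 * f e2 e2 + v$3 * f e2 e3)
    + u$3 * (v$1 * f e3 e1 + v$2 * f e3 e2 + v$3 * f e3 e3)"
    by (subst lin_expand[OF assms(1), of u v], subst (1 2 3) lin_expand[OF assms(2)]) simp
  then show ?thesis
    using sk[of e1 e3] sk[of e2 e1] sk[of e3 e2] by (simp add: assms(3) dot_def cr_def algebra_simps)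
qed

lemma det3_same: "det3 p p r = 0" "det3 p q q = 0" "det3 p q p = 0"
  by (simp_all add: det3_def algebra_simps)

lemma det3_nondegenerate:
  assumes "\<And>q r. det3 p q r = 0"
  shows "p = 0"
  using assms[of e2 e3] assms[of e3 e1] assms[of e1 e2] by (simp add: det3_def vec3_eq_iff)

text \<open>Substituting \<open>\<sigma> (\<sigma> a)\<close>, \<open>\<sigma> b\<close>,
  \<open>c\<close> for the arguments removes the twist: a form of degree 3 becomes alternating in
  both adjacent pairs, hence a multiple of the determinant. In degree 4 the first three and the last
  three arguments would both enter through such determinants, and these are incompatible.\<close>

lemma dim_skew:
  fixes \<mu> :: "('k::field)^3 \<Rightarrow> 'k^3 \<Rightarrow> 'k^3"
  assumes \<mu>: "\<And>u v. \<mu> u v = cr (\<rho> u) v" and \<rho>: "vlin \<rho>" and \<sigma>: "\<And>v. \<rho> (\<sigma> v) = v" "\<And>v. \<sigma> (\<rho> v) = v" "vlin \<sigma>"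
  shows "has_dim (SV \<mu> 3) 1" "m \<ge> 4 \<Longrightarrow> has_dim (SV \<mu> m) 0"
proof -
  let ?f = "\<lambda>u v w. det3 (\<rho> (\<rho> u)) (\<rho> v) w"
  let ?F = "\<lambda>l. if length l = 3 then ?f (l!0) (l!1) (l!2) else 0"
  let ?P = "[\<sigma> (\<sigma> e1), \<sigma> e2, e3]"
  have F0: "?F \<in> SV \<mu> 3"
  proof (rule SV_3I)
    show "lin (\<lambda>u. ?f u v w)" for v w by (rule lin_vlin[OF lin_vlin[OF det3_lin(1) \<rho>] \<rho>])
    show "lin (\<lambda>v. ?f u v w)" for u w by (rule lin_vlin[OF det3_lin(2) \<rho>])
    show "lin (?f u v)" for u v by (rule det3_lin)
    show "\<exists>\<psi>. \<forall>u v. ?f u v w = dot \<psi> (\<mu> u v)" for w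
    proof -
      have "det3 (\<rho> u) (\<rho> v) w = dot (vector [det3 (\<rho> e2) (\<rho> e3) w, det3 (\<rho> e3) (\<rho> e1) w, det3 (\<rho> e1) (\<rho> e2) w]) (cr u v)" for u v
        by (rule alternating_cr) (auto intro: lin_vlin[OF det3_lin(1) \<rho>] lin_vlin[OF det3_lin(2) \<rho>] simp: det3_same)
      then show ?thesis unfolding \<mu> by blast
    qed
    show "\<exists>\<psi>. \<forall>v w. ?f u v w = dot \<psi> (\<mu> v w)" for u
      by (intro exI[of _ "\<rho> (\<rho> u)"]) (simp add: \<mu> det3_def dot_def cr_def algebra_simps)
  qed
  have FP: "?F ?P = 1" by (simp add: \<sigma> det3_def)
  have zero: "F = (\<lambda>_. 0)" if F: "F \<in> SV \<mu> 3" and z: "F ?P = 0" for F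
  proof -
    define G where "G = (\<lambda>a b c. F [\<sigma> (\<sigma> a), \<sigma> b, c])"
    have l: "lin (\<lambda>a. G a b c)" "lin (\<lambda>b. G a b c)" "lin (\<lambda>c. G a b c)" for a b c
      unfolding G_def
      using lin_vlin[OF lin_vlin[OF SV_lin[OF F, of "[]" "[\<sigma> b, c]"] \<sigma>(3)] \<sigma>(3)]
        lin_vlin[OF SV_lin[OF F, of "[\<sigma> (\<sigma> a)]" "[c]"] \<sigma>(3)] SV_lin[OF F, of "[\<sigma> (\<sigma> a), \<sigma> b]" "[]"] by simp_all
    have a1: "G a a c = 0" for a c
      using SV_pair_zero[OF F, of "\<sigma> (\<sigma> a)" "\<sigma> a" "[]" "[c]"] by (simp add: G_def \<mu> \<sigma> cr_self)
    have a2: "G a b b = 0" for a b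
      using SV_pair_zero[OF F, of "\<sigma> b" "b" "[\<sigma> (\<sigma> a)]" "[]"] by (simp add: G_def \<mu> \<sigma> cr_self)
    have G1: "G a b c = dot (vector [G e2 e3 c, G e3 e1 c, G e1 e2 c]) (cr a b)" for a b c
      by (rule alternating_cr[where f = "\<lambda>a b. G a b c", OF l(1) l(2) a1])
    have G2: "G a b c = dot (vector [G a e2 e3, G a e3 e1, G a e1 e2]) (cr b c)" for a b c
      by (rule alternating_cr[where f = "G a", OF l(2) l(3) a2])
    have z1: "G e1 e2 e3 = 0" using z by (simp add: G_def)
    have z2: "G e2 e3 e1 = 0" "G e3 e1 e2 = 0"
    proof -
      have "G e2 e3 e1 = - G e2 e1 e3" by (subst (1 2) G2) (simp add: dot_def cr_def)
      also have "G e2 e1 e3 = - G e1 e2 e3" by (subst (1 2) G1) (simp add: dot_def cr_def)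
      finally show *: "G e2 e3 e1 = 0" using z1 by simp
      have "G e3 e1 e2 = - G e3 e2 e1" by (subst (1 2) G2) (simp add: dot_def cr_def)
      also have "G e3 e2 e1 = - G e2 e3 e1" by (subst (1 2) G1) (simp add: dot_def cr_def)
      finally show "G e3 e1 e2 = 0" using * by simp
    qed
    have "G e1 e2 c = 0" "G e2 e3 c = 0" "G e3 e1 c = 0" for c
    proof -
      have "G e1 e2 e1 = 0" "G e2 e3 e2 = 0" "G e3 e1 e3 = 0"
        using G2[of e1 e2 e1] G2[of e2 e3 e2] G2[of e3 e1 e3] a1[of e1 e2] a1[of e2 e3] a1[of e3 e1]
        by (simp_all add: dot_def cr_def)
      then show "G e1 e2 c = 0" "G e2 e3 c = 0" "G e3 e1 c = 0"
        using z1 z2 a2[of e1 e2] a2[of e2 e3] a2[of e3 e1]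
          lin_expand[OF l(3), of e1 e2 c] lin_expand[OF l(3), of e2 e3 c] lin_expand[OF l(3), of e3 e1 c] by simp_all
    qed
    then have "G a b c = 0" for a b c using G1[of a b c] by (simp add: dot_def)
    then have "F [u, v, w] = 0" for u v w
      using \<sigma>(2) unfolding G_def by metis
    then have "F l = 0" if "length l = 3" for l using that by (metis list3_E)
    then show "F = (\<lambda>_. 0)" using SVD(1)[OF F] by blast
  qed
  show "has_dim (SV \<mu> 3) 1" by (rule has_dim_one[OF F0 FP zero])
  have propor: "F l = F ?P * ?F l" if F: "F \<in> SV \<mu> 3" for F l
  proof -
    have "(\<lambda>l. F l - F ?P * ?F l) = (\<lambda>_. 0)"
      by (rule zero[OF fsub_diff[OF fsub_SV F fsub_SV_scale[OF F0]]]) (use FP in simp)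
    from fun_cong[OF this, of l] show ?thesis by simp
  qed
  have r0: "\<rho> v = 0 \<Longrightarrow> v = 0" for v using \<sigma>(2)[of v] vlinD(3)[OF \<sigma>(3)] by simp
  show "m \<ge> 4 \<Longrightarrow> has_dim (SV \<mu> m) 0"
  proof (rule has_dim_zero, rule SV_trivial_mono[where m = 4])
    fix F assume F: "F \<in> SV \<mu> 4"
    have l: "(\<lambda>l. F (a # l)) \<in> SV \<mu> 3" and r: "(\<lambda>l. F (l @ [a])) \<in> SV \<mu> 3" for a
      by (rule SV_cons, use F in \<open>simp add: eval_nat_numeral\<close>) (rule SV_snoc, use F in \<open>simp add: eval_nat_numeral\<close>)
    have eq: "F (a # ?P) * ?f b c d = F (?P @ [d]) * ?f a b c" for a b c d
      using propor[OF l, of a "[b, c, d]"] propor[OF r, of "[a, b, c]" d] by simp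
    have L: "F (a # ?P) = 0" for a
    proof (rule ccontr)
      assume n: "F (a # ?P) \<noteq> 0"
      \<comment> \<open>The choice \<open>b = \<rho> a\<close> gives the determinant in the first
        three arguments two equal columns, while the one in the last three is nondegenerate.\<close>
      have "F (a # ?P) * ?f (\<rho> a) c d = 0" for c d unfolding eq by (simp add: det3_same)
      then have "?f (\<rho> a) c d = 0" for c d using n by simp
      then have "det3 (\<rho> (\<rho> (\<rho> a))) q r = 0" for q r using \<sigma>(1)[of q] by metis
      then have "\<rho> (\<rho> (\<rho> a)) = 0" by (rule det3_nondegenerate)
      then have "a = 0" using r0 by blast
      then show False using n linD(3)[OF SV_lin[OF F, of "[]" ?P]] by simp
    qed
    have "F (a # s) = 0" for a s using propor[OF l, of a s] L by simp
    moreover have "F [] = 0" using SVD(1)[OF F] by simp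
    ultimately show "F = (\<lambda>_. 0)" by (metis ext list.exhaust)
  qed auto
qed

subsection \<open>Two generators and one relation\<close>

text \<open>If \<open>e1\<close> is annihilated from both sides, then in degrees at least 2 the
  algebra is one on the generators \<open>e2\<close> and \<open>e3\<close>. Requiring that
  \<open>e1\<close> never occurs gives the forms of that smaller algebra in degrees 0 and 1 as well,
  where inductions can start with the dimensions 1 and 2.\<close>

definition reduced :: "(('k::field)^3 \<Rightarrow> 'k^3 \<Rightarrow> 'k^3) \<Rightarrow> nat \<Rightarrow> (('k^3) list \<Rightarrow> 'k) set" where
  "reduced \<mu> m = {F \<in> SV \<mu> m. \<forall>p s. F (p @ e1 # s) = 0}"

lemma reducedD:
  assumes "F \<in> reduced \<mu> m"
  shows "F \<in> SV \<mu> m" "F (p @ e1 # s) = 0"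
  using assms by (simp_all add: reduced_def)

lemma reduced_eq_SV:
  assumes "\<And>u. \<mu> u e1 = 0" "\<And>u. \<mu> e1 u = 0" "m \<ge> 2"
  shows "reduced \<mu> m = SV \<mu> m"
proof -
  have "F (p @ e1 # s) = 0" if F: "F \<in> SV \<mu> m" for F p s
  proof (cases s)
    case (Cons a s')
    then show ?thesis using SV_pair_zero[OF F assms(2), of p a s'] by simp
  next
    case Nil
    show ?thesis
    proof (cases p rule: rev_cases)
      case Nil
      then show ?thesis using \<open>s = []\<close> SVD(1)[OF F, of "[e1]"] assms(3) by simp
    next
      case (snoc p' a)
      then show ?thesis using \<open>s = []\<close> SV_pair_zero[OF F assms(1), of p' a "[]"] by simp
    qed
  qed
  then show ?thesis by (auto simp: reduced_def)
qed

lemma reduced_cons: "F \<in> reduced \<mu> (Suc m) \<Longrightarrow> (\<lambda>l. F (v # l)) \<in> reduced \<mu> m"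
  unfolding reduced_def using SV_cons[of F \<mu> m v] by (auto simp flip: append_Cons)

lemma reduced_comb: "F \<in> reduced \<mu> m \<Longrightarrow> G \<in> reduced \<mu> m \<Longrightarrow> (\<lambda>l. a * F l + b * G l) \<in> reduced \<mu> m"
  unfolding reduced_def
  using fsubD(2)[OF fsub_SV fsubD(3)[OF fsub_SV, of F \<mu> m a] fsubD(3)[OF fsub_SV, of G \<mu> m b]] by auto

lemma reduced_expand:
  assumes "F \<in> reduced \<mu> m"
  shows "F (v # s) = v$2 * F (e2 # s) + v$3 * F (e3 # s)"
  using SV_expand_head[OF reducedD(1)[OF assms], of v s] reducedD(2)[OF assms, of "[]" s] by simp

lemma has_dim_reduced_0: "has_dim (reduced \<mu> 0) 1"
proof (rule has_dim_one[of "\<lambda>l. if l = [] then 1 else 0" _ "[]"])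
  have "(\<lambda>l. if l = [] then 1 else 0) \<in> SV \<mu> 0" by (rule SVI) auto
  then show "(\<lambda>l. if l = [] then 1 else 0) \<in> reduced \<mu> 0" by (simp add: reduced_def)
  fix f assume f: "f \<in> reduced \<mu> 0" "f [] = 0"
  then have "f l = 0" for l using SVD(1)[OF reducedD(1)[OF f(1)], of l] by (cases l) auto
  then show "f = (\<lambda>_. 0)" by auto
qed simp

definition cons_form :: "(('k::field)^3 \<Rightarrow> ('k^3) list \<Rightarrow> 'k) \<Rightarrow> ('k^3) list \<Rightarrow> 'k" where
  "cons_form f l = (case l of [] \<Rightarrow> 0 | v # s \<Rightarrow> f v s)"

lemma cons_form_simps [simp]: "cons_form f [] = 0" "cons_form f (v # s) = f v s"
  by (simp_all add: cons_form_def)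

lemma reduced_consI:
  assumes "\<And>v. f v \<in> reduced \<mu> m" "\<And>s. lin (\<lambda>v. f v s)" "\<And>s. f e1 s = 0"
    and "\<And>s. Suc (length s) = m \<Longrightarrow> \<exists>\<psi>. \<forall>u v. f u (v # s) = dot \<psi> (\<mu> u v)"
  shows "cons_form f \<in> reduced \<mu> (Suc m)"
  unfolding reduced_def
proof (intro CollectI conjI allI)
  show "cons_form f \<in> SV \<mu> (Suc m)"
    by (rule SV_consI) (use assms reducedD(1)[OF assms(1)] in simp_all)
  show "cons_form f (p @ e1 # s) = 0" for p s
    using assms(3) reducedD(2)[OF assms(1)] by (cases p) simp_all
qed

text \<open>The relation is \<open>e2 e3 = \<alpha> e3 e2 + \<beta> e3 e3\<close>, by which every
  \<open>e3\<close> can be moved to the front. Dually, the slice of a form at \<open>e3\<close> and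
  its value at \<open>e2 ... e2\<close> are free: the relation fixes the slice at \<open>e2\<close>
  on words beginning with \<open>e3\<close>, and induction supplies such a slice.\<close>

lemma reduced_ext:
  fixes \<mu> :: "('k::field)^3 \<Rightarrow> 'k^3 \<Rightarrow> 'k^3"
  assumes \<mu>: "\<And>u v. \<mu> u v = vector [u$3 * v$2 + \<alpha> * (u$2 * v$3), u$3 * v$3 + \<beta> * (u$2 * v$3), u$2 * v$2]"
    and "G \<in> reduced \<mu> m"
  shows "\<exists>F\<in>reduced \<mu> (Suc m). (\<forall>l. F (e3 # l) = G l) \<and> F (replicate (Suc m) e2) = c"
  using assms(2)
proof (induction m arbitrary: G c)
  case 0
  have I: "(\<lambda>l. if l = [] then 1 else 0) \<in> reduced \<mu> 0"
    unfolding reduced_def using SVI[of 0 "\<lambda>l. if l = [] then 1 else 0" \<mu>] by auto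
  have "cons_form (\<lambda>v l. v$3 * G l + (c * v$2) * (if l = [] then 1 else 0)) \<in> reduced \<mu> (Suc 0)"
  proof (rule reduced_consI)
    show "(\<lambda>l. v$3 * G l + (c * v$2) * (if l = [] then 1 else 0)) \<in> reduced \<mu> 0" for v
      by (intro reduced_comb 0 I)
  qed (simp_all add: lin_def algebra_simps)
  then show ?case by (rule bexI[rotated]) simp
next
  case (Suc m)
  have "(\<lambda>s. \<alpha> * G (e2 # s) + \<beta> * G (e3 # s)) \<in> reduced \<mu> m"
    by (intro reduced_comb reduced_cons Suc.prems)
  from Suc.IH[OF this] obtain H where H: "H \<in> reduced \<mu> (Suc m)" "\<And>s. H (e3 # s) = \<alpha> * G (e2 # s) + \<beta> * G (e3 # s)"
    "H (replicate (Suc m) e2) = c" by blast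
  have "cons_form (\<lambda>v l. v$3 * G l + v$2 * H l) \<in> reduced \<mu> (Suc (Suc m))"
  proof (rule reduced_consI)
    show "(\<lambda>l. v$3 * G l + v$2 * H l) \<in> reduced \<mu> (Suc m)" for v by (intro reduced_comb Suc.prems H)
    show "\<exists>\<psi>. \<forall>u v. u$3 * G (v # s) + u$2 * H (v # s) = dot \<psi> (\<mu> u v)" for s
    proof (intro exI allI)
      fix u v
      show "u$3 * G (v # s) + u$2 * H (v # s) = dot (vector [G (e2 # s), G (e3 # s), H (e2 # s)]) (\<mu> u v)"
        unfolding reduced_expand[OF Suc.prems, of v] reduced_expand[OF H(1), of v] H(2)
        by (simp add: dot_def \<mu> algebra_simps)
    qed
  qed (simp_all add: lin_def algebra_simps)
  then show ?case by (rule bexI[rotated]) (use H(3) in simp)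
qed

lemma reduced_determined:
  fixes \<mu> :: "('k::field)^3 \<Rightarrow> 'k^3 \<Rightarrow> 'k^3"
  assumes \<mu>: "\<And>u v. \<mu> u v = vector [u$3 * v$2 + \<alpha> * (u$2 * v$3), u$3 * v$3 + \<beta> * (u$2 * v$3), u$2 * v$2]"
    and "F \<in> reduced \<mu> m" "\<And>l. F (e3 # l) = 0" "F (replicate m e2) = 0"
  shows "F = (\<lambda>_. 0)"
  using assms(2-)
proof (induction m arbitrary: F)
  case 0
  then have "F l = 0" for l using SVD(1)[OF reducedD(1)[OF 0(1)], of l] by (cases l) auto
  then show ?case by auto
next
  case (Suc m)
  have y: "(\<lambda>l. F (e2 # l)) = (\<lambda>_. 0)"
  proof (rule Suc.IH[OF reduced_cons[OF Suc.prems(1)]])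
    show "F (e2 # e3 # l) = 0" for l
    proof -
      obtain \<psi> where \<psi>: "\<And>u v. F ([] @ u # v # l) = dot \<psi> (\<mu> u v)"
        using SV_pair[OF reducedD(1)[OF Suc.prems(1)], of "[]" l] by blast
      have "\<psi>$1 = 0" "\<psi>$2 = 0" using \<psi>[of e3 e2] \<psi>[of e3 e3] Suc.prems(2) by (simp_all add: dot_def \<mu>)
      then show ?thesis using \<psi>[of e2 e3] by (simp add: dot_def \<mu>)
    qed
  qed (use Suc.prems(3) in simp)
  have "F (v # l) = 0" for v l
    using reduced_expand[OF Suc.prems(1), of v l] Suc.prems(2) fun_cong[OF y, of l] by simp
  moreover have "F [] = 0" using SVD(1)[OF reducedD(1)[OF Suc.prems(1)]] by simp
  ultimately show ?case by (metis ext list.exhaust)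
qed

text \<open>Each degree adds one dimension: the slice at \<open>e3\<close> is an arbitrary form of
  the previous degree, and the value at \<open>e2 ... e2\<close> is one further parameter.\<close>

lemma has_dim_reduced_plane:
  fixes \<mu> :: "('k::field)^3 \<Rightarrow> 'k^3 \<Rightarrow> 'k^3"
  assumes \<mu>: "\<And>u v. \<mu> u v = vector [u$3 * v$2 + \<alpha> * (u$2 * v$3), u$3 * v$3 + \<beta> * (u$2 * v$3), u$2 * v$2]"
  shows "has_dim (reduced \<mu> m) (Suc m)"
proof (induction m)
  case 0
  then show ?case using has_dim_reduced_0 by simp
next
  case (Suc m)
  then obtain F P where *: "dual_system (reduced \<mu> m) (Suc m) F P" unfolding has_dim_def by blast
  note ex = reduced_ext[OF \<mu>]
  have "\<forall>i. \<exists>H. i < Suc m \<longrightarrow> H \<in> reduced \<mu> (Suc m) \<and> (\<forall>l. H (e3 # l) = F i l) \<and> H (replicate (Suc m) e2) = 0"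
    using ex[OF dual_systemD(1)[OF *]] by blast
  then obtain H where H: "\<And>i. i < Suc m \<Longrightarrow> H i \<in> reduced \<mu> (Suc m)" "\<And>i l. i < Suc m \<Longrightarrow> H i (e3 # l) = F i l"
    "\<And>i. i < Suc m \<Longrightarrow> H i (replicate (Suc m) e2) = 0" by metis
  have "(\<lambda>_. 0) \<in> reduced \<mu> m" using fsubD(1)[OF fsub_SV] by (simp add: reduced_def)
  from ex[OF this, of 1] obtain K where K: "K \<in> reduced \<mu> (Suc m)" "\<And>l. K (e3 # l) = 0" "K (replicate (Suc m) e2) = 1" by blast
  show ?case
  proof (rule has_dimI[of _ "\<lambda>i. if i = Suc m then K else H i" _ "\<lambda>i. if i = Suc m then replicate (Suc m) e2 else e3 # P i"])
    show "(if i = Suc m then K else H i) \<in> reduced \<mu> (Suc m)" if "i < Suc (Suc m)" for i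
      using that H(1)[of i] K(1) by (cases "i = Suc m") auto
    show "(if i = Suc m then K else H i) (if j = Suc m then replicate (Suc m) e2 else e3 # P j) = (if i = j then 1 else 0)"
      if "i < Suc (Suc m)" "j < Suc (Suc m)" for i j
      using that H(2,3)[of i] K(2,3) dual_systemD(2)[OF *, of i j] by (cases "i = Suc m"; cases "j = Suc m") auto
    fix f assume f: "f \<in> reduced \<mu> (Suc m)" and z: "\<And>i. i < Suc (Suc m) \<Longrightarrow> f (if i = Suc m then replicate (Suc m) e2 else e3 # P i) = 0"
    have "(\<lambda>l. f (e3 # l)) = (\<lambda>_. 0)"
    proof (rule dual_systemD(3)[OF * reduced_cons[OF f]])
      show "f (e3 # P i) = 0" if "i < Suc m" for i using z[of i] that by simp
    qed
    then have "f (e3 # l) = 0" for l by (rule fun_cong)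
    then show "f = (\<lambda>_. 0)" by (rule reduced_determined[OF \<mu> f]) (use z[of "Suc m"] in simp)
  qed
qed

lemma dim_plane:
  fixes \<mu> :: "('k::field)^3 \<Rightarrow> 'k^3 \<Rightarrow> 'k^3"
  assumes \<mu>: "\<And>u v. \<mu> u v = vector [u$3 * v$2 + \<alpha> * (u$2 * v$3), u$3 * v$3 + \<beta> * (u$2 * v$3), u$2 * v$2]" and "m \<ge> 2"
  shows "has_dim (SV \<mu> m) (m + 1)"
proof -
  have "\<mu> u e1 = 0" "\<mu> e1 u = 0" for u by (simp_all add: \<mu> vec3_eq_iff)
  then show ?thesis using has_dim_reduced_plane[OF \<mu>, of m] reduced_eq_SV[OF _ _ assms(2), of \<mu>] by simp
qed

fun fib_dim :: "nat \<Rightarrow> nat" where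
  "fib_dim 0 = 1" | "fib_dim (Suc 0) = 2" | "fib_dim (Suc (Suc n)) = fib_dim (Suc n) + fib_dim n"

lemma has_dim_reduced_1: "has_dim (reduced \<mu> (Suc 0)) 2"
proof -
  have mem: "(\<lambda>l. if length l = 1 then hd l $ i else 0) \<in> reduced \<mu> (Suc 0)" if "i \<in> {2, 3}" for i
  proof -
    have "(if length (p @ e1 # s) = 1 then hd (p @ e1 # s) $ i else 0) = 0" for p s
      using that by (cases p) auto
    moreover have "e1 $ i = (0 :: 'a)" using that by auto
    ultimately show ?thesis using SV_1I[OF lin_nth, of i \<mu>] by (simp add: reduced_def)
  qed
  show ?thesis
  proof (rule has_dim_two[OF mem[of 2] mem[of 3], of "[e2]" "[e3]"])
    fix f assume f: "f \<in> reduced \<mu> (Suc 0)" "f [e2] = 0" "f [e3] = 0"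
    have "f l = 0" for l
    proof (cases "length l = 1")
      case True
      then obtain v where "l = [v]" by (auto simp: length_Suc_conv)
      then show ?thesis using reduced_expand[OF f(1), of v "[]"] f by simp
    qed (use SVD(1)[OF reducedD(1)[OF f(1)]] in simp)
    then show "f = (\<lambda>_. 0)" by auto
  qed auto
qed

text \<open>The relation is \<open>e2 e2 = 0\<close>, and the words without adjacent
  \<open>e2\<close> form a basis. Such a word begins with \<open>e3\<close> followed by any such
  word, or with \<open>e2 e3\<close> followed by any such word; the two kinds account for
  \<open>a\<close> and \<open>b\<close>.\<close>

lemma has_dim_reduced_fib_step:
  fixes \<mu> :: "('k::field)^3 \<Rightarrow> 'k^3 \<Rightarrow> 'k^3"
  assumes \<mu>: "\<And>u v. \<mu> u v = vector [u$2 * v$3, u$3 * v$2, u$3 * v$3]"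
    and "has_dim (reduced \<mu> (Suc m)) a" "has_dim (reduced \<mu> m) b"
  shows "has_dim (reduced \<mu> (Suc (Suc m))) (a + b)"
proof -
  obtain F P where F: "dual_system (reduced \<mu> (Suc m)) a F P" using assms(2) unfolding has_dim_def by blast
  obtain G R where G: "dual_system (reduced \<mu> m) b G R" using assms(3) unfolding has_dim_def by blast
  have y: "\<mu> e2 e2 = 0" by (simp add: \<mu> vec3_eq_iff)
  have left: "cons_form (\<lambda>v l. v$3 * H l) \<in> reduced \<mu> (Suc n)" if H: "H \<in> reduced \<mu> n" for H n
  proof (rule reduced_consI)
    show "(\<lambda>l. v$3 * H l) \<in> reduced \<mu> n" for v :: "'k^3" using reduced_comb[OF H H, of "v$3" 0] by simp
    show "\<exists>\<psi>. \<forall>u v. u$3 * H (v # s) = dot \<psi> (\<mu> u v)" for s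
    proof (intro exI allI)
      fix u v
      show "u$3 * H (v # s) = dot (vector [0, H (e2 # s), H (e3 # s)]) (\<mu> u v)"
        unfolding reduced_expand[OF H, of v] by (simp add: dot_def \<mu> algebra_simps)
    qed
  qed (simp_all add: lin_def algebra_simps)
  \<comment> \<open>The form dual to prefixing \<open>e2 e3\<close>. Its head pair enters only
    through \<open>e2 e3\<close>, so the slices need no correction.\<close>
  define K :: "(('k^3) list \<Rightarrow> 'k) \<Rightarrow> ('k^3) list \<Rightarrow> 'k" where "K = (\<lambda>H. cons_form (\<lambda>v. (\<lambda>l. v$2 * cons_form (\<lambda>w l. w$3 * H l) l)))"
  have right: "K H \<in> reduced \<mu> (Suc (Suc m))" if H: "H \<in> reduced \<mu> m" for H
    unfolding K_def
  proof (rule reduced_consI)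
    show "(\<lambda>l. v$2 * cons_form (\<lambda>w l. w$3 * H l) l) \<in> reduced \<mu> (Suc m)" for v :: "'k^3"
      using reduced_comb[OF left[OF H] left[OF H], of "v$2" 0] by simp
    show "\<exists>\<psi>. \<forall>u v. u$2 * cons_form (\<lambda>w l. w$3 * H l) (v # s) = dot \<psi> (\<mu> u v)" for s
      by (intro exI[of _ "vector [H s, 0, 0]"]) (simp add: dot_def \<mu>)
  qed (simp_all add: lin_def algebra_simps)
  show ?thesis
  proof (rule has_dimI[of _ "\<lambda>i. if i < a then cons_form (\<lambda>v l. v$3 * F i l) else K (G (i - a))" _
        "\<lambda>i. if i < a then e3 # P i else e2 # e3 # R (i - a)"])
    show "(if i < a then cons_form (\<lambda>v l. v$3 * F i l) else K (G (i - a))) \<in> reduced \<mu> (Suc (Suc m))" if "i < a + b" for i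
      using left[OF dual_systemD(1)[OF F, of i]] right[OF dual_systemD(1)[OF G, of "i - a"]] that by auto
    show "(if i < a then cons_form (\<lambda>v l. v$3 * F i l) else K (G (i - a))) (if j < a then e3 # P j else e2 # e3 # R (j - a))
        = (if i = j then 1 else 0)" if "i < a + b" "j < a + b" for i j
      using dual_systemD(2)[OF F, of i j] dual_systemD(2)[OF G, of "i - a" "j - a"] that
      by (cases "i < a"; cases "j < a") (auto simp: K_def)
    fix f assume f: "f \<in> reduced \<mu> (Suc (Suc m))"
      and z: "\<And>i. i < a + b \<Longrightarrow> f (if i < a then e3 # P i else e2 # e3 # R (i - a)) = 0"
    have "(\<lambda>l. f (e3 # l)) = (\<lambda>_. 0)"
    proof (rule dual_systemD(3)[OF F reduced_cons[OF f]])
      show "f (e3 # P i) = 0" if "i < a" for i using z[of i] that by simp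
    qed
    then have 3: "f (e3 # l) = 0" for l by (rule fun_cong)
    have "(\<lambda>l. f (e2 # e3 # l)) = (\<lambda>_. 0)"
    proof (rule dual_systemD(3)[OF G reduced_cons[OF reduced_cons[OF f]]])
      show "f (e2 # e3 # R i) = 0" if "i < b" for i using z[of "a + i"] that by simp
    qed
    then have 23: "f (e2 # e3 # l) = 0" for l by (rule fun_cong)
    have 22: "f (e2 # e2 # l) = 0" for l using SV_pair_zero[OF reducedD(1)[OF f] y, of "[]" l] by simp
    have 2: "f (e2 # l) = 0" for l
    proof (cases l)
      case Nil
      then show ?thesis using SVD(1)[OF reducedD(1)[OF f]] by simp
    next
      case (Cons v s)
      then show ?thesis using reduced_expand[OF reduced_cons[OF f, of e2], of v s] 22 23 by simp
    qed
    have "f (v # l) = 0" for v l using reduced_expand[OF f, of v l] 2 3 by simp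
    moreover have "f [] = 0" using SVD(1)[OF reducedD(1)[OF f]] by simp
    ultimately show "f = (\<lambda>_. 0)" by (metis ext list.exhaust)
  qed
qed

lemma dim_fib:
  fixes \<mu> :: "('k::field)^3 \<Rightarrow> 'k^3 \<Rightarrow> 'k^3"
  assumes \<mu>: "\<And>u v. \<mu> u v = vector [u$2 * v$3, u$3 * v$2, u$3 * v$3]" and "m \<ge> 2"
  shows "has_dim (SV \<mu> m) (fib_dim m)"
proof -
  have "has_dim (reduced \<mu> m) (fib_dim m)"
    by (induction m rule: fib_dim.induct)
      (use has_dim_reduced_0 has_dim_reduced_1 has_dim_reduced_fib_step[OF \<mu>] in auto)
  moreover have "\<mu> u e1 = 0" "\<mu> e1 u = 0" for u by (simp_all add: \<mu> vec3_eq_iff)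
  ultimately show ?thesis using reduced_eq_SV[OF _ _ assms(2), of \<mu>] by simp
qed

subsection \<open>Classification over algebraically closed fields\<close>

text \<open>Over a finite field the product of all linear factors \<open>X - a\<close>, increased by
  1, has no root.\<close>

lemma infinite_alg_closed: "infinite (UNIV :: 'k::alg_closed_field set)"
proof
  assume fin: "finite (UNIV :: 'k set)"
  define p where "p = (\<Prod>a\<in>(UNIV :: 'k set). [:- a, 1:])"
  have "degree p = card (UNIV :: 'k set)" unfolding p_def by (subst degree_prod_eq_sum_degree) auto
  then have dp: "degree p > 0" using fin by (simp add: card_gt_0_iff)
  then have "degree (p + 1) > 0" by (subst degree_add_eq_left) auto
  then obtain x where "poly (p + 1) x = 0" using alg_closed_imp_poly_has_root by blast
  moreover have "poly p x = 0" unfolding p_def poly_prod using fin by (intro prod_zero) auto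
  ultimately show False by simp
qed

lemma quadratic_root:
  fixes a b c :: "'k::alg_closed_field"
  assumes "a \<noteq> 0"
  obtains t where "a * t * t + b * t + c = 0"
proof -
  have "degree [:c, b, a:] > 0" using assms by simp
  then obtain t where "poly [:c, b, a:] t = 0" using alg_closed_imp_poly_has_root by blast
  then show ?thesis by (intro that[of t]) (simp add: algebra_simps)
qed

text \<open>If the matrix were invertible, its columns \<open>q\<close> and \<open>r\<close> would
  be completed by some \<open>w\<close> to a nonzero determinant; but \<open>w\<close> lies in the
  image, and Cramer's rule makes that determinant zero.\<close>

lemma det3_eq_0_imp_singular:
  assumes "det3 p q r = 0"
  shows "singular (lc3 p q r)"
proof (rule ccontr)
  assume n: "\<not> singular (lc3 p q r)"
  then obtain g where g: "\<And>v. lc3 p q r (g v) = v" using vlin_nonsingular_inverse[OF vlin_lc3] by metis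
  have "indep2 q r"
    unfolding indep2_def
  proof (intro allI impI)
    fix a b assume "a *s q + b *s r = 0"
    then have "lc3 p q r (vector [0, a, b]) = 0" by (simp add: lc3_def)
    then have "vector [0, a, b] = (0 :: 'a^3)" using n unfolding singular_def by blast
    then show "a = 0 \<and> b = 0" by (simp add: vec3_eq_iff)
  qed
  then obtain w where "det3 q r w \<noteq> 0" by (rule indep2_complete)
  moreover have "det3 q r w = det3 w q r" by (simp add: det3_def algebra_simps)
  moreover have "det3 w q r = 0" using det3_lc3(1)[of p q r "g w"] g[of w] assms by simp
  ultimately show False by simp
qed

text \<open>A kernel vector of the transposed matrix.\<close>

lemma det3_eq_0_functional:
  assumes "det3 p q r = 0"
  obtains \<psi> where "\<psi> \<noteq> 0" "dot \<psi> p = 0" "dot \<psi> q = 0" "dot \<psi> r = 0"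
proof -
  have "det3 (vector [p$1, q$1, r$1]) (vector [p$2, q$2, r$2]) (vector [p$3, q$3, r$3]) = 0"
    using assms by (simp add: det3_def algebra_simps)
  from det3_eq_0_imp_singular[OF this] obtain x where x: "x \<noteq> 0"
    "lc3 (vector [p$1, q$1, r$1]) (vector [p$2, q$2, r$2]) (vector [p$3, q$3, r$3]) x = 0"
    unfolding singular_def by blast
  then show ?thesis by (intro that[of x]) (simp_all add: lc3_def dot_def vec3_eq_iff)
qed

lemma lc3_basis_inverse:
  assumes "det3 x y z \<noteq> 0"
  obtains g where "vlin g" "\<And>v. lc3 x y z (g v) = v" "\<And>v. g (lc3 x y z v) = v"
  using vlin_nonsingular_inverse[OF vlin_lc3 nonsingular_lc3[OF assms]] by blast

text \<open>All values of \<open>\<mu>\<close> lie in the span of \<open>p\<close>,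
  \<open>q\<close>, \<open>r\<close>, so these are a basis of the target by \<open>spanning\<close>.
  A normal form is thus reached by a basis of the source and a multiplication table alone.\<close>

lemma normal_form:
  assumes bil: "bil \<mu>" and sp: "spanning \<mu>" and b: "det3 x y z \<noteq> 0"
    and eq: "\<And>u v. \<mu> (lc3 x y z u) (lc3 x y z v) = lc3 p q r (\<nu> u v)"
    and d: "has_dim (SV \<mu> m) k"
  shows "has_dim (SV \<nu> m) k"
proof -
  obtain g where g: "vlin g" "\<And>v. lc3 x y z (g v) = v" "\<And>v. g (lc3 x y z v) = v" using lc3_basis_inverse[OF b] by blast
  have "det3 p q r \<noteq> 0"
  proof
    assume "det3 p q r = 0"
    then obtain \<psi> where \<psi>: "\<psi> \<noteq> 0" "dot \<psi> p = 0" "dot \<psi> q = 0" "dot \<psi> r = 0" by (rule det3_eq_0_functional)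
    have "dot \<psi> (\<mu> u v) = 0" for u v
    proof -
      have "dot \<psi> (lc3 p q r w) = w$1 * dot \<psi> p + w$2 * dot \<psi> q + w$3 * dot \<psi> r" for w
        by (simp add: lc3_def dot_def algebra_simps)
      moreover have "\<mu> u v = lc3 p q r (\<nu> (g u) (g v))" using eq[of "g u" "g v"] unfolding g(2) .
      ultimately show ?thesis using \<psi> by simp
    qed
    then show False using \<psi>(1) sp unfolding spanning_def by blast
  qed
  then obtain h where h: "vlin h" "\<And>v. lc3 p q r (h v) = v" "\<And>v. h (lc3 p q r v) = v" using lc3_basis_inverse by blast
  show ?thesis
  proof (rule has_dim_SV_change[OF vlin_lc3 g(1) g(2) g(3) h(1) vlin_lc3 h(3) h(2) _ d])
    show "\<nu> u v = h (\<mu> (lc3 x y z u) (lc3 x y z v))" for u v unfolding eq h(3) ..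
  qed
qed

lemma bil_lc3:
  assumes "bil \<mu>"
  shows "\<mu> (lc3 x y z u) (lc3 x y z v) =
    (u$1 * v$1) *s \<mu> x x + (u$1 * v$2) *s \<mu> x y + (u$1 * v$3) *s \<mu> x z +
    (u$2 * v$1) *s \<mu> y x + (u$2 * v$2) *s \<mu> y y + (u$2 * v$3) *s \<mu> y z +
    (u$3 * v$1) *s \<mu> z x + (u$3 * v$2) *s \<mu> z y + (u$3 * v$3) *s \<mu> z z"
  by (simp add: lc3_def bilD[OF assms] vec3_eq_iff algebra_simps)

lemma bil_op: "bil \<mu> \<Longrightarrow> bil (\<lambda>u v. \<mu> v u)"
  by (simp add: bil_def)

lemma spanning_op: "spanning \<mu> \<Longrightarrow> spanning (\<lambda>u v. \<mu> v u)"
  unfolding spanning_def by blast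

text \<open>The sequence \<open>d\<close> is a parameter of its own, so that the opposite
  multiplication is an instance of the same locale with the same \<open>d\<close>. A result and its
  mirror image then have one conclusion.\<close>

locale quadratic_dims =
  fixes \<mu> :: "('k::alg_closed_field)^3 \<Rightarrow> 'k^3 \<Rightarrow> 'k^3" and d :: "nat \<Rightarrow> nat"
  assumes bil: "bil \<mu>" and sp: "spanning \<mu>" and hd: "\<And>m. has_dim (SV \<mu> m) (d m)"

lemma quadratic_dims_op: "quadratic_dims \<mu> d \<Longrightarrow> quadratic_dims (\<lambda>u v. \<mu> v u) d"
  unfolding quadratic_dims_def using bil_op spanning_op has_dim_SV_rev by blast

context quadratic_dims
begin

lemma dims_eq:
  assumes "det3 x y z \<noteq> 0" "\<And>u v. \<mu> (lc3 x y z u) (lc3 x y z v) = lc3 p q r (\<nu> u v)" "has_dim (SV \<nu> m) k"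
  shows "d m = k"
  using has_dim_unique[OF fsub_SV normal_form[OF bil sp assms(1,2) hd] assms(3)] .

text \<open>After the twist \<open>\<mu>\<close> is alternating and factors through the cross
  product, with \<open>?p\<close>, \<open>?q\<close>, \<open>?r\<close> as the images of its
  coordinates; then \<open>dim_skew\<close> applies.\<close>

lemma allowed_skew:
  assumes "twisted_skew \<mu>"
  shows "allowed d"
proof -
  obtain \<sigma> where \<sigma>: "vlin \<sigma>" "\<not> singular \<sigma>" "\<And>v. \<mu> (\<sigma> v) v = 0" using assms unfolding twisted_skew_def by blast
  obtain \<rho> where \<rho>: "vlin \<rho>" "\<And>v. \<sigma> (\<rho> v) = v" "\<And>v. \<rho> (\<sigma> v) = v" using vlin_nonsingular_inverse[OF \<sigma>(1,2)] by blast
  let ?p = "\<mu> (\<sigma> e2) e3" and ?q = "\<mu> (\<sigma> e3) e1" and ?r = "\<mu> (\<sigma> e1) e2"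
  have vl: "vlin (\<mu> u)" "vlin (\<lambda>u. \<mu> u v)" for u v using bil by (auto simp: bil_def)
  have "\<mu> (\<sigma> a) b = lc3 ?p ?q ?r (cr a b)" for a b
  proof -
    have "\<mu> (\<sigma> a) b $ i = dot (vector [?p$i, ?q$i, ?r$i]) (cr a b)" for i
    proof (rule alternating_cr[where f = "\<lambda>a b. \<mu> (\<sigma> a) b $ i"])
      show "lin (\<lambda>a. \<mu> (\<sigma> a) b $ i)" for b
        using lin_vlin[OF lin_component[OF vl(2)] \<sigma>(1)] .
      show "lin (\<lambda>b. \<mu> (\<sigma> a) b $ i)" for a by (rule lin_component[OF vl(1)])
    qed (simp add: \<sigma>(3))
    then show ?thesis by (simp add: vec3_eq_iff lc3_def dot_def mult.commute)
  qed
  from this[of "\<rho> u" v for u v] have eq: "\<mu> u v = lc3 ?p ?q ?r (cr (\<rho> u) v)" for u v unfolding \<rho>(2) .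
  have id: "lc3 e1 e2 e3 u = u" for u :: "'k^3" by (simp add: lc3_def vec3_eq_iff)
  have D: "d m = k" if "has_dim (SV (\<lambda>u v. cr (\<rho> u) v) m) k" for m k
  proof (rule dims_eq[OF _ _ that])
    show "det3 e1 e2 e3 \<noteq> (0 :: 'k)" by (simp add: det3_def)
    show "\<mu> (lc3 e1 e2 e3 u) (lc3 e1 e2 e3 v) = lc3 ?p ?q ?r (cr (\<rho> u) v)" for u v unfolding id by (rule eq)
  qed
  have "d 3 = 1" by (rule D[OF dim_skew(1)[OF _ \<rho>(1) \<rho>(3,2) \<sigma>(1)]]) simp
  moreover have "d m = 0" if "m \<ge> 4" for m by (rule D[OF dim_skew(2)[OF _ \<rho>(1) \<rho>(3,2) \<sigma>(1) that]]) simp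
  ultimately show ?thesis unfolding allowed_def by blast
qed

lemma allowed_plane:
  assumes b: "det3 x y z \<noteq> 0" and k: "\<And>u. \<mu> u x = 0" "\<And>u. \<mu> x u = 0" and r: "\<mu> y z = a *s \<mu> z y + c *s \<mu> z z"
  shows "allowed d"
proof -
  let ?\<nu> = "\<lambda>u v. vector [u$3 * v$2 + a * (u$2 * v$3), u$3 * v$3 + c * (u$2 * v$3), u$2 * v$2] :: 'k^3"
  have "d m = m + 1" if m: "m \<ge> 3" for m
  proof (rule dims_eq[OF b])
    show "\<mu> (lc3 x y z u) (lc3 x y z v) = lc3 (\<mu> z y) (\<mu> z z) (\<mu> y y) (?\<nu> u v)" for u v
      unfolding bil_lc3[OF bil] k r by (simp add: lc3_def vec3_eq_iff algebra_simps)
    show "has_dim (SV ?\<nu> m) (m + 1)" by (rule dim_plane[OF refl]) (use m in simp)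
  qed
  then show ?thesis unfolding allowed_def by blast
qed

lemma fib_dim_allowed:
  assumes "\<And>m. m \<ge> 3 \<Longrightarrow> d m = fib_dim m"
  shows "allowed d"
proof -
  have "d 3 = 5" "d 4 = 8" using assms[of 3] assms[of 4] by (simp_all add: eval_nat_numeral)
  moreover have "d (m + 2) = d (m + 1) + d m" if "m \<ge> 3" for m using assms that by simp
  ultimately show ?thesis unfolding allowed_def by blast
qed

lemma allowed_fib:
  assumes b: "det3 x y z \<noteq> 0" and k: "\<And>u. \<mu> u x = 0" "\<And>u. \<mu> x u = 0" and r: "\<mu> y y = 0"
  shows "allowed d"
proof (rule fib_dim_allowed)
  fix m :: nat assume m: "m \<ge> 3"
  let ?\<nu> = "\<lambda>u v. vector [u$2 * v$3, u$3 * v$2, u$3 * v$3] :: 'k^3"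
  show "d m = fib_dim m"
  proof (rule dims_eq[OF b])
    show "\<mu> (lc3 x y z u) (lc3 x y z v) = lc3 (\<mu> y z) (\<mu> z y) (\<mu> z z) (?\<nu> u v)" for u v
      unfolding bil_lc3[OF bil] k r by (simp add: lc3_def vec3_eq_iff algebra_simps)
    show "has_dim (SV ?\<nu> m) (fib_dim m)" by (rule dim_fib[OF refl]) (use m in simp)
  qed
qed

end

lemma four_dependent:
  fixes p q r s :: "('k::field)^3"
  obtains a b c e where "a \<noteq> 0 \<or> b \<noteq> 0 \<or> c \<noteq> 0 \<or> e \<noteq> 0" "a *s p + b *s q + c *s r + e *s s = 0"
proof -
  define f where "f = (\<lambda>i::nat. if i = 0 then p else if i = 1 then q else if i = 2 then r else s)"
  obtain c where c: "\<exists>i\<in>{..<4}. c i \<noteq> 0" "\<forall>j<3. (\<Sum>i<4. c i * f i $ idx j) = 0"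
    using homogeneous_system[of "{..<4::nat}" 3 "\<lambda>i j. f i $ idx j"] by auto
  have s: "(\<Sum>i<4. c i * f i $ k) = c 0 * p$k + c 1 * q$k + c 2 * r$k + c 3 * s$k" for k
    by (simp add: f_def eval_nat_numeral)
  have "c 0 \<noteq> 0 \<or> c 1 \<noteq> 0 \<or> c 2 \<noteq> 0 \<or> c 3 \<noteq> 0"
  proof -
    obtain i where "i < 4" "c i \<noteq> 0" using c(1) by auto
    then have "i = 0 \<or> i = 1 \<or> i = 2 \<or> i = 3" by auto
    then show ?thesis using \<open>c i \<noteq> 0\<close> by auto
  qed
  moreover have "c 0 *s p + c 1 *s q + c 2 *s r + c 3 *s s = 0"
    using c(2)[rule_format, of 0] c(2)[rule_format, of 1] c(2)[rule_format, of 2]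
    unfolding s by (simp add: vec3_eq_iff)
  ultimately show ?thesis by (rule that)
qed

lemma nonzero_complete:
  assumes "x \<noteq> (0 :: ('k::field)^3)"
  obtains y z where "det3 x y z \<noteq> 0"
  using det3_nondegenerate[of x] assms by blast

text \<open>Solves a relation for its first term. Relations with fewer terms are brought to this
  shape by appending zero terms.\<close>

lemma dividing_relation:
  fixes p q r s :: "('k::field)^3"
  assumes "a *s p + b *s q + c *s r + e *s s = 0" "a \<noteq> 0"
  shows "p = (- b / a) *s q + (- c / a) *s r + (- e / a) *s s"
proof (rule vec3_eqI)
  have *: "a * p$i + b * q$i + c * r$i + e * s$i = 0" for i
    using arg_cong[OF assms(1), of "\<lambda>v. v $ i"] by simp
  have "p$i = - b / a * q$i + - c / a * r$i + - e / a * s$i" for i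
  proof -
    have "a * p$i = - (b * q$i + c * r$i + e * s$i)" using *[of i] unfolding eq_neg_iff_add_eq_0 by (simp add: add.assoc)
    then have "p$i = - (b * q$i + c * r$i + e * s$i) / a" using assms(2) by (metis nonzero_mult_div_cancel_left)
    then show ?thesis by (simp add: add_divide_distrib diff_divide_distrib)
  qed
  then show "p$1 = ((- b / a) *s q + (- c / a) *s r + (- e / a) *s s)$1" "p$2 = ((- b / a) *s q + (- c / a) *s r + (- e / a) *s s)$2"
    "p$3 = ((- b / a) *s q + (- c / a) *s r + (- e / a) *s s)$3" by simp_all
qed

lemma det3_swap: "det3 x z y = - det3 x y z" "det3 y x z = - det3 x y z"
  by (simp_all add: det3_def algebra_simps)

section \<open>Case analysis by kernels and compressions on the two sides\<close>

context quadratic_dims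
begin

text \<open>In degrees at least 2 this is an algebra on two generators with one relation. A
  substitution removes the square of one generator from the relation, because a binary quadratic
  form has a zero. What is left makes one mixed product reducible, as in
  \<open>allowed_plane\<close> or its mirror image, or it says that the other generator has square
  zero.\<close>

lemma allowed_same_kernel:
  assumes x: "x \<noteq> 0" and k: "\<And>u. \<mu> u x = 0" "\<And>u. \<mu> x u = 0"
  shows "allowed d"
proof -
  obtain y z where b: "det3 x y z \<noteq> 0" using nonzero_complete[OF x] .
  have fin: "allowed d" if b: "det3 x y z \<noteq> 0" and nz: "A \<noteq> 0 \<or> B \<noteq> 0 \<or> C \<noteq> 0"
      and r: "C *s \<mu> y z + B *s \<mu> z y + A *s \<mu> z z + 0 *s \<mu> z z = 0" for y z A B C
  proof (cases "C = 0")
    case False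
    from dividing_relation[OF r this] show ?thesis by (intro allowed_plane[OF b k, of "- B / C" "- A / C"]) simp
  next
    case C: True
    show ?thesis
    proof (cases "B = 0")
      case False
      have "B *s \<mu> z y + A *s \<mu> z z + 0 *s \<mu> z z + 0 *s \<mu> z z = 0" using r C by simp
      from dividing_relation[OF this False]
      have e: "\<mu> z y = 0 *s \<mu> y z + (- A / B) *s \<mu> z z" by simp
      interpret op: quadratic_dims "\<lambda>u v. \<mu> v u" d using quadratic_dims_op[OF quadratic_dims_axioms] .
      show ?thesis by (rule op.allowed_plane[OF b k(2,1) e])
    next
      case True
      then have "\<mu> z z = 0" using r C nz by simp
      moreover have "det3 x z y \<noteq> 0" using b det3_swap(1)[of x z y] by simp
      ultimately show ?thesis by (intro allowed_fib[OF _ k])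
    qed
  qed
  obtain r1 r2 r3 r4 where r: "r1 \<noteq> 0 \<or> r2 \<noteq> 0 \<or> r3 \<noteq> 0 \<or> r4 \<noteq> 0"
    "r1 *s \<mu> y y + r2 *s \<mu> y z + r3 *s \<mu> z y + r4 *s \<mu> z z = 0" by (rule four_dependent)
  show ?thesis
  proof (cases "r1 = 0")
    case True
    then show ?thesis using r by (intro fin[OF b, of r4 r3 r2]) auto
  next
    case False
    then obtain t where t: "r1 * t * t + (r2 + r3) * t + r4 = 0" by (rule quadratic_root)
    \<comment> \<open>With \<open>y = ?z + t ?y\<close> the polynomial whose root is
      \<open>t\<close> becomes the coefficient of the product \<open>?y ?y\<close> in the
      relation.\<close>
    let ?y = "z" and ?z = "y + (- t) *s z"
    have "det3 x ?y ?z = - det3 x y z" by (simp add: det3_def algebra_simps)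
    then have b': "det3 x ?y ?z \<noteq> 0" using b by simp
    have "(r1 * t + r3) *s \<mu> ?y ?z + (r1 * t + r2) *s \<mu> ?z ?y + r1 *s \<mu> ?z ?z + (r1 * t * t + (r2 + r3) * t + r4) *s \<mu> ?y ?y
        = r1 *s \<mu> y y + r2 *s \<mu> y z + r3 *s \<mu> z y + r4 *s \<mu> z z"
      by (simp add: bilD[OF bil] vec3_eq_iff algebra_simps)
    then have "(r1 * t + r3) *s \<mu> ?y ?z + (r1 * t + r2) *s \<mu> ?z ?y + r1 *s \<mu> ?z ?z + (r1 * t * t + (r2 + r3) * t + r4) *s \<mu> ?y ?y = 0"
      unfolding r(2) .
    then have "(r1 * t + r3) *s \<mu> ?y ?z + (r1 * t + r2) *s \<mu> ?z ?y + r1 *s \<mu> ?z ?z + 0 *s \<mu> ?z ?z = 0"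
      unfolding t by simp
    then show ?thesis by (rule fin[OF b', rotated]) (use False in simp)
  qed
qed

lemma allowed_xy_relation:
  assumes b: "det3 x y z \<noteq> 0" and k: "\<And>u. \<mu> u x = 0" "\<And>u. \<mu> y u = 0" and r: "\<mu> x z = a *s \<mu> x y"
  shows "allowed d"
proof -
  let ?\<nu> = "\<lambda>u v. vector [u$1 * v$2 + a * (u$1 * v$3), u$3 * v$2, u$3 * v$3] :: 'k^3"
  have "d m = 2" if m: "m \<ge> 3" for m
  proof (rule dims_eq[OF b])
    show "\<mu> (lc3 x y z u) (lc3 x y z v) = lc3 (\<mu> x y) (\<mu> z y) (\<mu> z z) (?\<nu> u v)" for u v
      unfolding bil_lc3[OF bil] k r by (simp add: lc3_def vec3_eq_iff algebra_simps)
    show "has_dim (SV ?\<nu> m) 2" by (rule dim_kernels_2[OF refl m])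
  qed
  then show ?thesis unfolding allowed_def by blast
qed

text \<open>Only the four products of \<open>x\<close> or \<open>z\<close> with \<open>y\<close> or
  \<open>z\<close> can be nonzero, and four vectors of a three-dimensional space satisfy a relation.
  The cases ask which of \<open>z z\<close>, \<open>z y\<close>, \<open>x z\<close>,
  \<open>x y\<close> occurs first in it.\<close>

lemma allowed_two_kernels:
  assumes b: "det3 x y z \<noteq> 0" and k: "\<And>u. \<mu> u x = 0" "\<And>u. \<mu> y u = 0"
  shows "allowed d"
proof -
  obtain r1 r2 r3 r4 where nz: "r1 \<noteq> 0 \<or> r2 \<noteq> 0 \<or> r3 \<noteq> 0 \<or> r4 \<noteq> 0"
    and r: "r1 *s \<mu> z z + r2 *s \<mu> z y + r3 *s \<mu> x z + r4 *s \<mu> x y = 0" by (rule four_dependent)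
  consider "r1 \<noteq> 0" | "r1 = 0" "r2 \<noteq> 0" "r3 \<noteq> 0" | "r1 = 0" "r2 \<noteq> 0" "r3 = 0" | "r1 = 0" "r2 = 0" "r3 \<noteq> 0"
    | "r1 = 0" "r2 = 0" "r3 = 0" "r4 \<noteq> 0" using nz by blast
  then show ?thesis
  proof cases
    case 1
    from dividing_relation[OF r 1] obtain a c e where e: "\<mu> z z = a *s \<mu> z y + c *s \<mu> x z + e *s \<mu> x y" by blast
    let ?\<nu> = "\<lambda>u v. vector [u$1 * v$2 + e * (u$3 * v$3), u$3 * v$2 + a * (u$3 * v$3), u$1 * v$3 + c * (u$3 * v$3)] :: 'k^3"
    have eq: "\<mu> (lc3 x y z u) (lc3 x y z v) = lc3 (\<mu> x y) (\<mu> z y) (\<mu> x z) (?\<nu> u v)" for u v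
      unfolding bil_lc3[OF bil] k e by (simp add: lc3_def vec3_eq_iff algebra_simps)
    have "d 3 = 1" by (rule dims_eq[OF b eq dim_kernels_0(1)[OF refl]])
    moreover have "d m = 0" if "m \<ge> 4" for m by (rule dims_eq[OF b eq dim_kernels_0(2)[OF refl that]])
    ultimately show ?thesis unfolding allowed_def by blast
  next
    case 2
    have "r2 *s \<mu> z y + r3 *s \<mu> x z + r4 *s \<mu> x y + 0 *s \<mu> x y = 0" using r 2 by simp
    from dividing_relation[OF this 2(2)]
    have e: "\<mu> z y = (- r3 / r2) *s \<mu> x z + (- r4 / r2) *s \<mu> x y" by simp
    define a c where "a = - r4 / r2" and "c = - r3 / r2"
    note e = e[folded a_def c_def]
    have c: "c \<noteq> 0" using 2 by (simp add: c_def)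
    let ?\<nu> = "\<lambda>u v. vector [u$1 * v$2 + a * (u$3 * v$2), u$1 * v$3 + c * (u$3 * v$2), u$3 * v$3] :: 'k^3"
    have eq: "\<mu> (lc3 x y z u) (lc3 x y z v) = lc3 (\<mu> x y) (\<mu> x z) (\<mu> z z) (?\<nu> u v)" for u v
      unfolding bil_lc3[OF bil] k e by (simp add: lc3_def vec3_eq_iff algebra_simps)
    have "d m = 1" if "m \<ge> 3" for m by (rule dims_eq[OF b eq dim_kernels_1[OF refl c that]])
    then show ?thesis unfolding allowed_def by blast
  next
    case 3
    have "r2 *s \<mu> z y + r4 *s \<mu> x y + 0 *s \<mu> x y + 0 *s \<mu> x y = 0" using r 3 by simp
    from dividing_relation[OF this 3(2)] have e: "\<mu> z y = (- r4 / r2) *s \<mu> x y" by simp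
    \<comment> \<open>A relation expressing \<open>z y\<close> by \<open>x y\<close> is the mirror
      image of one expressing \<open>x z\<close> by \<open>x y\<close>, with \<open>x\<close> and
      \<open>y\<close> exchanged.\<close>
    interpret op: quadratic_dims "\<lambda>u v. \<mu> v u" d using quadratic_dims_op[OF quadratic_dims_axioms] .
    have "det3 y x z \<noteq> 0" using b det3_swap(2)[of y x z] by simp
    then show ?thesis by (rule op.allowed_xy_relation[of y x z "- r4 / r2", OF _ k(2) k(1) e])
  next
    case 4
    have "r3 *s \<mu> x z + r4 *s \<mu> x y + 0 *s \<mu> x y + 0 *s \<mu> x y = 0" using r 4 by simp
    from dividing_relation[OF this 4(3)] have e: "\<mu> x z = (- r4 / r3) *s \<mu> x y" by simp
    show ?thesis by (rule allowed_xy_relation[OF b k e])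
  next
    case 5
    then have e: "\<mu> x y = 0" using r by simp
    let ?\<nu> = "\<lambda>u v. vector [u$3 * v$2, u$1 * v$3, u$3 * v$3] :: 'k^3"
    have eq: "\<mu> (lc3 x y z u) (lc3 x y z v) = lc3 (\<mu> z y) (\<mu> x z) (\<mu> z z) (?\<nu> u v)" for u v
      unfolding bil_lc3[OF bil] k e by (simp add: lc3_def vec3_eq_iff algebra_simps)
    have "d m = 4" if "m \<ge> 3" for m by (rule dims_eq[OF b eq dim_kernels_4[OF refl that]])
    then show ?thesis unfolding allowed_def by blast
  qed
qed

lemma allowed_both_kernels:
  assumes "right_kernel \<mu>" "right_kernel (\<lambda>u v. \<mu> v u)"
  shows "allowed d"
proof -
  obtain x where x: "x \<noteq> 0" "\<And>u. \<mu> u x = 0" using assms(1) unfolding right_kernel_def by blast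
  obtain y where y: "y \<noteq> 0" "\<And>u. \<mu> y u = 0" using assms(2) unfolding right_kernel_def by blast
  show ?thesis
  proof (cases "indep2 x y")
    case True
    then obtain z where "det3 x y z \<noteq> 0" by (rule indep2_complete)
    then show ?thesis by (rule allowed_two_kernels[OF _ x(2) y(2)])
  next
    case False
    then obtain c where c: "x = c *s y" using not_indep2'[OF _ y(1)] by blast
    have "\<mu> x u = 0" for u unfolding c by (simp add: bilD[OF bil] y(2))
    then show ?thesis by (rule allowed_same_kernel[OF x])
  qed
qed

text \<open>A degenerate matrix would give a nonzero combination of \<open>s\<close> and
  \<open>t\<close> that kills the whole basis \<open>x\<close>, \<open>y\<close>, \<open>z\<close>,
  that is, a left kernel.\<close>

lemma left_kernel_minor:
  assumes nk: "\<not> right_kernel (\<lambda>u v. \<mu> v u)" and b: "det3 x y z \<noteq> 0" and ind: "indep2 s t"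
    and "\<mu> s x = 0" "\<mu> t x = 0" and "\<mu> s y = a *s p" "\<mu> s z = b *s p" "\<mu> t y = c *s p" "\<mu> t z = e *s p"
  shows "a * e \<noteq> b * c"
proof
  assume h: "a * e = b * c"
  obtain g where g: "\<And>v. lc3 x y z (g v) = v" using lc3_basis_inverse[OF b] by metis
  have kill: "w = 0" if "\<mu> w x = 0" "\<mu> w y = 0" "\<mu> w z = 0" for w
  proof (rule ccontr)
    assume n: "w \<noteq> 0"
    have "\<mu> w (lc3 x y z v) = 0" for v using that by (simp add: lc3_def bilD[OF bil])
    then have "\<mu> w v = 0" for v using g[of v] by metis
    then show False using nk n unfolding right_kernel_def by blast
  qed
  have 1: "\<mu> (i *s s + j *s t) y = (i * a + j * c) *s p" "\<mu> (i *s s + j *s t) z = (i * b + j * e) *s p" "\<mu> (i *s s + j *s t) x = 0" for i j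
    using assms(4-) by (simp_all add: bilD[OF bil] vec3_eq_iff algebra_simps)
  have z: "i = 0 \<and> j = 0" if "i * a + j * c = 0" "i * b + j * e = 0" for i j
    using kill[of "i *s s + j *s t"] 1[of i j] that ind unfolding indep2_def by auto
  \<comment> \<open>The coefficient pairs \<open>(c, - a)\<close> and \<open>(e, - b)\<close> are
    kernel vectors of a degenerate matrix. If both are zero, the matrix is zero and the pair
    \<open>(1, 1)\<close> serves.\<close>
  have "c = 0 \<and> - a = 0" using z[of c "- a"] h by (simp add: algebra_simps)
  moreover have "e = 0 \<and> - b = 0" using z[of e "- b"] h by (simp add: algebra_simps)
  ultimately show False using z[of 1 1] by simp
qed

text \<open>Let \<open>x\<close> be the right kernel vector and let left factors in the plane of
  \<open>s\<close> and \<open>t\<close> have all products in the line of \<open>p\<close>. If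
  \<open>x\<close> lies outside the plane, \<open>x\<close>, \<open>s\<close>, \<open>t\<close> is a
  basis and degree 4 vanishes. If it lies inside, the plane has a basis \<open>x\<close>,
  \<open>y\<close> and the dimension stays 2. The matrices involved are nondegenerate because there
  is no left kernel.\<close>

lemma allowed_kernel_compressed:
  assumes rk: "right_kernel \<mu>" and c: "compressed (\<lambda>u v. \<mu> v u)" and nk: "\<not> right_kernel (\<lambda>u v. \<mu> v u)"
  shows "allowed d"
proof -
  obtain x where x: "x \<noteq> 0" "\<And>u. \<mu> u x = 0" using rk unfolding right_kernel_def by blast
  obtain s t p where st: "indep2 s t" "\<And>u. \<exists>a. \<mu> s u = a *s p" "\<And>u. \<exists>a. \<mu> t u = a *s p"
    using c unfolding compressed_def by blast
  show ?thesis
  proof (cases "det3 x s t = 0")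
    case False
    obtain a b c e where m: "\<mu> s s = a *s p" "\<mu> s t = b *s p" "\<mu> t s = c *s p" "\<mu> t t = e *s p" using st(2,3) by metis
    have n: "a * e \<noteq> b * c" by (rule left_kernel_minor[OF nk False st(1) x(2) x(2) m])
    let ?\<nu> = "\<lambda>u v. vector [u$2 * (a * v$2 + b * v$3) + u$3 * (c * v$2 + e * v$3), u$1 * v$2, u$1 * v$3] :: 'k^3"
    have eq: "\<mu> (lc3 x s t u) (lc3 x s t v) = lc3 p (\<mu> x s) (\<mu> x t) (?\<nu> u v)" for u v
      unfolding bil_lc3[OF bil] x m by (simp add: lc3_def vec3_eq_iff algebra_simps)
    have "d 3 = 1" by (rule dims_eq[OF False eq dim_compressed_0(1)[OF refl n]])
    moreover have "d m = 0" if "m \<ge> 4" for m by (rule dims_eq[OF False eq dim_compressed_0(2)[OF refl n that]])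
    ultimately show ?thesis unfolding allowed_def by blast
  next
    case True
    obtain w where w: "w \<noteq> 0" "lc3 x s t w = 0" using det3_eq_0_imp_singular[OF True] unfolding singular_def by blast
    have w1: "w$1 \<noteq> 0"
    proof
      assume "w$1 = 0"
      then have "w$2 *s s + w$3 *s t = 0" using w(2) by (simp add: lc3_def)
      then have "w$2 = 0 \<and> w$3 = 0" using st(1) unfolding indep2_def by blast
      then show False using w(1) \<open>w$1 = 0\<close> by (simp add: vec3_eq_iff)
    qed
    have xst: "x = (- w$2 / w$1) *s s + (- w$3 / w$1) *s t"
    proof -
      have "w$1 *s x + w$2 *s s + w$3 *s t + 0 *s t = 0" using w(2) by (simp add: lc3_def)
      from dividing_relation[OF this w1] show ?thesis by simp
    qed
    have xp: "\<exists>a. \<mu> x u = a *s p" for u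
    proof -
      obtain a b where "\<mu> s u = a *s p" "\<mu> t u = b *s p" using st(2,3) by metis
      then have "\<mu> x u = (- w$2 / w$1 * a + - w$3 / w$1 * b) *s p"
        by (subst xst) (simp add: bilD[OF bil] vec3_eq_iff algebra_simps)
      then show ?thesis by blast
    qed
    have "\<exists>y. indep2 x y \<and> (\<forall>u. \<exists>a. \<mu> y u = a *s p)"
    proof (cases "indep2 x s")
      case True
      then show ?thesis using st by blast
    next
      case False
      then obtain c where c: "s = c *s x" using not_indep2[OF _ x(1)] by blast
      have "indep2 x t"
      proof (rule ccontr)
        assume "\<not> indep2 x t"
        then obtain c' where c': "t = c' *s x" using not_indep2[OF _ x(1)] by blast
        have "c' *s s + (- c) *s t = 0" unfolding c c' by (simp add: vec3_eq_iff)
        then have "c' = 0 \<and> - c = 0" using st(1) unfolding indep2_def by blast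
        then have "c = 0" "c' = 0" by auto
        then have "1 *s s + 1 *s t = 0" using c c' by simp
        then show False using st(1) unfolding indep2_def by (metis one_neq_zero)
      qed
      then show ?thesis using st by blast
    qed
    then obtain y where y: "indep2 x y" "\<And>u. \<exists>a. \<mu> y u = a *s p" by blast
    obtain z where b: "det3 x y z \<noteq> 0" using indep2_complete[OF y(1)] .
    obtain a b' c e where m: "\<mu> x y = a *s p" "\<mu> x z = b' *s p" "\<mu> y y = c *s p" "\<mu> y z = e *s p" using xp y(2) by metis
    have n: "a * e \<noteq> b' * c" by (rule left_kernel_minor[OF nk b y(1) x(2) x(2) m])
    let ?\<nu> = "\<lambda>u v. vector [u$1 * (a * v$2 + b' * v$3) + u$2 * (c * v$2 + e * v$3), u$3 * v$2, u$3 * v$3] :: 'k^3"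
    have eq: "\<mu> (lc3 x y z u) (lc3 x y z v) = lc3 p (\<mu> z y) (\<mu> z z) (?\<nu> u v)" for u v
      unfolding bil_lc3[OF bil] x m by (simp add: lc3_def vec3_eq_iff algebra_simps)
    have "d m = 2" if "m \<ge> 3" for m by (rule dims_eq[OF b eq dim_compressed_2[OF refl n that]])
    then show ?thesis unfolding allowed_def by blast
  qed
qed

text \<open>The products of the left plane with the right plane are not all zero, since otherwise a
  left kernel arises. Hence the lines of \<open>p\<close> and \<open>q\<close> coincide, and all
  values of \<open>\<mu>\<close> lie in the span of \<open>p\<close> and the single product
  \<open>\<mu> z' z\<close>, against \<open>spanning\<close>.\<close>

lemma both_compressed:
  assumes c: "compressed \<mu>" "compressed (\<lambda>u v. \<mu> v u)" and nk: "\<not> right_kernel (\<lambda>u v. \<mu> v u)"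
  shows False
proof -
  obtain v w p where vw: "indep2 v w" "\<And>u. \<exists>a. \<mu> u v = a *s p" "\<And>u. \<exists>a. \<mu> u w = a *s p"
    using c(1) unfolding compressed_def by blast
  obtain s t q where st: "indep2 s t" "\<And>u. \<exists>a. \<mu> s u = a *s q" "\<And>u. \<exists>a. \<mu> t u = a *s q"
    using c(2) unfolding compressed_def by blast
  obtain z where z: "det3 v w z \<noteq> 0" using indep2_complete[OF vw(1)] .
  obtain z' where z': "det3 s t z' \<noteq> 0" using indep2_complete[OF st(1)] .
  obtain g where g: "\<And>x. lc3 v w z (g x) = x" using lc3_basis_inverse[OF z] by metis
  obtain g' where g': "\<And>x. lc3 s t z' (g' x) = x" using lc3_basis_inverse[OF z'] by metis
  have "\<exists>u\<in>{s, t}. \<exists>x\<in>{v, w}. \<mu> u x \<noteq> 0"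
  proof (rule ccontr)
    assume "\<not> ?thesis"
    then have 0: "\<mu> s v = 0" "\<mu> s w = 0" "\<mu> t v = 0" "\<mu> t w = 0" by auto
    obtain a b where ab: "\<mu> s z = a *s q" "\<mu> t z = b *s q" using st(2,3) by metis
    have kill: "y = 0" if "\<mu> y v = 0" "\<mu> y w = 0" "\<mu> y z = 0" for y
    proof (rule ccontr)
      assume n: "y \<noteq> 0"
      have "\<mu> y (lc3 v w z x) = 0" for x using that by (simp add: lc3_def bilD[OF bil])
      then have "\<mu> y x = 0" for x using g[of x] by metis
      then show False using nk n unfolding right_kernel_def by blast
    qed
    have "b *s s + (- a) *s t = 0" by (rule kill) (simp_all add: bilD[OF bil] 0 ab vec3_eq_iff algebra_simps)
    then have "b = 0 \<and> - a = 0" using st(1) unfolding indep2_def by blast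
    then have "b = 0" "a = 0" by auto
    then have "s = 0" using kill[of s] 0 ab by simp
    then have "1 *s s + 0 *s t = 0" by simp
    then show False using st(1) unfolding indep2_def by (metis one_neq_zero)
  qed
  then obtain u x where ux: "u \<in> {s, t}" "x \<in> {v, w}" "\<mu> u x \<noteq> 0" by blast
  obtain a where a: "\<mu> u x = a *s p" using vw(2,3) ux(2) by blast
  obtain b where b: "\<mu> u x = b *s q" using st(2,3) ux(1) by blast
  have "b \<noteq> 0" using b ux(3) by auto
  have qp: "q = (a / b) *s p"
    using a b \<open>b \<noteq> 0\<close> by (simp add: vec3_eq_iff field_simps)
  \<comment> \<open>The zero vector in third place turns \<open>det3_eq_0_functional\<close> into a
    functional that kills two given vectors.\<close>
  have "det3 p (\<mu> z' z) 0 = 0" by simp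
  then obtain \<psi> where \<psi>: "\<psi> \<noteq> 0" "dot \<psi> p = 0" "dot \<psi> (\<mu> z' z) = 0" by (rule det3_eq_0_functional)
  have dm: "dot \<psi> (c *s y) = c * dot \<psi> y" "dot \<psi> (y + y') = dot \<psi> y + dot \<psi> y'" for c y y'
    by (simp_all add: dot_def algebra_simps)
  have kp: "dot \<psi> (\<mu> y v) = 0" "dot \<psi> (\<mu> y w) = 0" "dot \<psi> (\<mu> s y) = 0" "dot \<psi> (\<mu> t y) = 0" for y
    using vw(2)[of y] vw(3)[of y] st(2)[of y] st(3)[of y] \<psi>(2) qp by (auto simp: dm)
  have "dot \<psi> (\<mu> (lc3 s t z' y) (lc3 v w z y')) = 0" for y y'
    by (simp add: lc3_def bilD[OF bil] dm kp \<psi>)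
  then have "dot \<psi> (\<mu> y y') = 0" for y y' using g[of y'] g'[of y] by metis
  then show False using \<psi>(1) sp unfolding spanning_def by blast
qed

theorem allowed_dims: "allowed d"
proof -
  interpret op: quadratic_dims "\<lambda>u v. \<mu> v u" d using quadratic_dims_op[OF quadratic_dims_axioms] .
  show ?thesis
  proof (cases "(\<exists>z. \<not> singular (\<mu> z)) \<or> (\<exists>z. \<not> singular (\<lambda>u. \<mu> u z))")
    case True
    then show ?thesis using allowed_nonsingular[OF bil _ hd] allowed_nonsingular[OF op.bil _ op.hd] by blast
  next
    case False
    then have "singular (\<mu> u)" "singular (\<lambda>v. \<mu> v u)" for u by auto
    then have 1: "right_kernel \<mu> \<or> compressed \<mu> \<or> twisted_skew \<mu>"
      and 2: "right_kernel (\<lambda>u v. \<mu> v u) \<or> compressed (\<lambda>u v. \<mu> v u) \<or> twisted_skew (\<lambda>u v. \<mu> v u)"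
      using singular_spaces[OF infinite_alg_closed bil sp] singular_spaces[OF infinite_alg_closed op.bil op.sp] by blast+
    \<comment> \<open>A twisted skew side decides alone. Otherwise each side has a kernel or is
      compressed: two kernels and one kernel with one compressed side are settled above, and two
      compressed sides without a left kernel are impossible.\<close>
    show ?thesis
      using 1 2 allowed_skew op.allowed_skew allowed_both_kernels allowed_kernel_compressed op.allowed_kernel_compressed
        both_compressed by blast
  qed
qed

end

subsection \<open>Further examples\<close>

lemma has_dim_three:
  assumes "F \<in> Q" "G \<in> Q" "H \<in> Q" "F P = 1" "F R = 0" "F S = 0" "G P = 0" "G R = 1" "G S = 0" "H P = 0" "H R = 0" "H S = 1"
    "\<And>f. f \<in> Q \<Longrightarrow> f P = 0 \<Longrightarrow> f R = 0 \<Longrightarrow> f S = 0 \<Longrightarrow> f = (\<lambda>_. 0)"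
  shows "has_dim Q 3"
proof (rule has_dimI[of _ "\<lambda>i. if i = 0 then F else if i = 1 then G else H" _ "\<lambda>i. if i = 0 then P else if i = 1 then R else S"])
  fix f assume f: "f \<in> Q" "\<And>i::nat. i < 3 \<Longrightarrow> f (if i = 0 then P else if i = 1 then R else S) = 0"
  show "f = (\<lambda>_. 0)" by (rule assms(13)[OF f(1)]) (use f(2)[of 0] f(2)[of 1] f(2)[of 2] in auto)
next
  fix i j :: nat assume "i < 3" "j < 3"
  then have "i = 0 \<or> i = 1 \<or> i = 2" "j = 0 \<or> j = 1 \<or> j = 2" by auto
  then show "(if i = 0 then F else if i = 1 then G else H) (if j = 0 then P else if j = 1 then R else S) = (if i = j then 1 else 0)"
    using assms(4-12) by auto
qed (use assms(1-3) in auto)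

lemma SV_pair_eq:
  assumes "F \<in> SV \<mu> m" "\<mu> u v = \<mu> u' v'"
  shows "F (p @ u # v # s) = F (p @ u' # v' # s)"
proof -
  obtain \<psi> where "\<forall>u v. F (p @ u # v # s) = dot \<psi> (\<mu> u v)" using SV_pair[OF assms(1)] by blast
  then show ?thesis using assms(2) by simp
qed

lemma SV3_pairs:
  assumes "F \<in> SV \<mu> 3"
  shows "\<mu> u v = 0 \<Longrightarrow> F [u, v, w] = 0" "\<mu> u v = 0 \<Longrightarrow> F [w, u, v] = 0"
    "\<mu> u v = \<mu> u' v' \<Longrightarrow> F [u, v, w] = F [u', v', w]" "\<mu> u v = \<mu> u' v' \<Longrightarrow> F [w, u, v] = F [w, u', v']"
  using SV_pair_zero[OF assms, of u v "[]" "[w]"] SV_pair_zero[OF assms, of u v "[w]" "[]"]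
    SV_pair_eq[OF assms, of u v u' v' "[]" "[w]"] SV_pair_eq[OF assms, of u v u' v' "[w]" "[]"] by simp_all

lemma SV3_zero:
  assumes "F \<in> SV \<mu> 3" "\<And>a b c. a \<in> {e1, e2, e3} \<Longrightarrow> b \<in> {e1, e2, e3} \<Longrightarrow> c \<in> {e1, e2, e3} \<Longrightarrow> F [a, b, c] = 0"
  shows "F = (\<lambda>_. 0)"
proof (rule SV_zero[OF assms(1)])
  fix l :: "('a^3) list" assume l: "set l \<subseteq> {e1, e2, e3}" "length l = 3"
  obtain a b c where "l = [a, b, c]" using l(2) by (rule list3_E)
  then show "F l = 0" using assms(2)[of a b c] l(1) by simp
qed

lemma SV4_sub: "F \<in> SV \<mu> 4 \<Longrightarrow> (\<lambda>l. F (a # l)) \<in> SV \<mu> 3" "F \<in> SV \<mu> 4 \<Longrightarrow> (\<lambda>l. F (l @ [a])) \<in> SV \<mu> 3"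
  by (rule SV_cons, simp) (rule SV_snoc, simp)

lemma SV4_zero:
  assumes "F \<in> SV \<mu> 4" "\<And>a b c e. a \<in> {e1, e2, e3} \<Longrightarrow> b \<in> {e1, e2, e3} \<Longrightarrow> c \<in> {e1, e2, e3} \<Longrightarrow> e \<in> {e1, e2, e3} \<Longrightarrow> F [a, b, c, e] = 0"
  shows "F = (\<lambda>_. 0)"
proof (rule SV_zero[OF assms(1)])
  fix l :: "('a^3) list" assume l: "set l \<subseteq> {e1, e2, e3}" "length l = 4"
  then obtain a b c e where "l = [a, b, c, e]" by (auto simp: length_Suc_conv eval_nat_numeral)
  then show "F l = 0" using assms(2)[of a b c e] l(1) by simp
qed

lemma SV_0_above: "(\<And>F. F \<in> SV \<mu> m \<Longrightarrow> F = (\<lambda>_. 0)) \<Longrightarrow> n \<ge> m \<Longrightarrow> has_dim (SV \<mu> n) 0"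
  by (rule has_dim_zero) (rule SV_trivial_mono)

text \<open>Tables in which every product of basis vectors is 0 or a basis vector of
  \<open>A\<^sub>2\<close>; a coordinate with two terms encodes an equality such as
  \<open>e2 e2 = e3 e3\<close>. The number is the index of the Hilbert series; the other series come
  from normal forms above.\<close>

definition "mu1 u v = (vector [u$2 * v$2 + u$3 * v$3, u$3 * v$1, u$3 * v$2] :: ('k::field)^3)"
definition "mu4 u v = (vector [u$2 * v$3 + u$3 * v$3, u$3 * v$1, u$3 * v$2] :: ('k::field)^3)"
definition "mu5 u v = (vector [u$2 * v$2 + u$3 * v$2, u$2 * v$3, u$3 * v$1] :: ('k::field)^3)"
definition "mu6 u v = (vector [u$3 * v$3, u$3 * v$2 + u$2 * v$2, u$2 * v$1] :: ('k::field)^3)"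
definition "mu8 u v = (vector [u$3 * v$1, u$3 * v$2, u$3 * v$3] :: ('k::field)^3)"

text \<open>With y, z for \<open>e2\<close>, \<open>e3\<close>: since y y = z z and y z = 0, first y
  y y = y z z = 0. Then z z w = y y w = 0 for all w, and z y y = z z z = 0.\<close>

lemma dim_mu1: "m \<ge> 3 \<Longrightarrow> has_dim (SV (mu1 :: ('k::field)^3 \<Rightarrow> 'k^3 \<Rightarrow> 'k^3) m) 0"
proof (rule SV_0_above[where m = 3])
  fix F :: "('k^3) list \<Rightarrow> 'k" assume F: "F \<in> SV mu1 3"
  note P = SV3_pairs[OF F]
  have z: "F [e1, v, w] = 0" "F [v, e1, w] = 0" "F [e2, e1, w] = 0" "F [w, e2, e1] = 0" "F [e2, e3, w] = 0" "F [w, e2, e3] = 0" for v w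
    by ((rule P(1), (simp add: mu1_def vec3_eq_iff; fail)) | (rule P(2), (simp add: mu1_def vec3_eq_iff; fail)) | (rule P(3), (simp add: mu1_def vec3_eq_iff; fail)) | (rule P(4), (simp add: mu1_def vec3_eq_iff; fail)))+
  have q: "F [e2, e2, w] = F [e3, e3, w]" "F [w, e2, e2] = F [w, e3, e3]" for w
    by ((rule P(1), (simp add: mu1_def vec3_eq_iff; fail)) | (rule P(2), (simp add: mu1_def vec3_eq_iff; fail)) | (rule P(3), (simp add: mu1_def vec3_eq_iff; fail)) | (rule P(4), (simp add: mu1_def vec3_eq_iff; fail)))+
  have 1: "F [e2, e2, e2] = 0" using q(2)[of e2] z(5)[of e3] by simp
  have 2: "F [e3, e3, w] = 0" if "w \<in> {e1, e2, e3}" for w using q(1)[of w] 1 z(4,6)[of e2] that by auto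
  have 3: "F [e3, e2, e2] = 0" using q(2)[of e3] 2[of e3] by simp
  show "F = (\<lambda>_. 0)"
    by (rule SV3_zero[OF F]) (use z 1 2 3 in auto)
qed

text \<open>With x, y, z for the basis vectors: y z = z z, and degree 3 is spanned by y z x and y z
  y. In a word of length 4 the third letter must be different from z for the first three letters to
  survive, and equal to z for the last three.\<close>

lemma dim_mu4:
  "has_dim (SV (mu4 :: ('k::field)^3 \<Rightarrow> 'k^3 \<Rightarrow> 'k^3) 3) 2"
  "m \<ge> 4 \<Longrightarrow> has_dim (SV (mu4 :: ('k::field)^3 \<Rightarrow> 'k^3 \<Rightarrow> 'k^3) m) 0"
proof -
  have facts: "F [e1, v, w] = 0" "F [v, e1, w] = 0" "F [e2, e2, w] = 0" "F [v, e2, e1] = 0" "F [v, e2, e2] = 0"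
    "F [e2, e3, w] = F [e3, e3, w]" "F [v, e2, e3] = F [v, e3, e3]" if F: "F \<in> SV mu4 3" for F :: "('k^3) list \<Rightarrow> 'k" and v w
    by ((rule SV3_pairs(1)[OF F], (simp add: mu4_def vec3_eq_iff; fail)) | (rule SV3_pairs(2)[OF F], (simp add: mu4_def vec3_eq_iff; fail)) | (rule SV3_pairs(3)[OF F], (simp add: mu4_def vec3_eq_iff; fail)) | (rule SV3_pairs(4)[OF F], (simp add: mu4_def vec3_eq_iff; fail)))+
  have 3: "F [e2, e3, e3] = 0" "F [e3, e3, e3] = 0" "F [e3, e2, e3] = 0" if F: "F \<in> SV mu4 3" for F :: "('k^3) list \<Rightarrow> 'k"
    using facts(3)[OF F, of e3] facts(6)[OF F, of e3] facts(7)[OF F, of e2] facts(7)[OF F, of e3] by auto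
  let ?F = "\<lambda>i l. if length l = 3 then ((l!0)$2 + (l!0)$3) * (l!1)$3 * (l!2)$i else 0 :: 'k"
  have mem: "?F i \<in> SV mu4 3" if "i \<in> {1, 2}" for i
  proof (rule SV_3I)
    show "\<exists>\<psi>. \<forall>u v. (u$2 + u$3) * v$3 * w$i = dot \<psi> (mu4 u v)" for w :: "'k^3"
      by (intro exI[of _ "vector [w$i, 0, 0]"]) (simp add: mu4_def dot_def algebra_simps)
    show "\<exists>\<psi>. \<forall>v w. (u$2 + u$3) * v$3 * w$i = dot \<psi> (mu4 v w)" for u :: "'k^3"
      using that by (intro exI[of _ "if i = 1 then vector [0, u$2 + u$3, 0] else vector [0, 0, u$2 + u$3]"]) (auto simp: mu4_def dot_def algebra_simps)
  qed (simp_all add: lin_def algebra_simps)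
  show "has_dim (SV (mu4 :: 'k^3 \<Rightarrow> 'k^3 \<Rightarrow> 'k^3) 3) 2"
  proof (rule has_dim_two[OF mem[of 1] mem[of 2], of "[e2, e3, e1]" "[e2, e3, e2]"])
    fix F :: "('k^3) list \<Rightarrow> 'k" assume F: "F \<in> SV mu4 3" and z: "F [e2, e3, e1] = 0" "F [e2, e3, e2] = 0"
    have "F [e3, e3, e1] = 0" "F [e3, e3, e2] = 0" using z facts(6)[OF F, of e1] facts(6)[OF F, of e2] by auto
    then show "F = (\<lambda>_. 0)" by (intro SV3_zero[OF F]) (use facts(1-5)[OF F] 3[OF F] z in auto)
  qed simp_all
  show "m \<ge> 4 \<Longrightarrow> has_dim (SV (mu4 :: 'k^3 \<Rightarrow> 'k^3 \<Rightarrow> 'k^3) m) 0"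
  proof (rule SV_0_above[where m = 4])
    fix F :: "('k^3) list \<Rightarrow> 'k" assume F: "F \<in> SV mu4 4"
    have L: "G [a, b, e3] = 0" if G: "G \<in> SV mu4 3" and "a \<in> {e1, e2, e3}" "b \<in> {e1, e2, e3}" for G :: "('k^3) list \<Rightarrow> 'k" and a b
      using facts(1-5)[OF G] 3[OF G] that(2,3) by auto
    have M: "G [a, b, c] = 0" if G: "G \<in> SV mu4 3" and "a \<in> {e1, e2, e3}" "b \<in> {e1, e2}" "c \<in> {e1, e2, e3}" for G :: "('k^3) list \<Rightarrow> 'k" and a b c
      using facts(1-5)[OF G] 3[OF G] that(2-4) by auto
    show "F = (\<lambda>_. 0)"
    proof (rule SV4_zero[OF F])
      fix a b c e :: "'k^3" assume h: "a \<in> {e1, e2, e3}" "b \<in> {e1, e2, e3}" "c \<in> {e1, e2, e3}" "e \<in> {e1, e2, e3}"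
      show "F [a, b, c, e] = 0"
      proof (cases "c = e3")
        case True
        then show ?thesis using L[OF SV4_sub(2)[OF F, of e], of a b] h by simp
      next
        case False
        then show ?thesis using M[OF SV4_sub(1)[OF F, of a], of b c e] h by simp
      qed
    qed
  qed
qed

lemma SV_3_tail_zero:
  assumes "F \<in> SV \<mu> 4" "\<And>G. G \<in> SV \<mu> 3 \<Longrightarrow> G [b, c, e] = 0"
  shows "F [a, b, c, e] = 0"
  using assms(2)[OF SV4_sub(1)[OF assms(1)], of a] .

lemma SV_3_init_zero:
  assumes "F \<in> SV \<mu> 4" "\<And>G. G \<in> SV \<mu> 3 \<Longrightarrow> G [a, b, c] = 0"
  shows "F [a, b, c, e] = 0"
  using assms(2)[OF SV4_sub(2)[OF assms(1)], of e] by simp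

lemma e_distinct [simp]:
  "e1 \<noteq> (e2 :: ('k::field)^3)" "e1 \<noteq> (e3 :: 'k^3)" "e2 \<noteq> (e1 :: 'k^3)" "e2 \<noteq> (e3 :: 'k^3)" "e3 \<noteq> (e1 :: 'k^3)" "e3 \<noteq> (e2 :: 'k^3)"
  by (simp_all add: vec3_eq_iff)

text \<open>Here y y = z y. Degree 3 is spanned by y z x and y y z, degree 4 by y y z x. In a word
  of length 5 the third letter would have to be z because of the first four letters and y because of
  the last four.\<close>

lemma dim_mu5:
  "has_dim (SV (mu5 :: ('k::field)^3 \<Rightarrow> 'k^3 \<Rightarrow> 'k^3) 3) 2" "has_dim (SV (mu5 :: ('k::field)^3 \<Rightarrow> 'k^3 \<Rightarrow> 'k^3) 4) 1"
  "m \<ge> 5 \<Longrightarrow> has_dim (SV (mu5 :: ('k::field)^3 \<Rightarrow> 'k^3 \<Rightarrow> 'k^3) m) 0"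
proof -
  have facts: "F [e1, v, w] = 0" "F [v, e1, w] = 0" "F [e2, e1, w] = 0" "F [v, e2, e1] = 0" "F [e3, e3, w] = 0" "F [v, e3, e3] = 0"
    "F [e2, e2, w] = F [e3, e2, w]" "F [v, e2, e2] = F [v, e3, e2]" if F: "F \<in> SV mu5 3" for F :: "('k^3) list \<Rightarrow> 'k" and v w
    by ((rule SV3_pairs(1)[OF F], (simp add: mu5_def vec3_eq_iff; fail)) | (rule SV3_pairs(2)[OF F], (simp add: mu5_def vec3_eq_iff; fail)) | (rule SV3_pairs(3)[OF F], (simp add: mu5_def vec3_eq_iff; fail)) | (rule SV3_pairs(4)[OF F], (simp add: mu5_def vec3_eq_iff; fail)))+
  have y: "F [a, b, e2] = 0" if F: "F \<in> SV mu5 3" and ab: "a \<in> {e1, e2, e3}" "b \<in> {e1, e2, e3}" for F :: "('k^3) list \<Rightarrow> 'k" and a b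
  proof -
    have 1: "F [e3, e2, e2] = 0" using facts(8)[OF F, of e3] facts(5)[OF F, of e2] by simp
    have 2: "F [e2, e2, e2] = 0" using facts(7)[OF F, of e2] 1 by simp
    have 3: "F [e2, e3, e2] = 0" using facts(8)[OF F, of e2] 2 by simp
    show ?thesis using ab 1 2 3 facts(1-6)[OF F] by auto
  qed
  have zero: "F [a, b, c] = 0" if F: "F \<in> SV mu5 3" and "a \<in> {e1, e2, e3}" "b \<in> {e1, e2, e3}" "c \<in> {e1, e2, e3}"
    and "\<not> (a = e2 \<and> b = e3 \<and> c = e1)" "\<not> (b = e2 \<and> c = e3)" for F :: "('k^3) list \<Rightarrow> 'k" and a b c
    using that(2-) facts(1-6)[OF F] y[OF F] by auto
  let ?F = "\<lambda>l. if length l = 3 then (l!0)$2 * (l!1)$3 * (l!2)$1 else 0 :: 'k"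
  let ?G = "\<lambda>l. if length l = 3 then ((l!0)$2 + (l!0)$3) * (l!1)$2 * (l!2)$3 else 0 :: 'k"
  have F: "?F \<in> SV mu5 3"
  proof (rule SV_3I)
    show "\<exists>\<psi>. \<forall>u v. u$2 * v$3 * w$1 = dot \<psi> (mu5 u v)" for w :: "'k^3"
      by (intro exI[of _ "vector [0, w$1, 0]"]) (simp add: mu5_def dot_def algebra_simps)
    show "\<exists>\<psi>. \<forall>v w. u$2 * v$3 * w$1 = dot \<psi> (mu5 v w)" for u :: "'k^3"
      by (intro exI[of _ "vector [0, 0, u$2]"]) (simp add: mu5_def dot_def algebra_simps)
  qed (simp_all add: lin_def algebra_simps)
  have G: "?G \<in> SV mu5 3"
  proof (rule SV_3I)
    show "\<exists>\<psi>. \<forall>u v. (u$2 + u$3) * v$2 * w$3 = dot \<psi> (mu5 u v)" for w :: "'k^3"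
      by (intro exI[of _ "vector [w$3, 0, 0]"]) (simp add: mu5_def dot_def algebra_simps)
    show "\<exists>\<psi>. \<forall>v w. (u$2 + u$3) * v$2 * w$3 = dot \<psi> (mu5 v w)" for u :: "'k^3"
      by (intro exI[of _ "vector [0, u$2 + u$3, 0]"]) (simp add: mu5_def dot_def algebra_simps)
  qed (simp_all add: lin_def algebra_simps)
  show "has_dim (SV (mu5 :: 'k^3 \<Rightarrow> 'k^3 \<Rightarrow> 'k^3) 3) 2"
  proof (rule has_dim_two[OF F G, of "[e2, e3, e1]" "[e2, e2, e3]"])
    fix H :: "('k^3) list \<Rightarrow> 'k" assume H: "H \<in> SV mu5 3" and z: "H [e2, e3, e1] = 0" "H [e2, e2, e3] = 0"
    have z3: "H [e3, e2, e3] = 0" using z(2) facts(7)[OF H, of e3] by simp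
    show "H = (\<lambda>_. 0)"
    proof (rule SV3_zero[OF H])
      fix a b c :: "'k^3" assume h: "a \<in> {e1, e2, e3}" "b \<in> {e1, e2, e3}" "c \<in> {e1, e2, e3}"
      show "H [a, b, c] = 0"
      proof (cases "b = e2 \<and> c = e3")
        case True
        then show ?thesis using z(2) z3 facts(1)[OF H] h(1) by auto
      next
        case False
        then show ?thesis using zero[OF H h] z(1) by blast
      qed
    qed
  qed simp_all
  have zero4: "F [a, b, c, e] = 0" if F: "F \<in> SV mu5 4" and h: "a \<in> {e1, e2, e3}" "b \<in> {e1, e2, e3}" "c \<in> {e1, e2, e3}" "e \<in> {e1, e2, e3}"
    and n: "\<not> (a \<in> {e2, e3} \<and> b = e2 \<and> c = e3 \<and> e = e1)" for F :: "('k^3) list \<Rightarrow> 'k" and a b c e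
  proof (cases "b = e2 \<and> c = e3 \<and> e = e1")
    case True
    then have "a = e1" using n h by auto
    show ?thesis by (rule SV_3_init_zero[OF F]) (use facts(1) \<open>a = e1\<close> in auto)
  next
    case False
    show ?thesis
    proof (cases "c = e2 \<and> e = e3")
      case True
      have "\<not> (a = e2 \<and> b = e3 \<and> c = e1)" "\<not> (b = e2 \<and> c = e3)" using True by auto
      then show ?thesis by (intro SV_3_init_zero[OF F] zero[OF _ h(1-3)])
    next
      case False2: False
      show ?thesis
      proof (cases "b = e2 \<and> c = e3")
        case True
        then have "e \<in> {e2, e3}" using False h by auto
        then show ?thesis by (intro SV_3_tail_zero[OF F] zero[OF _ h(2-4)]) (use True in auto)
      next
        case n3: False
        show ?thesis
        proof (cases "b = e2 \<and> c = e3 \<or> a = e2 \<and> b = e3 \<and> c = e1")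
          case True
          then have "c = e1" using n3 by auto
          show ?thesis by (rule SV_3_tail_zero[OF F]) (use facts(2) \<open>c = e1\<close> in auto)
        next
          case False
          then show ?thesis by (intro SV_3_init_zero[OF F] zero[OF _ h(1-3)]) auto
        qed
      qed
    qed
  qed
  show "has_dim (SV (mu5 :: 'k^3 \<Rightarrow> 'k^3 \<Rightarrow> 'k^3) 4) 1"
  proof (rule has_dim_one[of "cons_form (\<lambda>v l. (v$2 + v$3) * ?F l)" _ "[e2, e2, e3, e1]"])
    have "cons_form (\<lambda>v l. (v$2 + v$3) * ?F l) \<in> SV mu5 (Suc 3)"
    proof (rule SV_consI)
      show "(\<lambda>l. cons_form (\<lambda>v l. (v$2 + v$3) * ?F l) (v # l)) \<in> SV mu5 3" for v :: "'k^3"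
        using fsub_SV_scale[OF F, of "v$2 + v$3"] by simp
      show "\<exists>\<psi>. \<forall>u v. cons_form (\<lambda>v l. (v$2 + v$3) * ?F l) (u # v # s) = dot \<psi> (mu5 u v)" if "Suc (length s) = 3" for s :: "('k^3) list"
        using that by (intro exI[of _ "vector [(s!0)$3 * (s!1)$1, 0, 0]"]) (simp add: mu5_def dot_def algebra_simps)
    qed (simp_all add: lin_def algebra_simps)
    then show "cons_form (\<lambda>v l. (v$2 + v$3) * ?F l) \<in> SV mu5 4" by simp
    fix H :: "('k^3) list \<Rightarrow> 'k" assume H: "H \<in> SV mu5 4" and z: "H [e2, e2, e3, e1] = 0"
    have z3: "H [e3, e2, e3, e1] = 0" using z facts(7)[OF SV4_sub(2)[OF H], of e3 e1] by simp
    show "H = (\<lambda>_. 0)"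
    proof (rule SV4_zero[OF H])
      fix a b c e :: "'k^3" assume h: "a \<in> {e1, e2, e3}" "b \<in> {e1, e2, e3}" "c \<in> {e1, e2, e3}" "e \<in> {e1, e2, e3}"
      show "H [a, b, c, e] = 0"
        using zero4[OF H h] z z3 by blast
    qed
  qed simp
  show "m \<ge> 5 \<Longrightarrow> has_dim (SV (mu5 :: 'k^3 \<Rightarrow> 'k^3 \<Rightarrow> 'k^3) m) 0"
  proof (rule SV_0_above[where m = 5])
    fix F :: "('k^3) list \<Rightarrow> 'k" assume F: "F \<in> SV mu5 5"
    show "F = (\<lambda>_. 0)"
    proof (rule SV_zero[OF F])
      fix l :: "('k^3) list" assume l: "set l \<subseteq> {e1, e2, e3}" "length l = 5"
      then obtain a b c e f where l': "l = [a, b, c, e, f]" by (auto simp: length_Suc_conv eval_nat_numeral)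
      have S: "(\<lambda>l. F (a # l)) \<in> SV mu5 4" "(\<lambda>l. F (l @ [f])) \<in> SV mu5 4"
        by (rule SV_cons, use F in \<open>simp add: eval_nat_numeral\<close>) (rule SV_snoc, use F in \<open>simp add: eval_nat_numeral\<close>)
      show "F l = 0"
      proof (cases "c = e3")
        case False
        then show ?thesis using zero4[OF S(2), of a b c e] l l' by simp
      next
        case True
        then show ?thesis using zero4[OF S(1), of b c e f] l l' by simp
      qed
    qed
  qed
qed

text \<open>Here z y = y y. Degree 3 is spanned by z z z and y y x, and the latter has no nonzero
  continuation on either side, so from degree 4 on only the power of z survives.\<close>

lemma dim_mu6:
  "has_dim (SV (mu6 :: ('k::field)^3 \<Rightarrow> 'k^3 \<Rightarrow> 'k^3) 3) 2" "m \<ge> 4 \<Longrightarrow> has_dim (SV (mu6 :: ('k::field)^3 \<Rightarrow> 'k^3 \<Rightarrow> 'k^3) m) 1"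
proof -
  have facts: "F [e1, v, w] = 0" "F [v, e1, w] = 0" "F [e3, e1, w] = 0" "F [v, e3, e1] = 0" "F [e2, e3, w] = 0" "F [v, e2, e3] = 0"
    "F [e3, e2, w] = F [e2, e2, w]" "F [v, e3, e2] = F [v, e2, e2]" if F: "F \<in> SV mu6 3" for F :: "('k^3) list \<Rightarrow> 'k" and v w
    by ((rule SV3_pairs(1)[OF F], (simp add: mu6_def vec3_eq_iff; fail)) | (rule SV3_pairs(2)[OF F], (simp add: mu6_def vec3_eq_iff; fail)) | (rule SV3_pairs(3)[OF F], (simp add: mu6_def vec3_eq_iff; fail)) | (rule SV3_pairs(4)[OF F], (simp add: mu6_def vec3_eq_iff; fail)))+
  have y: "F [e2, e2, e2] = 0" "F [e3, e2, e2] = 0" "F [e3, e3, e2] = 0" if F: "F \<in> SV mu6 3" for F :: "('k^3) list \<Rightarrow> 'k"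
  proof -
    show 1: "F [e2, e2, e2] = 0" using facts(8)[OF F, of e2] facts(5)[OF F, of e2] by simp
    show 2: "F [e3, e2, e2] = 0" using facts(7)[OF F, of e2] 1 by simp
    show 3: "F [e3, e3, e2] = 0" using facts(8)[OF F, of e3] 2 by simp
  qed
  have zero: "F [a, b, c] = 0" if F: "F \<in> SV mu6 3" and "a \<in> {e1, e2, e3}" "b \<in> {e1, e2, e3}" "c \<in> {e1, e2, e3}"
    and "\<not> (a = e3 \<and> b = e3 \<and> c = e3)" "\<not> (b = e2 \<and> c = e1)" for F :: "('k^3) list \<Rightarrow> 'k" and a b c
    using that(2-) facts(1-6)[OF F] y[OF F] by auto
  have e: "\<And>u v :: 'k^3. u$3 * v$3 = dot e1 (mu6 u v)" by (simp add: mu6_def)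
  have T: "(\<lambda>l. if length l = m then tail_form (\<lambda>v. v$3) l else 0) \<in> SV (mu6 :: 'k^3 \<Rightarrow> 'k^3 \<Rightarrow> 'k^3) m" if "m \<ge> 1" for m
    by (rule tail_form_SV[OF lin_nth e e that])
  let ?G = "\<lambda>l. if length l = 3 then ((l!0)$2 + (l!0)$3) * (l!1)$2 * (l!2)$1 else 0 :: 'k"
  have G: "?G \<in> SV mu6 3"
  proof (rule SV_3I)
    show "\<exists>\<psi>. \<forall>u v. (u$2 + u$3) * v$2 * w$1 = dot \<psi> (mu6 u v)" for w :: "'k^3"
      by (intro exI[of _ "vector [0, w$1, 0]"]) (simp add: mu6_def dot_def algebra_simps)
    show "\<exists>\<psi>. \<forall>v w. (u$2 + u$3) * v$2 * w$1 = dot \<psi> (mu6 v w)" for u :: "'k^3"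
      by (intro exI[of _ "vector [0, 0, u$2 + u$3]"]) (simp add: mu6_def dot_def algebra_simps)
  qed (simp_all add: lin_def algebra_simps)
  show "has_dim (SV (mu6 :: 'k^3 \<Rightarrow> 'k^3 \<Rightarrow> 'k^3) 3) 2"
  proof (rule has_dim_two[OF T[of 3] G, of "[e3, e3, e3]" "[e2, e2, e1]"])
    fix H :: "('k^3) list \<Rightarrow> 'k" assume H: "H \<in> SV mu6 3" and z: "H [e3, e3, e3] = 0" "H [e2, e2, e1] = 0"
    have z3: "H [e3, e2, e1] = 0" using z(2) facts(7)[OF H, of e1] by simp
    show "H = (\<lambda>_. 0)"
    proof (rule SV3_zero[OF H])
      fix a b c :: "'k^3" assume h: "a \<in> {e1, e2, e3}" "b \<in> {e1, e2, e3}" "c \<in> {e1, e2, e3}"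
      show "H [a, b, c] = 0"
      proof (cases "b = e2 \<and> c = e1")
        case True
        then show ?thesis using z(2) z3 facts(1)[OF H] h(1) by auto
      next
        case False
        then show ?thesis using zero[OF H h] z(1) by blast
      qed
    qed
  qed simp_all
  \<comment> \<open>A word other than the power of z has an initial or a final part, shorter by one
    letter, that is not a power of z either; induction makes it vanish.\<close>
  have zero4: "F l = 0" if "m \<ge> 4" "F \<in> SV mu6 m" "set l \<subseteq> {e1, e2, e3}" "length l = m" "l \<noteq> replicate m e3" for F :: "('k^3) list \<Rightarrow> 'k" and l m
    using that
  proof (induction m arbitrary: F l rule: dec_induct)
    case base
    then obtain a b c e where l: "l = [a, b, c, e]" by (auto simp: length_Suc_conv eval_nat_numeral)
    note F = \<open>F \<in> SV mu6 4\<close>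
    have h: "a \<in> {e1, e2, e3}" "b \<in> {e1, e2, e3}" "c \<in> {e1, e2, e3}" "e \<in> {e1, e2, e3}" using base l by auto
    have "F [a, b, c, e] = 0"
    proof (cases "c = e2 \<and> e = e1")
      case True
      have "\<not> (a = e3 \<and> b = e3 \<and> c = e3)" "\<not> (b = e2 \<and> c = e1)" using True by auto
      then show ?thesis by (intro SV_3_init_zero[OF F] zero[OF _ h(1-3)])
    next
      case False
      show ?thesis
      proof (cases "b = e3 \<and> c = e3 \<and> e = e3")
        case True
        then have "a \<noteq> e3" using base(4) l by (auto simp: eval_nat_numeral)
        then have "\<not> (a = e3 \<and> b = e3 \<and> c = e3)" "\<not> (b = e2 \<and> c = e1)" using True by auto
        then show ?thesis by (intro SV_3_init_zero[OF F] zero[OF _ h(1-3)])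
      next
        case n: False
        show ?thesis by (rule SV_3_tail_zero[OF F], rule zero[OF _ h(2-4) n False])
      qed
    qed
    then show ?case using l by simp
  next
    case (step m)
    obtain a l' where l: "l = a # l'" "length l' = m" using step.prems(3) by (cases l) auto
    show ?case
    proof (cases "l' = replicate m e3")
      case False
      show ?thesis using step.IH[OF SV_cons[OF step.prems(1), of a], of l'] step.prems l False by simp
    next
      case True
      then have a: "a \<noteq> e3" using step.prems(4) l by simp
      obtain k where k: "m = Suc k" using step.hyps by (cases m) auto
      have "F ((a # replicate k e3) @ [e3]) = 0"
        by (rule step.IH[OF SV_snoc[OF step.prems(1), of e3], of "a # replicate k e3"])
          (use step.prems l a k in auto)
      then show ?thesis using l True k by (simp add: replicate_append_same)
    qed
  qed
  show "m \<ge> 4 \<Longrightarrow> has_dim (SV (mu6 :: 'k^3 \<Rightarrow> 'k^3 \<Rightarrow> 'k^3) m) 1"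
  proof (rule has_dim_one[OF T, of m "replicate (m - 1) e3 @ [e3]"])
    assume m: "m \<ge> 4"
    then show "1 \<le> m" by simp
    have r: "replicate (m - 1) e3 @ [e3] = replicate m (e3 :: 'k^3)" using m by (cases m) (auto simp: replicate_append_same)
    show "(if length (replicate (m - 1) e3 @ [e3]) = m then tail_form (\<lambda>v. v$3) (replicate (m - 1) e3 @ [e3]) else 0) = (1 :: 'k)"
      unfolding tail_form_replicate using m by simp
    fix F :: "('k^3) list \<Rightarrow> 'k" assume F: "F \<in> SV mu6 m" and z: "F (replicate (m - 1) e3 @ [e3]) = 0"
    show "F = (\<lambda>_. 0)"
    proof (rule SV_zero[OF F])
      fix l :: "('k^3) list" assume l: "set l \<subseteq> {e1, e2, e3}" "length l = m"
      show "F l = 0"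
        by (cases "l = replicate m e3") (use z r in simp, rule zero4[OF m F l])
    qed
  qed
qed

text \<open>Left multiplication by \<open>e1\<close> and by \<open>e2\<close> is zero, so a
  surviving word has \<open>e3\<close> everywhere except at the end, where any letter may
  stand.\<close>

lemma dim_mu8: "m \<ge> 3 \<Longrightarrow> has_dim (SV (mu8 :: ('k::field)^3 \<Rightarrow> 'k^3 \<Rightarrow> 'k^3) m) 3"
proof -
  assume m: "m \<ge> 3"
  have T: "(\<lambda>l. if length l = m then tail_form (\<lambda>v. v$i) l else 0) \<in> SV (mu8 :: 'k^3 \<Rightarrow> 'k^3 \<Rightarrow> 'k^3) m" for i
  proof (rule tail_form_SV[OF lin_nth])
    show "u$3 * v$3 = dot e3 (mu8 u v)" for u v :: "'k^3" by (simp add: mu8_def)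
    show "u$3 * v$i = dot (if i = 1 then e1 else if i = 2 then e2 else e3) (mu8 u v)" for u v :: "'k^3"
      using exhaust_3[of i] by (auto simp: mu8_def)
  qed (use m in simp)
  let ?p = "\<lambda>e. replicate (m - 1) e3 @ [e :: 'k^3]"
  show ?thesis
  proof (rule has_dim_three[OF T[of 1] T[of 2] T[of 3], of "?p e1" "?p e2" "?p e3"])
    fix F :: "('k^3) list \<Rightarrow> 'k" assume F: "F \<in> SV mu8 m" and z: "F (?p e1) = 0" "F (?p e2) = 0" "F (?p e3) = 0"
    show "F = (\<lambda>_. 0)"
    proof (rule SV_zero[OF F])
      fix l :: "('k^3) list" assume l: "set l \<subseteq> {e1, e2, e3}" "length l = m"
      then have "(\<exists>p s e. l = p @ e # s \<and> s \<noteq> [] \<and> e \<in> {e1, e2}) \<or> (\<exists>e\<in>{e1, e2, e3}. l = ?p e)"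
        using basis_list_cases[of l "m - 1"] m by simp
      then show "F l = 0"
      proof
        assume "\<exists>p s e. l = p @ e # s \<and> s \<noteq> [] \<and> e \<in> {e1, e2}"
        then obtain p s e where e: "l = p @ e # s" "s \<noteq> []" "e \<in> {e1, e2}" by blast
        obtain w s' where s: "s = w # s'" using e(2) by (cases s) auto
        show ?thesis unfolding e(1) s by (rule SV_pair_zero[OF F]) (use e(3) in \<open>auto simp: mu8_def vec3_eq_iff\<close>)
      qed (use z in auto)
    qed
  qed (use m in \<open>simp_all add: tail_form_replicate\<close>)
qed

subsection \<open>Hilbert series\<close>

lemma series_quotientI:
  fixes f g h :: "rat fps"
  assumes "f * g = h" "fps_nth g 0 \<noteq> 0"
  shows "f = h / g"
proof -
  have "g \<noteq> 0" using assms(2) by auto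
  then show ?thesis using assms(1) by (metis nonzero_mult_div_cancel_right)
qed

lemma series_cases:
  fixes f g :: "rat fps"
  assumes "fps_nth f 0 = fps_nth g 0" "fps_nth f 1 = fps_nth g 1" "fps_nth f 2 = fps_nth g 2"
    "fps_nth f 3 = fps_nth g 3" "fps_nth f 4 = fps_nth g 4" "\<And>m. m \<ge> 5 \<Longrightarrow> fps_nth f m = fps_nth g m"
  shows "f = g"
proof (rule fps_ext)
  fix m :: nat
  have "m = 0 \<or> m = 1 \<or> m = 2 \<or> m = 3 \<or> m = 4 \<or> m \<ge> 5" by linarith
  then show "fps_nth f m = fps_nth g m" using assms by blast
qed

abbreviation series :: "(nat \<Rightarrow> nat) \<Rightarrow> rat fps" where
  "series d \<equiv> Abs_fps (\<lambda>m. of_nat (d m))"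

context
  fixes d :: "nat \<Rightarrow> nat"
  assumes d012: "d 0 = 1" "d 1 = 3" "d 2 = 3"
begin

lemma series_mult_nth:
  "fps_nth (series d * fps_X ^ k) m = (if m < k then 0 else of_nat (d (m - k)))"
  "fps_nth (fps_const c * fps_X ^ k) m = (if m = k then c else (0::rat))"
  by (auto simp: fps_X_power_mult_right_nth)

lemma series_1: "\<forall>m\<ge>3. d m = 0 \<Longrightarrow> series d = 1 + 3 * fps_X + 3 * fps_X ^ 2"
  by (rule series_cases) (use d012 in \<open>simp_all add: numeral_fps_const\<close>)

lemma series_2: "d 3 = 1 \<Longrightarrow> \<forall>m\<ge>4. d m = 0 \<Longrightarrow> series d = (1 + fps_X) ^ 3"
proof -
  assume "d 3 = 1" "\<forall>m\<ge>4. d m = 0"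
  then have "series d = 1 + 3 * fps_X + 3 * fps_X ^ 2 + fps_X ^ 3"
    by (intro series_cases) (use d012 in \<open>simp_all add: numeral_fps_const\<close>)
  then show ?thesis by (simp add: power3_eq_cube power2_eq_square algebra_simps)
qed

lemma series_3: "\<forall>m\<ge>3. d m = 1 \<Longrightarrow> series d = (1 + 2 * fps_X - 2 * fps_X ^ 3) / (1 - fps_X)"
  by (rule series_quotientI, rule series_cases) (use d012 in \<open>simp_all add: numeral_fps_const right_diff_distrib\<close>)

lemma series_4: "d 3 = 2 \<Longrightarrow> \<forall>m\<ge>4. d m = 0 \<Longrightarrow> series d = 1 + 3 * fps_X + 3 * fps_X ^ 2 + 2 * fps_X ^ 3"
  by (rule series_cases) (use d012 in \<open>simp_all add: numeral_fps_const\<close>)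

lemma series_5: "d 3 = 2 \<Longrightarrow> d 4 = 1 \<Longrightarrow> \<forall>m\<ge>5. d m = 0 \<Longrightarrow>
    series d = 1 + 3 * fps_X + 3 * fps_X ^ 2 + 2 * fps_X ^ 3 + fps_X ^ 4"
  by (rule series_cases) (use d012 in \<open>simp_all add: numeral_fps_const\<close>)

lemma series_6: "d 3 = 2 \<Longrightarrow> \<forall>m\<ge>4. d m = 1 \<Longrightarrow>
    series d = (1 + 2 * fps_X - fps_X ^ 3 - fps_X ^ 4) / (1 - fps_X)"
  by (rule series_quotientI, rule series_cases) (use d012 in \<open>simp_all add: numeral_fps_const right_diff_distrib\<close>)

lemma series_7: "\<forall>m\<ge>3. d m = 2 \<Longrightarrow> series d = (1 + 2 * fps_X - fps_X ^ 3) / (1 - fps_X)"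
  by (rule series_quotientI, rule series_cases) (use d012 in \<open>simp_all add: numeral_fps_const right_diff_distrib\<close>)

lemma series_8: "\<forall>m\<ge>3. d m = 3 \<Longrightarrow> series d = (1 + 2 * fps_X) / (1 - fps_X)"
  by (rule series_quotientI, rule series_cases) (use d012 in \<open>simp_all add: numeral_fps_const right_diff_distrib\<close>)

lemma series_9: "\<forall>m\<ge>3. d m = 4 \<Longrightarrow> series d = (1 + 2 * fps_X + fps_X ^ 3) / (1 - fps_X)"
  by (rule series_quotientI, rule series_cases) (use d012 in \<open>simp_all add: numeral_fps_const right_diff_distrib\<close>)

lemma series_10:
  assumes "\<forall>m\<ge>3. d m = m + 1"
  shows "series d = (1 + fps_X - 2 * fps_X ^ 2 + fps_X ^ 3) / (1 - fps_X) ^ 2"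
proof (rule series_quotientI)
  \<comment> \<open>Written with shifted copies of the series, the coefficients can be read off by
    \<open>series_mult_nth\<close>.\<close>
  have "series d * (1 - fps_X) ^ 2 =
      series d - fps_const 2 * (series d * fps_X ^ 1) + series d * fps_X ^ 2"
    by (simp add: power2_eq_square algebra_simps flip: numeral_fps_const)
  also have "\<dots> = 1 + fps_X - 2 * fps_X ^ 2 + fps_X ^ 3"
    by (rule series_cases) (use d012 assms in \<open>simp_all only: fps_add_nth fps_sub_nth fps_mult_left_const_nth series_mult_nth fps_nth_Abs_fps numeral_fps_const, simp_all add: of_nat_diff\<close>)
  finally show "series d * (1 - fps_X) ^ 2 = 1 + fps_X - 2 * fps_X ^ 2 + fps_X ^ 3" .
qed (simp add: power2_eq_square)

lemma series_11:
  assumes "d 3 = 5" "d 4 = 8" "\<forall>m\<ge>3. d (m + 2) = d (m + 1) + d m"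
  shows "series d = (1 + 2 * fps_X - fps_X ^ 2 - fps_X ^ 3) / (1 - fps_X - fps_X ^ 2)"
proof (rule series_quotientI, rule series_cases)
  fix m :: nat assume m: "m \<ge> 5"
  then obtain k where k: "m = k + 5" using le_Suc_ex by (metis add.commute)
  have "d (k + 5) = d (4 + k) + d (3 + k)" using assms(3)[rule_format, of "k + 3"] by (simp add: algebra_simps)
  then show "fps_nth (series d * (1 - fps_X - fps_X ^ 2)) m = fps_nth (1 + 2 * fps_X - fps_X ^ 2 - fps_X ^ 3) m"
    using m by (simp add: numeral_fps_const right_diff_distrib fps_X_power_mult_right_nth k)
qed (use d012 assms in \<open>simp_all add: numeral_fps_const right_diff_distrib fps_X_power_mult_right_nth\<close>)

end

section \<open>Passage between algebras and multiplications, and the final comparison\<close>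

lemma component_dim_0:
  assumes "quadratic_relations n R"
  shows "component_dim n R 0 = 1"
proof (rule component_dim_eq[OF assms], rule has_dim_one[of "\<lambda>w. if w = [] then 1 else 0" _ "[]"])
  fix f assume f: "f \<in> ann n R 0" "f [] = 0"
  then have "f w = 0" for w using annD(1)[OF f(1), of w] by auto
  then show "f = (\<lambda>_. 0)" by auto
qed (auto simp: ann_def)

lemma component_dim_1:
  assumes "quadratic_relations n R"
  shows "component_dim n R 1 = n"
proof (rule component_dim_eq[OF assms], rule has_dimI[of _ "\<lambda>i w. if w = [i] then 1 else 0" _ "\<lambda>i. [i]"])
  fix f assume f: "f \<in> ann n R 1" "\<And>i. i < n \<Longrightarrow> f [i] = 0"
  have "f w = 0" for w
  proof (rule ccontr)
    assume "f w \<noteq> 0"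
    moreover from annD(1)[OF f(1) this] obtain i where "w = [i]" "i < n" by (auto simp: length_Suc_conv)
    ultimately show False using f(2) by simp
  qed
  then show "f = (\<lambda>_. 0)" by auto
qed (auto simp: ann_def)

lemma spanning_mu_of:
  assumes "\<And>k. k < 3 \<Longrightarrow> p k < 3 \<and> q k < 3" "\<And>k l. k < 3 \<Longrightarrow> l < 3 \<Longrightarrow> c (p k) (q k) l = (if k = l then 1 else 0)"
  shows "spanning (mu_of c)"
  unfolding spanning_def
proof (intro allI impI)
  fix \<psi> :: "'a^3" assume z: "\<forall>u v. dot \<psi> (mu_of c u v) = 0"
  have "\<psi> $ idx k = 0" if k: "k < 3" for k
  proof -
    have "p k = 0 \<or> p k = 1 \<or> p k = 2" "q k = 0 \<or> q k = 1 \<or> q k = 2" using assms(1)[OF k] by auto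
    then have "dot \<psi> (mu_of c (bv (p k)) (bv (q k))) = (\<Sum>l<3. \<psi> $ idx l * c (p k) (q k) l)"
      by (elim disjE) (simp_all add: dot_def mu_of_def sum_less_3 bv_def)
    also have "\<dots> = (\<Sum>l<3. if k = l then \<psi> $ idx l else 0)"
      by (intro sum.cong) (use assms(2)[OF k] in auto)
    also have "\<dots> = \<psi> $ idx k" using k by simp
    finally show ?thesis using z by simp
  qed
  from this[of 0] this[of 1] this[of 2] show "\<psi> = 0" by (simp add: vec3_eq_iff)
qed

text \<open>The structure constants \<open>F k [i, j]\<close> are read in the closure. The words
  \<open>P k\<close> of the dual system are products of letters equal to basis vectors of the
  target, which gives \<open>spanning\<close>; the dimensions are carried over by
  \<open>has_dim_SW_extend\<close>.\<close>

theorem allowed_component_dim: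
  fixes R :: "'k::field ncpoly set"
  assumes R: "quadratic_relations 3 R" and d2: "component_dim 3 R 2 = 3"
  shows "allowed (component_dim 3 R)"
proof -
  have hd: "has_dim (ann 3 R m) (component_dim 3 R m)" for m
    using ex_has_dim_ann[of 3 R m] component_dim_eq[OF R] by metis
  obtain F P where FP: "dual_system (ann 3 R 2) 3 F P"
    using hd[of 2] unfolding d2 has_dim_def by blast
  have P: "P k = [P k ! 0, P k ! 1] \<and> P k ! 0 < 3 \<and> P k ! 1 < 3" if k: "k < 3" for k
  proof -
    have "F k (P k) \<noteq> 0" using dual_systemD(2)[OF FP k k] by simp
    then have "length (P k) = 2" "set (P k) \<subseteq> {..<3}" using annD(1)[OF dual_systemD(1)[OF FP k]] by blast+
    then show ?thesis by (auto simp: length_Suc_conv eval_nat_numeral)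
  qed
  let ?c = "\<lambda>i j k. to_ac (F k [i, j])"
  have "quadratic_dims (mu_of ?c) (component_dim 3 R)"
  proof
    show "bil (mu_of ?c)" by (rule bil_mu_of)
    show "spanning (mu_of ?c)"
      by (rule spanning_mu_of[of "\<lambda>k. P k ! 0" "\<lambda>k. P k ! 1"])
        (use P in blast, use P dual_systemD(2)[OF FP] in \<open>metis to_ac_0 to_ac_1\<close>)
    show "has_dim (SV (mu_of ?c) m) (component_dim 3 R m)" for m
      using hd[of m] unfolding ann_eq_SW[OF R FP] by (intro has_dim_SW_SV has_dim_SW_extend)
  qed
  then show ?thesis by (rule quadratic_dims.allowed_dims)
qed

lemma single_free_component: "length w = m \<Longrightarrow> set w \<subseteq> {..<n} \<Longrightarrow> Poly_Mapping.single (Word w) c \<in> free_component n m"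
  by (cases "c = 0") (auto simp: free_component_def free_algebra_def)

lemma mu_of_bv:
  assumes "bil \<mu>"
  shows "mu_of (\<lambda>i j k. \<mu> (bv i) (bv j) $ idx k) = \<mu>"
proof (intro ext)
  fix u v
  have l: "vlin (\<mu> u)" "vlin (\<lambda>u. \<mu> u v)" for u v using assms by (auto simp: bil_def)
  have "\<mu> u v = u$1 *s \<mu> e1 v + u$2 *s \<mu> e2 v + u$3 *s \<mu> e3 v" by (rule vlin_expand[OF l(2)])
  then show "mu_of (\<lambda>i j k. \<mu> (bv i) (bv j) $ idx k) u v = \<mu> u v"
    unfolding vlin_expand[OF l(1), of _ v]
    by (simp add: mu_of_def sum_less_3 bv_def vec3_eq_iff algebra_simps)
qed

text \<open>\<open>R\<close> is the kernel of the map that \<open>\<mu>\<close> induces on words of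
  length two, cut out by its three coordinate functionals. That every basis vector is a product of
  basis vectors supplies the points \<open>[p k, q k]\<close> of a dual system, so these functionals
  are a basis of the whole dual of \<open>A\<^sub>2\<close>.\<close>

theorem realize:
  fixes \<mu> :: "('k::field)^3 \<Rightarrow> 'k^3 \<Rightarrow> 'k^3"
  assumes bil: "bil \<mu>" and pq: "\<And>k. k < 3 \<Longrightarrow> p k < 3 \<and> q k < 3 \<and> \<mu> (bv (p k)) (bv (q k)) = bv k"
  obtains R :: "'k ncpoly set" where "quadratic_relations 3 R" "component_dim 3 R 1 = 3" "component_dim 3 R 2 = 3"
    "\<And>m k. has_dim (SV \<mu> m) k \<Longrightarrow> component_dim 3 R m = k"
proof -
  define B where "B k w = (if length w = 2 \<and> set w \<subseteq> {..<3} then \<mu> (bv (w!0)) (bv (w!1)) $ idx k else 0)" for k w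
  define R where "R = {f \<in> free_component 3 2. \<forall>k<3. ev (B k) f = 0}"
  have "Modules.module (\<lambda>c (f :: 'k ncpoly). const c * f)"
    by unfold_locales (auto simp: const_def distrib_left distrib_right mult_single single_add simp flip: mult.assoc)
  then have R: "quadratic_relations 3 R"
    unfolding quadratic_relations_def R_def
    by (auto simp: Modules.module.subspace_def free_component_ops ev_add ev_const_mult)
  have B: "B k [i, j] = \<mu> (bv i) (bv j) $ idx k" if "i < 3" "j < 3" for i j k
    using that by (simp add: B_def)
  have bv_idx: "bv l $ idx k = (if k = l then 1 else (0 :: 'k))" if "k < 3" "l < 3" for k l
  proof -
    have "k = 0 \<or> k = 1 \<or> k = 2" "l = 0 \<or> l = 1 \<or> l = 2" using that by auto
    then show ?thesis by (elim disjE) (simp_all add: bv_def)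
  qed
  have FP: "dual_system (ann 3 R 2) 3 B (\<lambda>k. [p k, q k])"
    unfolding dual_system_def
  proof (intro conjI allI impI ballI)
    show "B k \<in> ann 3 R 2" if "k < 3" for k
      using that unfolding ann_def by (auto simp: R_def B_def split: if_splits)
    show BP: "B k [p l, q l] = (if k = l then 1 else 0)" if "k < 3" "l < 3" for k l
      using pq[OF that(2)] bv_idx[OF that] by (simp add: B)
    fix \<phi> assume \<phi>: "\<phi> \<in> ann 3 R 2" "\<forall>k<3. \<phi> [p k, q k] = 0"
    have "\<phi> w = 0" if w: "length w = 2" "set w \<subseteq> {..<3}" for w
    proof -
      let ?s = "\<lambda>w c. Poly_Mapping.single (Word w) c :: 'k ncpoly"
      \<comment> \<open>The word \<open>w\<close> minus the combination of the words
        \<open>[p k, q k]\<close> with the same product lies in \<open>R\<close>, so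
        \<open>\<phi> w\<close> is determined by the values of \<open>\<phi>\<close> at these
        words.\<close>
      let ?f = "?s w 1 + (\<Sum>k<3. ?s [p k, q k] (- B k w))"
      have "?s w 1 \<in> free_component 3 2" "\<And>k. k < 3 \<Longrightarrow> ?s [p k, q k] (- B k w) \<in> free_component 3 2"
        using w pq by (auto intro!: single_free_component)
      then have "?f \<in> free_component 3 2" by (auto simp: sum_less_3 intro!: free_component_ops)
      moreover have "ev (B l) ?f = 0" if "l < 3" for l
      proof -
        have "ev (B l) ?f = B l w + (\<Sum>k<3. - B k w * B l [p k, q k])" by (simp add: ev_add ev_sum)
        also have "(\<Sum>k<3. - B k w * B l [p k, q k]) = (\<Sum>k<3. if l = k then - B k w else 0)"
          by (intro sum.cong) (use BP that in auto)
        finally show ?thesis using that by simp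
      qed
      ultimately have "ev \<phi> ?f = 0" using annD(2)[OF \<phi>(1), of ?f "[]" "[]"] by (simp add: R_def)
      then show ?thesis using \<phi>(2) by (simp add: ev_add ev_sum)
    qed
    then show "\<phi> = (\<lambda>_. 0)" using annD(1)[OF \<phi>(1)] by blast
  qed
  have "mu_of (\<lambda>i j k. B k [i, j]) = mu_of (\<lambda>i j k. \<mu> (bv i) (bv j) $ idx k)"
    by (auto simp: mu_of_def B sum_less_3 fun_eq_iff)
  then have mu: "mu_of (\<lambda>i j k. B k [i, j]) = \<mu>" using mu_of_bv[OF bil] by simp
  have "component_dim 3 R m = k" if "has_dim (SV \<mu> m) k" for m k
  proof -
    have "has_dim (SV \<mu> m) (component_dim 3 R m)"
      using ex_has_dim_ann[of 3 R m] component_dim_eq[OF R] has_dim_SW_SV[of "\<lambda>i j k. B k [i, j]" m]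
      unfolding ann_eq_SW[OF R FP] mu by metis
    then show ?thesis using has_dim_unique[OF fsub_SV] that by blast
  qed
  moreover have "component_dim 3 R 2 = 3" using component_dim_eq[OF R, of 2 3] FP unfolding has_dim_def by blast
  ultimately show ?thesis using that[OF R component_dim_1[OF R]] by blast
qed

text \<open>The hypothesis \<open>H\<close> speaks of any sequence with the dimensions of
  \<open>\<mu>\<close>, which keeps relation spaces and polynomials out of the individual
  examples.\<close>

lemma realize_series:
  fixes \<mu> :: "('k::field)^3 \<Rightarrow> 'k^3 \<Rightarrow> 'k^3"
  assumes bil: "bil \<mu>" and e: "\<forall>e\<in>{e1, e2, e3}. \<exists>a\<in>{e1, e2, e3}. \<exists>b\<in>{e1, e2, e3}. \<mu> a b = e"
    and H: "\<And>d. d 0 = 1 \<Longrightarrow> d 1 = 3 \<Longrightarrow> d 2 = 3 \<Longrightarrow> (\<And>m k. has_dim (SV \<mu> m) k \<Longrightarrow> d m = k) \<Longrightarrow> series d = H"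
  shows "H \<in> {hilbert_series n R | (n :: nat) (R :: 'k ncpoly set).
      quadratic_relations n R \<and> component_dim n R 1 = 3 \<and> component_dim n R 2 = 3}"
proof -
  have bv: "\<exists>i<3. a = bv i" if "a \<in> {e1, e2, e3}" for a :: "'k^3"
  proof -
    have "bv 0 = (e1 :: 'k^3)" "bv 1 = (e2 :: 'k^3)" "bv 2 = (e3 :: 'k^3)" by (simp_all add: bv_def)
    moreover have "0 < (3::nat)" "1 < (3::nat)" "2 < (3::nat)" by simp_all
    ultimately show ?thesis using that by (metis insertE empty_iff)
  qed
  have "\<exists>i j. i < 3 \<and> j < 3 \<and> \<mu> (bv i) (bv j) = bv k" for k
  proof -
    have "bv k \<in> {e1, e2, e3 :: 'k^3}" by (simp add: bv_def)
    from bspec[OF e this] obtain a b where "a \<in> {e1, e2, e3}" "b \<in> {e1, e2, e3}" "\<mu> a b = bv k" by meson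
    then show ?thesis using bv[of a] bv[of b] by metis
  qed
  then obtain p q where "\<And>k. p k < 3 \<and> q k < 3 \<and> \<mu> (bv (p k)) (bv (q k)) = bv k" by metis
  then obtain R :: "'k ncpoly set" where R: "quadratic_relations 3 R" "component_dim 3 R 1 = 3" "component_dim 3 R 2 = 3"
    "\<And>m k. has_dim (SV \<mu> m) k \<Longrightarrow> component_dim 3 R m = k"
    using realize[OF bil, of p q] by blast
  then have "series (component_dim 3 R) = H" by (intro H component_dim_0) auto
  then show ?thesis using R unfolding hilbert_series_def by blast
qed

theorem theorem1p1:
  shows "{hilbert_series n R | (n :: nat) (R :: 'k::field ncpoly set).
            quadratic_relations n R \<and> component_dim n R 1 = 3 \<and> component_dim n R 2 = 3}
       = {1 + 3 * fps_X + 3 * fps_X ^ 2,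
          (1 + fps_X) ^ 3,
          (1 + 2 * fps_X - 2 * fps_X ^ 3) / (1 - fps_X),
          1 + 3 * fps_X + 3 * fps_X ^ 2 + 2 * fps_X ^ 3,
          1 + 3 * fps_X + 3 * fps_X ^ 2 + 2 * fps_X ^ 3 + fps_X ^ 4,
          (1 + 2 * fps_X - fps_X ^ 3 - fps_X ^ 4) / (1 - fps_X),
          (1 + 2 * fps_X - fps_X ^ 3) / (1 - fps_X),
          (1 + 2 * fps_X) / (1 - fps_X),
          (1 + 2 * fps_X + fps_X ^ 3) / (1 - fps_X),
          (1 + fps_X - 2 * fps_X ^ 2 + fps_X ^ 3) / (1 - fps_X) ^ 2,
          (1 + 2 * fps_X - fps_X ^ 2 - fps_X ^ 3) / (1 - fps_X - fps_X ^ 2)}"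
    (is "?S = {?H1, ?H2, ?H3, ?H4, ?H5, ?H6, ?H7, ?H8, ?H9, ?H10, ?H11}")
proof
  show "?S \<subseteq> {?H1, ?H2, ?H3, ?H4, ?H5, ?H6, ?H7, ?H8, ?H9, ?H10, ?H11}"
  proof
    fix h assume "h \<in> ?S"
    then obtain n and R :: "'k ncpoly set" where h: "h = series (component_dim n R)"
      and R: "quadratic_relations n R" "component_dim n R 1 = 3" "component_dim n R 2 = 3"
      unfolding hilbert_series_def by blast
    \<comment> \<open>The first component has the dimension of the generating space, so the number
      of letters is forced.\<close>
    have n: "n = 3" using component_dim_1[OF R(1)] R(2) by simp
    note S = series_1 series_2 series_3 series_4 series_5 series_6 series_7 series_8 series_9 series_10 series_11
    note S = S[of "component_dim n R", OF component_dim_0[OF R(1)] R(2,3)]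
    have "allowed (component_dim n R)" using allowed_component_dim R unfolding n by blast
    then show "h \<in> {?H1, ?H2, ?H3, ?H4, ?H5, ?H6, ?H7, ?H8, ?H9, ?H10, ?H11}"
      unfolding h allowed_def insert_iff using S by argo
  qed
  \<comment> \<open>All examples live over the given field. Where a normal form of the
    classification is reused, its parameters are set to 0, except for H_3, where
    \<open>c = 1\<close> meets the condition that \<open>c\<close> be nonzero.\<close>
  have "?H1 \<in> ?S"
  proof (rule realize_series[of mu1])
    fix d :: "nat \<Rightarrow> nat" assume z: "d 0 = 1" "d 1 = 3" "d 2 = 3" and D: "\<And>m k. has_dim (SV (mu1 :: 'k^3 \<Rightarrow> _) m) k \<Longrightarrow> d m = k"
    show "series d = ?H1" by (intro series_1[OF z] D dim_mu1 allI impI) auto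
  qed (simp add: mu1_def bil_def vlin_def vec3_eq_iff algebra_simps, simp only: ball_simps bex_simps, simp add: mu1_def vec3_eq_iff)
  moreover have "?H2 \<in> ?S"
  proof (rule realize_series[of "\<lambda>u v. vector [u$1 * v$2, u$3 * v$2, u$1 * v$3]"])
    fix d :: "nat \<Rightarrow> nat" assume z: "d 0 = 1" "d 1 = 3" "d 2 = 3" and D: "\<And>m k. has_dim (SV (\<lambda>u v. vector [u$1 * v$2, u$3 * v$2, u$1 * v$3]) m) k \<Longrightarrow> d m = k"
    show "series d = ?H2" by (intro series_2[OF z] D dim_kernels_0[of _ 0 0 0] allI impI) auto
  qed (simp add: bil_def vlin_def vec3_eq_iff algebra_simps, simp only: ball_simps bex_simps, simp add: vec3_eq_iff)
  moreover have "?H3 \<in> ?S"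
  proof (rule realize_series[of "\<lambda>u v. vector [u$1 * v$2, u$1 * v$3 + u$3 * v$2, u$3 * v$3]"])
    fix d :: "nat \<Rightarrow> nat" assume z: "d 0 = 1" "d 1 = 3" "d 2 = 3" and D: "\<And>m k. has_dim (SV (\<lambda>u v. vector [u$1 * v$2, u$1 * v$3 + u$3 * v$2, u$3 * v$3]) m) k \<Longrightarrow> d m = k"
    show "series d = ?H3" by (intro series_3[OF z] D dim_kernels_1[of _ 0 1] allI impI) auto
  qed (simp add: bil_def vlin_def vec3_eq_iff algebra_simps, simp only: ball_simps bex_simps, simp add: vec3_eq_iff)
  moreover have "?H4 \<in> ?S"
  proof (rule realize_series[of mu4])
    fix d :: "nat \<Rightarrow> nat" assume z: "d 0 = 1" "d 1 = 3" "d 2 = 3" and D: "\<And>m k. has_dim (SV (mu4 :: 'k^3 \<Rightarrow> _) m) k \<Longrightarrow> d m = k"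
    show "series d = ?H4" by (intro series_4[OF z] D dim_mu4 allI impI) auto
  qed (simp add: mu4_def bil_def vlin_def vec3_eq_iff algebra_simps, simp only: ball_simps bex_simps, simp add: mu4_def vec3_eq_iff)
  moreover have "?H5 \<in> ?S"
  proof (rule realize_series[of mu5])
    fix d :: "nat \<Rightarrow> nat" assume z: "d 0 = 1" "d 1 = 3" "d 2 = 3" and D: "\<And>m k. has_dim (SV (mu5 :: 'k^3 \<Rightarrow> _) m) k \<Longrightarrow> d m = k"
    show "series d = ?H5" by (intro series_5[OF z] D dim_mu5 allI impI) auto
  qed (simp add: mu5_def bil_def vlin_def vec3_eq_iff algebra_simps, simp only: ball_simps bex_simps, simp add: mu5_def vec3_eq_iff)
  moreover have "?H6 \<in> ?S"
  proof (rule realize_series[of mu6])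
    fix d :: "nat \<Rightarrow> nat" assume z: "d 0 = 1" "d 1 = 3" "d 2 = 3" and D: "\<And>m k. has_dim (SV (mu6 :: 'k^3 \<Rightarrow> _) m) k \<Longrightarrow> d m = k"
    show "series d = ?H6" by (intro series_6[OF z] D dim_mu6 allI impI) auto
  qed (simp add: mu6_def bil_def vlin_def vec3_eq_iff algebra_simps, simp only: ball_simps bex_simps, simp add: mu6_def vec3_eq_iff)
  moreover have "?H7 \<in> ?S"
  proof (rule realize_series[of "\<lambda>u v. vector [u$1 * v$2, u$3 * v$2, u$3 * v$3]"])
    fix d :: "nat \<Rightarrow> nat" assume z: "d 0 = 1" "d 1 = 3" "d 2 = 3" and D: "\<And>m k. has_dim (SV (\<lambda>u v. vector [u$1 * v$2, u$3 * v$2, u$3 * v$3]) m) k \<Longrightarrow> d m = k"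
    show "series d = ?H7" by (intro series_7[OF z] D dim_kernels_2[of _ 0] allI impI) auto
  qed (simp add: bil_def vlin_def vec3_eq_iff algebra_simps, simp only: ball_simps bex_simps, simp add: vec3_eq_iff)
  moreover have "?H8 \<in> ?S"
  proof (rule realize_series[of mu8])
    fix d :: "nat \<Rightarrow> nat" assume z: "d 0 = 1" "d 1 = 3" "d 2 = 3" and D: "\<And>m k. has_dim (SV (mu8 :: 'k^3 \<Rightarrow> _) m) k \<Longrightarrow> d m = k"
    show "series d = ?H8" by (intro series_8[OF z] D dim_mu8 allI impI) auto
  qed (simp add: mu8_def bil_def vlin_def vec3_eq_iff algebra_simps, simp only: ball_simps bex_simps, simp add: mu8_def vec3_eq_iff)
  moreover have "?H9 \<in> ?S"
  proof (rule realize_series[of "\<lambda>u v. vector [u$3 * v$2, u$1 * v$3, u$3 * v$3]"])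
    fix d :: "nat \<Rightarrow> nat" assume z: "d 0 = 1" "d 1 = 3" "d 2 = 3" and D: "\<And>m k. has_dim (SV (\<lambda>u v. vector [u$3 * v$2, u$1 * v$3, u$3 * v$3]) m) k \<Longrightarrow> d m = k"
    show "series d = ?H9" by (intro series_9[OF z] D dim_kernels_4 allI impI) auto
  qed (simp add: bil_def vlin_def vec3_eq_iff algebra_simps, simp only: ball_simps bex_simps, simp add: vec3_eq_iff)
  moreover have "?H10 \<in> ?S"
  proof (rule realize_series[of "\<lambda>u v. vector [u$3 * v$2, u$3 * v$3, u$2 * v$2]"])
    fix d :: "nat \<Rightarrow> nat" assume z: "d 0 = 1" "d 1 = 3" "d 2 = 3" and D: "\<And>m k. has_dim (SV (\<lambda>u v. vector [u$3 * v$2, u$3 * v$3, u$2 * v$2]) m) k \<Longrightarrow> d m = k"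
    show "series d = ?H10" by (intro series_10[OF z] D dim_plane[of _ 0 0] allI impI) auto
  qed (simp add: bil_def vlin_def vec3_eq_iff algebra_simps, simp only: ball_simps bex_simps, simp add: vec3_eq_iff)
  moreover have "?H11 \<in> ?S"
  proof (rule realize_series[of "\<lambda>u v. vector [u$2 * v$3, u$3 * v$2, u$3 * v$3]"])
    fix d :: "nat \<Rightarrow> nat" assume z: "d 0 = 1" "d 1 = 3" "d 2 = 3" and D: "\<And>m k. has_dim (SV (\<lambda>u v. vector [u$2 * v$3, u$3 * v$2, u$3 * v$3]) m) k \<Longrightarrow> d m = k"
    have "d m = fib_dim m" if "m \<ge> 3" for m by (rule D, rule dim_fib) (use that in auto)
    then have "d 3 = 5" "d 4 = 8" "\<forall>m\<ge>3. d (m + 2) = d (m + 1) + d m" by (simp_all add: eval_nat_numeral)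
    then show "series d = ?H11" by (rule series_11[OF z])
  qed (simp add: bil_def vlin_def vec3_eq_iff algebra_simps, simp only: ball_simps bex_simps, simp add: vec3_eq_iff)
  ultimately show "{?H1, ?H2, ?H3, ?H4, ?H5, ?H6, ?H7, ?H8, ?H9, ?H10, ?H11} \<subseteq> ?S" by (intro insert_subsetI empty_subsetI)
qed

end
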